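(* Let $G$ be a discrete group, let $-\rtimes_\mu G$ be a correspondence crossed product functor, and let $G$ act on a unital C*-algebra $A$ with a $G$-invariant state. Then the canonical map $\iota_{G,\mu}:C^*_\mu(G)\to A\rtimes_\mu G$ is isometric.
   Context: A $G$-C*-algebra is a C*-algebra $A$ with a homomorphism $\alpha:G\to\mathrm{Aut}(A)$; $A\rtimes_{\mathrm{alg}}G$ is the convolution $*$-algebra of finitely supported functions $G\to A$. $-\rtimes_uG$ and $-\rtimes_rG$ are the universal and reduced crossed product functors, and $\Lambda:-\rtimes_uG\Rightarrow-\rtimes_rG$ is the natural transformation of surjections which is the identity on $A\rtimes_{\mathrm{alg}}G$. A crossed product functor is a functor $-\rtimes_\mu G$ from $G$-C*-algebras (with $G$-equivariant $*$-homomorphisms) to C*-algebras, together with natural transformations $q:-\rtimes_uG\Rightarrow-\rtimes_\mu G$ and $s:-\rtimes_\mu G\Rightarrow-\rtimes_rG$ consisting of surjective $*$-homomorphisms with $s\circ q=\Lambda$. A crossed product functor is a correspondence functor if it satisfies one (equivalently all) of: (i) every $G$-equivariant completely positive map $\varphi:A\to B$ induces a completely positive map $A\rtimes_\mu G\to B\rtimes_\mu G$ given by $f\mapsto\varphi\circ f$ on $A\rtimes_{\mathrm{alg}}G$; (ii) for every $G$-invariant projection $e\in\mathcal{M}(A)$ the inclusion $eAe\to A$ induces an injective map $eAe\rtimes_\mu G\to A\rtimes_\mu G$; (iii) for every $G$-invariant hereditary subalgebra $B\subseteq A$ the inclusion induces an injective map $B\rtimes_\mu G\to A\rtimes_\mu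 G$. $C^*_\mu(G):=\mathbb{C}\rtimes_\mu G$ (trivial action on $\mathbb{C}$). For $A$ unital, $\iota_{G,\mu}:C^*_\mu(G)\to A\rtimes_\mu G$ is the $*$-homomorphism sending a finitely supported $f:G\to\mathbb{C}$ to the function $s\mapsto f(s)1_A$ (i.e. it is induced by the unital embedding $\mathbb{C}\to A$). *)

theory Defs
  imports Complex_Main "HOL-Library.Nonpos_Ints" "HOL-Algebra.Module"
begin

section \<open>*-algebras and C*-algebras\<close>

definition complex_ring :: "complex ring" where
  "complex_ring = \<lparr>carrier = UNIV, mult = (*), one = 1, zero = 0, add = (+)\<rparr>"

text \<open>
  Algebras need not be unital: the field \<open>one\<close> inherited from the ring record is
  unconstrained, unless \<open>unital\<close> (below) is assumed.
\<close>

record 'a star_algebra = "(complex, 'a) module" +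
  star :: "'a \<Rightarrow> 'a"

record 'a cstar_algebra = "'a star_algebra" +
  cnorm :: "'a \<Rightarrow> real"

record ('a, 'g) g_cstar_algebra = "'a cstar_algebra" +
  act :: "'g \<Rightarrow> 'a \<Rightarrow> 'a"

locale star_algebra = module complex_ring A
  for A :: "('a, 'm) star_algebra_scheme" (structure) +
  assumes mult_closed: "\<lbrakk>x \<in> carrier A; y \<in> carrier A\<rbrakk> \<Longrightarrow> x \<otimes> y \<in> carrier A"
    and mult_assoc: "\<lbrakk>x \<in> carrier A; y \<in> carrier A; z \<in> carrier A\<rbrakk> \<Longrightarrow> (x \<otimes> y) \<otimes> z = x \<otimes> (y \<otimes> z)"
    and mult_l_distr:
      "\<lbrakk>x \<in> carrier A; y \<in> carrier A; z \<in> carrier A\<rbrakk> \<Longrightarrow> (x \<oplus> y) \<otimes> z = x \<otimes> z \<oplus> y \<otimes> z"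
    and mult_r_distr:
      "\<lbrakk>x \<in> carrier A; y \<in> carrier A; z \<in> carrier A\<rbrakk> \<Longrightarrow> z \<otimes> (x \<oplus> y) = z \<otimes> x \<oplus> z \<otimes> y"
    and smult_mult_l: "\<lbrakk>x \<in> carrier A; y \<in> carrier A\<rbrakk> \<Longrightarrow> (c \<odot> x) \<otimes> y = c \<odot> (x \<otimes> y)"
    and smult_mult_r: "\<lbrakk>x \<in> carrier A; y \<in> carrier A\<rbrakk> \<Longrightarrow> x \<otimes> (c \<odot> y) = c \<odot> (x \<otimes> y)"
    and star_closed: "x \<in> carrier A \<Longrightarrow> star A x \<in> carrier A"
    and star_star: "x \<in> carrier A \<Longrightarrow> star A (star A x) = x"
    and star_add: "\<lbrakk>x \<in> carrier A; y \<in> carrier A\<rbrakk> \<Longrightarrow> star A (x \<oplus> y) = star A x \<oplus> star A y"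
    and star_smult: "x \<in> carrier A \<Longrightarrow> star A (c \<odot> x) = cnj c \<odot> star A x"
    and star_mult: "\<lbrakk>x \<in> carrier A; y \<in> carrier A\<rbrakk> \<Longrightarrow> star A (x \<otimes> y) = star A y \<otimes> star A x"

definition cstar_seminorm :: "('a, 'm) star_algebra_scheme \<Rightarrow> ('a \<Rightarrow> real) \<Rightarrow> bool" where
  "cstar_seminorm A p \<longleftrightarrow>
     (\<forall>x\<in>carrier A. 0 \<le> p x) \<and>
     (\<forall>c. \<forall>x\<in>carrier A. p (c \<odot>\<^bsub>A\<^esub> x) = cmod c * p x) \<and>
     (\<forall>x\<in>carrier A. \<forall>y\<in>carrier A. p (x \<oplus>\<^bsub>A\<^esub> y) \<le> p x + p y) \<and>
     (\<forall>x\<in>carrier A. \<forall>y\<in>carrier A. p (x \<otimes>\<^bsub>A\<^esub> y) \<le> p x * p y) \<and>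
     (\<forall>x\<in>carrier A. p (star A x \<otimes>\<^bsub>A\<^esub> x) = (p x)\<^sup>2)"

definition cauchy_seqs ::
    "('a, 'm) star_algebra_scheme \<Rightarrow> ('a \<Rightarrow> real) \<Rightarrow> (nat \<Rightarrow> 'a) set" where
  "cauchy_seqs A p = {x. (\<forall>n. x n \<in> carrier A) \<and>
     (\<forall>e>0. \<exists>N. \<forall>m\<ge>N. \<forall>n\<ge>N. p (x m \<ominus>\<^bsub>A\<^esub> x n) < e)}"

locale cstar_algebra = star_algebra A
  for A :: "('a, 'm) cstar_algebra_scheme" (structure) +
  assumes cnorm_seminorm: "cstar_seminorm A (cnorm A)"
    and cnorm_eq_0: "\<lbrakk>x \<in> carrier A; cnorm A x = 0\<rbrakk> \<Longrightarrow> x = \<zero>"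
    and complete: "u \<in> cauchy_seqs A (cnorm A) \<Longrightarrow>
      \<exists>l\<in>carrier A. (\<lambda>n. cnorm A (u n \<ominus> l)) \<longlonglongrightarrow> 0"

definition unital :: "('a, 'm) ring_scheme \<Rightarrow> bool" where
  "unital A \<longleftrightarrow> \<one>\<^bsub>A\<^esub> \<in> carrier A \<and>
     (\<forall>x\<in>carrier A. \<one>\<^bsub>A\<^esub> \<otimes>\<^bsub>A\<^esub> x = x \<and> x \<otimes>\<^bsub>A\<^esub> \<one>\<^bsub>A\<^esub> = x)"

definition linear_on ::
    "('a, 'm) star_algebra_scheme \<Rightarrow> ('b, 'n) star_algebra_scheme \<Rightarrow> ('a \<Rightarrow> 'b) \<Rightarrow> bool" where
  "linear_on A B f \<longleftrightarrow>
     (\<forall>x\<in>carrier A. f x \<in> carrier B) \<and>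
     (\<forall>x\<in>carrier A. \<forall>y\<in>carrier A. f (x \<oplus>\<^bsub>A\<^esub> y) = f x \<oplus>\<^bsub>B\<^esub> f y) \<and>
     (\<forall>c. \<forall>x\<in>carrier A. f (c \<odot>\<^bsub>A\<^esub> x) = c \<odot>\<^bsub>B\<^esub> f x)"

definition star_hom ::
    "('a, 'm) star_algebra_scheme \<Rightarrow> ('b, 'n) star_algebra_scheme \<Rightarrow> ('a \<Rightarrow> 'b) \<Rightarrow> bool" where
  "star_hom A B f \<longleftrightarrow> linear_on A B f \<and>
     (\<forall>x\<in>carrier A. \<forall>y\<in>carrier A. f (x \<otimes>\<^bsub>A\<^esub> y) = f x \<otimes>\<^bsub>B\<^esub> f y) \<and>
     (\<forall>x\<in>carrier A. f (star A x) = star B (f x))"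

definition surj_star_hom ::
    "('a, 'm) star_algebra_scheme \<Rightarrow> ('b, 'n) star_algebra_scheme \<Rightarrow> ('a \<Rightarrow> 'b) \<Rightarrow> bool" where
  "surj_star_hom A B f \<longleftrightarrow> star_hom A B f \<and> f ` carrier A = carrier B"


section \<open>Positivity, complete positivity, states\<close>

definition positive :: "('a, 'm) star_algebra_scheme \<Rightarrow> 'a \<Rightarrow> bool" where
  "positive A a \<longleftrightarrow> (\<exists>b\<in>carrier A. a = star A b \<otimes>\<^bsub>A\<^esub> b)"

text \<open>
  The *-algebra of n by n matrices over \<open>A\<close>; entries with an index outside \<open>{..<n}\<close> are \<open>0\<close>.
  When \<open>A\<close> is a C*-algebra it carries a (unique) C*-norm, which is not needed here:
  its positive elements are exactly the elements \<open>X* X\<close>.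
\<close>

definition matrix_algebra ::
    "nat \<Rightarrow> ('a, 'm) star_algebra_scheme \<Rightarrow> (nat \<Rightarrow> nat \<Rightarrow> 'a) star_algebra" where
  "matrix_algebra n A = \<lparr>
     carrier = {X. \<forall>i j. (if i < n \<and> j < n then X i j \<in> carrier A else X i j = \<zero>\<^bsub>A\<^esub>)},
     mult = (\<lambda>X Y i j. if i < n \<and> j < n then (\<Oplus>\<^bsub>A\<^esub>k\<in>{..<n}. X i k \<otimes>\<^bsub>A\<^esub> Y k j) else \<zero>\<^bsub>A\<^esub>),
     one = (\<lambda>i j. if i < n \<and> i = j then \<one>\<^bsub>A\<^esub> else \<zero>\<^bsub>A\<^esub>),
     zero = (\<lambda>i j. \<zero>\<^bsub>A\<^esub>),
     add = (\<lambda>X Y i j. X i j \<oplus>\<^bsub>A\<^esub> Y i j),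
     smult = (\<lambda>c X i j. c \<odot>\<^bsub>A\<^esub> X i j),
     star = (\<lambda>X i j. if i < n \<and> j < n then star A (X j i) else \<zero>\<^bsub>A\<^esub>)\<rparr>"

definition completely_positive ::
    "('a, 'm) star_algebra_scheme \<Rightarrow> ('b, 'n) star_algebra_scheme \<Rightarrow> ('a \<Rightarrow> 'b) \<Rightarrow> bool" where
  "completely_positive A B f \<longleftrightarrow> linear_on A B f \<and>
     (\<forall>n X. positive (matrix_algebra n A) X \<longrightarrow>
        positive (matrix_algebra n B) (\<lambda>i j. f (X i j)))"

definition state :: "('a, 'm) cstar_algebra_scheme \<Rightarrow> ('a \<Rightarrow> complex) \<Rightarrow> bool" where
  "state A \<phi> \<longleftrightarrow>
     (\<forall>x\<in>carrier A. \<forall>y\<in>carrier A. \<phi> (x \<oplus>\<^bsub>A\<^esub> y) = \<phi> x + \<phi> y) \<and>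
     (\<forall>c. \<forall>x\<in>carrier A. \<phi> (c \<odot>\<^bsub>A\<^esub> x) = c * \<phi> x) \<and>
     (\<forall>a. positive A a \<longrightarrow> \<phi> a \<in> \<real>\<^sub>\<ge>\<^sub>0) \<and>
     bdd_above {cmod (\<phi> x) |x. x \<in> carrier A \<and> cnorm A x \<le> 1} \<and>
     Sup {cmod (\<phi> x) |x. x \<in> carrier A \<and> cnorm A x \<le> 1} = 1"


section \<open>G-C*-algebras\<close>

definition star_aut :: "('a, 'm) star_algebra_scheme \<Rightarrow> ('a \<Rightarrow> 'a) \<Rightarrow> bool" where
  "star_aut A h \<longleftrightarrow> star_hom A A h \<and> bij_betw h (carrier A) (carrier A)"

definition g_cstar_algebra :: "('g, 'k) monoid_scheme \<Rightarrow> ('a, 'g) g_cstar_algebra \<Rightarrow> bool" where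
  "g_cstar_algebra G A \<longleftrightarrow> cstar_algebra A \<and>
     (\<forall>s\<in>carrier G. star_aut A (act A s)) \<and>
     (\<forall>s\<in>carrier G. \<forall>t\<in>carrier G. \<forall>x\<in>carrier A.
        act A (s \<otimes>\<^bsub>G\<^esub> t) x = act A s (act A t x))"

definition equivariant ::
    "('g, 'k) monoid_scheme \<Rightarrow> ('a, 'g) g_cstar_algebra \<Rightarrow> ('b, 'g) g_cstar_algebra \<Rightarrow>
     ('a \<Rightarrow> 'b) \<Rightarrow> bool" where
  "equivariant G A B f \<longleftrightarrow> (\<forall>s\<in>carrier G. \<forall>x\<in>carrier A. f (act A s x) = act B s (f x))"

definition invariant_state ::
    "('g, 'k) monoid_scheme \<Rightarrow> ('a, 'g) g_cstar_algebra \<Rightarrow> ('a \<Rightarrow> complex) \<Rightarrow> bool" where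
  "invariant_state G A \<phi> \<longleftrightarrow> state A \<phi> \<and>
     (\<forall>s\<in>carrier G. \<forall>x\<in>carrier A. \<phi> (act A s x) = \<phi> x)"

text \<open>
  The C*-algebra of complex numbers with the trivial action, transported along an
  injection \<open>e\<close> into the type in which the G-C*-algebras live.
\<close>

definition scalars :: "(complex \<Rightarrow> 'a) \<Rightarrow> ('a, 'g) g_cstar_algebra" where
  "scalars e = \<lparr>
     carrier = range e,
     mult = (\<lambda>x y. e (inv_into UNIV e x * inv_into UNIV e y)),
     one = e 1,
     zero = e 0,
     add = (\<lambda>x y. e (inv_into UNIV e x + inv_into UNIV e y)),
     smult = (\<lambda>c x. e (c * inv_into UNIV e x)),
     star = (\<lambda>x. e (cnj (inv_into UNIV e x))),
     cnorm = (\<lambda>x. cmod (inv_into UNIV e x)),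
     act = (\<lambda>s x. x)\<rparr>"


section \<open>The algebraic, universal and reduced crossed products\<close>

text \<open>Finitely supported functions are extended by \<open>0\<close> outside \<open>carrier G\<close>.\<close>

definition alg_crossed_product ::
    "('g, 'k) monoid_scheme \<Rightarrow> ('a, 'g) g_cstar_algebra \<Rightarrow> ('g \<Rightarrow> 'a) star_algebra" where
  "alg_crossed_product G A = \<lparr>
     carrier = {f. (\<forall>s\<in>carrier G. f s \<in> carrier A) \<and> (\<forall>s. s \<notin> carrier G \<longrightarrow> f s = \<zero>\<^bsub>A\<^esub>) \<and>
                   finite {s. f s \<noteq> \<zero>\<^bsub>A\<^esub>}},
     mult = (\<lambda>f g t. if t \<in> carrier G
               then (\<Oplus>\<^bsub>A\<^esub>s\<in>{s. f s \<noteq> \<zero>\<^bsub>A\<^esub>}. f s \<otimes>\<^bsub>A\<^esub> act A s (g (inv\<^bsub>G\<^esub> s \<otimes>\<^bsub>G\<^esub> t))) else \<zero>\<^bsub>A\<^esub>),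
     one = (\<lambda>t. if t = \<one>\<^bsub>G\<^esub> then \<one>\<^bsub>A\<^esub> else \<zero>\<^bsub>A\<^esub>),
     zero = (\<lambda>t. \<zero>\<^bsub>A\<^esub>),
     add = (\<lambda>f g t. f t \<oplus>\<^bsub>A\<^esub> g t),
     smult = (\<lambda>c f t. c \<odot>\<^bsub>A\<^esub> f t),
     star = (\<lambda>f t. if t \<in> carrier G then act A t (star A (f (inv\<^bsub>G\<^esub> t))) else \<zero>\<^bsub>A\<^esub>)\<rparr>"

text \<open>
  The universal norm is the largest C*-seminorm (all of them are dominated by the
  l1-norm, so the supremum is over a bounded set).
\<close>

definition universal_norm ::
    "('g, 'k) monoid_scheme \<Rightarrow> ('a, 'g) g_cstar_algebra \<Rightarrow> ('g \<Rightarrow> 'a) \<Rightarrow> real" where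
  "universal_norm G A f = Sup {p f |p. cstar_seminorm (alg_crossed_product G A) p}"

text \<open>
  The reduced norm is the operator norm of the regular representation on the Hilbert
  \<open>A\<close>-module \<open>l2(G, A)\<close>, computed on its dense submodule of finitely supported functions:
  \<open>(\<lambda>(f)\<xi>)(t) = \<Sum>s. act t\<inverse> (f s) \<cdot> \<xi>(s\<inverse>t)\<close> and \<open>\<parallel>\<xi>\<parallel>\<^sup>2 = \<parallel>\<Sum>s. \<xi>(s)* \<xi>(s)\<parallel>\<close>.
\<close>

definition l2_norm :: "('a, 'g) g_cstar_algebra \<Rightarrow> ('g \<Rightarrow> 'a) \<Rightarrow> real" where
  "l2_norm A \<xi> =
     sqrt (cnorm A (\<Oplus>\<^bsub>A\<^esub>s\<in>{s. \<xi> s \<noteq> \<zero>\<^bsub>A\<^esub>}. star A (\<xi> s) \<otimes>\<^bsub>A\<^esub> \<xi> s))"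

definition regular_rep ::
    "('g, 'k) monoid_scheme \<Rightarrow> ('a, 'g) g_cstar_algebra \<Rightarrow>
     ('g \<Rightarrow> 'a) \<Rightarrow> ('g \<Rightarrow> 'a) \<Rightarrow> ('g \<Rightarrow> 'a)" where
  "regular_rep G A f \<xi> = (\<lambda>t. if t \<in> carrier G
     then (\<Oplus>\<^bsub>A\<^esub>s\<in>{s. f s \<noteq> \<zero>\<^bsub>A\<^esub>}. act A (inv\<^bsub>G\<^esub> t) (f s) \<otimes>\<^bsub>A\<^esub> \<xi> (inv\<^bsub>G\<^esub> s \<otimes>\<^bsub>G\<^esub> t)) else \<zero>\<^bsub>A\<^esub>)"

definition reduced_norm ::
    "('g, 'k) monoid_scheme \<Rightarrow> ('a, 'g) g_cstar_algebra \<Rightarrow> ('g \<Rightarrow> 'a) \<Rightarrow> real" where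
  "reduced_norm G A f = Sup {l2_norm A (regular_rep G A f \<xi>) |\<xi>.
     \<xi> \<in> carrier (alg_crossed_product G A) \<and> l2_norm A \<xi> \<le> 1}"

text \<open>
  Separation and completion of a *-algebra in a C*-seminorm: Cauchy sequences modulo
  null sequences.
\<close>

definition null_rel ::
    "('a, 'm) star_algebra_scheme \<Rightarrow> ('a \<Rightarrow> real) \<Rightarrow> ((nat \<Rightarrow> 'a) \<times> (nat \<Rightarrow> 'a)) set" where
  "null_rel A p = {(x, y). x \<in> cauchy_seqs A p \<and> y \<in> cauchy_seqs A p \<and>
     (\<lambda>n. p (x n \<ominus>\<^bsub>A\<^esub> y n)) \<longlonglongrightarrow> 0}"

definition completion ::
    "('a, 'm) star_algebra_scheme \<Rightarrow> ('a \<Rightarrow> real) \<Rightarrow> (nat \<Rightarrow> 'a) set cstar_algebra" where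
  "completion A p = \<lparr>
     carrier = cauchy_seqs A p // null_rel A p,
     mult = (\<lambda>X Y. \<Union>x\<in>X. \<Union>y\<in>Y. null_rel A p `` {\<lambda>n. x n \<otimes>\<^bsub>A\<^esub> y n}),
     one = null_rel A p `` {\<lambda>n. \<one>\<^bsub>A\<^esub>},
     zero = null_rel A p `` {\<lambda>n. \<zero>\<^bsub>A\<^esub>},
     add = (\<lambda>X Y. \<Union>x\<in>X. \<Union>y\<in>Y. null_rel A p `` {\<lambda>n. x n \<oplus>\<^bsub>A\<^esub> y n}),
     smult = (\<lambda>c X. \<Union>x\<in>X. null_rel A p `` {\<lambda>n. c \<odot>\<^bsub>A\<^esub> x n}),
     star = (\<lambda>X. \<Union>x\<in>X. null_rel A p `` {\<lambda>n. star A (x n)}),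
     cnorm = (\<lambda>X. THE r. \<forall>x\<in>X. (\<lambda>n. p (x n)) \<longlonglongrightarrow> r)\<rparr>"

definition completion_in ::
    "('a, 'm) star_algebra_scheme \<Rightarrow> ('a \<Rightarrow> real) \<Rightarrow> 'a \<Rightarrow> (nat \<Rightarrow> 'a) set" where
  "completion_in A p a = null_rel A p `` {\<lambda>n. a}"

text \<open>
  The extension by continuity of a bounded map \<open>h\<close> into \<open>B\<close> to the completions;
  the equivalence class does not depend on the chosen representative.
\<close>

definition completion_map ::
    "('b, 'm) star_algebra_scheme \<Rightarrow> ('b \<Rightarrow> real) \<Rightarrow> ('a \<Rightarrow> 'b) \<Rightarrow>
     (nat \<Rightarrow> 'a) set \<Rightarrow> (nat \<Rightarrow> 'b) set" where
  "completion_map B p h X = (\<Union>x\<in>X. null_rel B p `` {\<lambda>n. h (x n)})"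

definition universal_crossed_product ::
    "('g, 'k) monoid_scheme \<Rightarrow> ('a, 'g) g_cstar_algebra \<Rightarrow> (nat \<Rightarrow> 'g \<Rightarrow> 'a) set cstar_algebra" where
  "universal_crossed_product G A = completion (alg_crossed_product G A) (universal_norm G A)"

definition universal_map ::
    "('g, 'k) monoid_scheme \<Rightarrow> ('b, 'g) g_cstar_algebra \<Rightarrow> ('a \<Rightarrow> 'b) \<Rightarrow>
     (nat \<Rightarrow> 'g \<Rightarrow> 'a) set \<Rightarrow> (nat \<Rightarrow> 'g \<Rightarrow> 'b) set" where
  "universal_map G B h =
     completion_map (alg_crossed_product G B) (universal_norm G B) (\<lambda>f. h \<circ> f)"

definition reduced_crossed_product ::
    "('g, 'k) monoid_scheme \<Rightarrow> ('a, 'g) g_cstar_algebra \<Rightarrow> (nat \<Rightarrow> 'g \<Rightarrow> 'a) set cstar_algebra" where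
  "reduced_crossed_product G A = completion (alg_crossed_product G A) (reduced_norm G A)"

definition reduced_map ::
    "('g, 'k) monoid_scheme \<Rightarrow> ('b, 'g) g_cstar_algebra \<Rightarrow> ('a \<Rightarrow> 'b) \<Rightarrow>
     (nat \<Rightarrow> 'g \<Rightarrow> 'a) set \<Rightarrow> (nat \<Rightarrow> 'g \<Rightarrow> 'b) set" where
  "reduced_map G B h =
     completion_map (alg_crossed_product G B) (reduced_norm G B) (\<lambda>f. h \<circ> f)"

definition Lambda ::
    "('g, 'k) monoid_scheme \<Rightarrow> ('a, 'g) g_cstar_algebra \<Rightarrow>
     (nat \<Rightarrow> 'g \<Rightarrow> 'a) set \<Rightarrow> (nat \<Rightarrow> 'g \<Rightarrow> 'a) set" where
  "Lambda G A = completion_map (alg_crossed_product G A) (reduced_norm G A) (\<lambda>f. f)"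


section \<open>Crossed product functors\<close>

text \<open>
  A functor is given by its action on objects and, for given source and target, on morphisms.
  The G-C*-algebras range over all those with carrier contained in an arbitrary type \<open>'a\<close>,
  and the values are C*-algebras with carrier contained in an arbitrary type \<open>'v\<close>.
\<close>

record ('a, 'g, 'v) crossed_product =
  obj :: "('a, 'g) g_cstar_algebra \<Rightarrow> 'v cstar_algebra"
  mor :: "('a, 'g) g_cstar_algebra \<Rightarrow> ('a, 'g) g_cstar_algebra \<Rightarrow> ('a \<Rightarrow> 'a) \<Rightarrow> 'v \<Rightarrow> 'v"
  from_universal :: "('a, 'g) g_cstar_algebra \<Rightarrow> (nat \<Rightarrow> 'g \<Rightarrow> 'a) set \<Rightarrow> 'v"
  to_reduced :: "('a, 'g) g_cstar_algebra \<Rightarrow> 'v \<Rightarrow> (nat \<Rightarrow> 'g \<Rightarrow> 'a) set"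

definition g_morphism ::
    "('g, 'k) monoid_scheme \<Rightarrow> ('a, 'g) g_cstar_algebra \<Rightarrow> ('b, 'g) g_cstar_algebra \<Rightarrow>
     ('a \<Rightarrow> 'b) \<Rightarrow> bool" where
  "g_morphism G A B f \<longleftrightarrow> g_cstar_algebra G A \<and> g_cstar_algebra G B \<and>
     star_hom A B f \<and> equivariant G A B f"

locale crossed_product_functor =
  fixes G :: "('g, 'k) monoid_scheme"
    and \<mu> :: "('a, 'g, 'v) crossed_product"
  assumes obj_cstar: "g_cstar_algebra G A \<Longrightarrow> cstar_algebra (obj \<mu> A)"
    and mor_hom: "g_morphism G A B f \<Longrightarrow> star_hom (obj \<mu> A) (obj \<mu> B) (mor \<mu> A B f)"
    and mor_id: "\<lbrakk>g_cstar_algebra G A; x \<in> carrier (obj \<mu> A)\<rbrakk> \<Longrightarrow> mor \<mu> A A (\<lambda>a. a) x = x"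
    and mor_comp: "\<lbrakk>g_morphism G A B f; g_morphism G B C h; x \<in> carrier (obj \<mu> A)\<rbrakk> \<Longrightarrow>
      mor \<mu> A C (h \<circ> f) x = mor \<mu> B C h (mor \<mu> A B f x)"
    and from_universal_surj: "g_cstar_algebra G A \<Longrightarrow>
      surj_star_hom (universal_crossed_product G A) (obj \<mu> A) (from_universal \<mu> A)"
    and from_universal_natural:
      "\<lbrakk>g_morphism G A B f; X \<in> carrier (universal_crossed_product G A)\<rbrakk> \<Longrightarrow>
      mor \<mu> A B f (from_universal \<mu> A X) = from_universal \<mu> B (universal_map G B f X)"
    and to_reduced_surj: "g_cstar_algebra G A \<Longrightarrow>
      surj_star_hom (obj \<mu> A) (reduced_crossed_product G A) (to_reduced \<mu> A)"
    and to_reduced_natural: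
      "\<lbrakk>g_morphism G A B f; x \<in> carrier (obj \<mu> A)\<rbrakk> \<Longrightarrow>
      reduced_map G B f (to_reduced \<mu> A x) = to_reduced \<mu> B (mor \<mu> A B f x)"
    and to_reduced_from_universal:
      "\<lbrakk>g_cstar_algebra G A; X \<in> carrier (universal_crossed_product G A)\<rbrakk> \<Longrightarrow>
      to_reduced \<mu> A (from_universal \<mu> A X) = Lambda G A X"

definition alg_in ::
    "('g, 'k) monoid_scheme \<Rightarrow> ('a, 'g, 'v) crossed_product \<Rightarrow> ('a, 'g) g_cstar_algebra \<Rightarrow>
     ('g \<Rightarrow> 'a) \<Rightarrow> 'v" where
  "alg_in G \<mu> A f =
     from_universal \<mu> A (completion_in (alg_crossed_product G A) (universal_norm G A) f)"

text \<open>
  Of the equivalent characterisations of correspondence functors, the one by functoriality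
  for equivariant completely positive maps is taken as the definition.
\<close>

locale correspondence_functor = crossed_product_functor G \<mu>
  for G :: "('g, 'k) monoid_scheme"
    and \<mu> :: "('a, 'g, 'v) crossed_product" +
  assumes cp_functorial:
    "\<lbrakk>g_cstar_algebra G A; g_cstar_algebra G B; completely_positive A B \<phi>;
      equivariant G A B \<phi>\<rbrakk> \<Longrightarrow>
     \<exists>\<Phi>. completely_positive (obj \<mu> A) (obj \<mu> B) \<Phi> \<and>
       (\<forall>f\<in>carrier (alg_crossed_product G A).
          \<Phi> (alg_in G \<mu> A f) = alg_in G \<mu> B (\<phi> \<circ> f))"

definition group_cstar_algebra ::
    "('a, 'g, 'v) crossed_product \<Rightarrow> (complex \<Rightarrow> 'a) \<Rightarrow> 'v cstar_algebra" where
  "group_cstar_algebra \<mu> e = obj \<mu> (scalars e)"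

definition canonical_map ::
    "('a, 'g, 'v) crossed_product \<Rightarrow> (complex \<Rightarrow> 'a) \<Rightarrow> ('a, 'g) g_cstar_algebra \<Rightarrow> 'v \<Rightarrow> 'v" where
  "canonical_map \<mu> e A = mor \<mu> (scalars e) A (\<lambda>z. inv_into UNIV e z \<odot>\<^bsub>A\<^esub> \<one>\<^bsub>A\<^esub>)"

end

theory Submission
  imports Defs
begin

text \<open>
  The state \<open>\<phi>\<close> is completely positive and equivariant, so it induces a completely positive map \<open>\<Phi>\<close>
  which is a left inverse of \<open>\<iota>\<close> on the image of the convolution algebra. If \<open>k\<close> is self-adjoint there
  and \<open>\<parallel>\<iota>(k)\<parallel> \<le> 1\<close>, then \<open>1 - \<iota>(k)\<^sup>2\<close> is a square, so applying \<open>\<Phi>\<close> shows that \<open>1 - k\<^sup>2\<close> is of the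
  form \<open>b* b\<close>, hence \<open>\<parallel>k\<parallel> \<le> 1\<close>. The C*-identity and density extend this to all elements.

  The C*-theory used here rests on one device replacing spectral theory: if \<open>x, y\<close> are commuting
  self-adjoint elements with \<open>x\<^sup>2 + y\<^sup>2 = 1\<close>, then \<open>x + i y\<close> is unitary and so \<open>\<parallel>x\<parallel> \<le> 1\<close>.
\<close>

section \<open>Star algebras and C*-seminorms\<close>

text \<open>\<Phi> need not be multiplicative, no norm bound on it is given, and it is prescribed
  only on the image of the convolution algebra. So a norm estimate has to be encoded as an equation
  that positivity transports, and decoded afterwards. Decoding is the hard half:
  \<open>positive\<close> returns an arbitrary b, whereas the unitary device needs a self-adjoint
  root of b* b that commutes with k. This is the classical fact that b* b has nonnegative spectrum,
  to be proved without spectra.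

  The definitions impose three more tasks. The universal norm is a real supremum, so the
  C*-seminorms of the convolution algebra must be bounded in common before anything can be said
  about crossed products. Functoriality accepts only completely positive maps, so the state has to
  be handled on matrices of every size, which calls for factorising positive semidefinite complex
  matrices. Finally, a state is normalised by its norm, and \<phi>(1) = 1, which makes \<Phi> a left
  inverse, has to be derived.\<close>

lemma complex_ring_simps [simp]:
  "carrier complex_ring = UNIV" "\<one>\<^bsub>complex_ring\<^esub> = 1" "\<zero>\<^bsub>complex_ring\<^esub> = 0"
  "x \<oplus>\<^bsub>complex_ring\<^esub> y = x + y" "x \<otimes>\<^bsub>complex_ring\<^esub> y = x * y"
  by (simp_all add: complex_ring_def)

lemma cring_complex_ring: "cring complex_ring"
proof (rule cringI)
  show "abelian_group complex_ring"
  proof (rule abelian_groupI, simp_all add: algebra_simps)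
    show "\<exists>y. x + y = 0" for x :: complex
      by (rule exI[of _ "- x"]) simp
  qed
qed (auto intro: comm_monoidI simp: algebra_simps)

text \<open>The unit is an explicit element because the field \<open>one\<close> of the values of a crossed product functor is
  unconstrained.\<close>

definition is_unit :: "('a, 'm) ring_scheme \<Rightarrow> 'a \<Rightarrow> bool" where
  "is_unit A u \<longleftrightarrow> u \<in> carrier A \<and> (\<forall>x\<in>carrier A. u \<otimes>\<^bsub>A\<^esub> x = x \<and> x \<otimes>\<^bsub>A\<^esub> u = x)"

context star_algebra
begin

lemmas [simp] = mult_closed star_closed star_star star_smult star_mult star_add

lemma scale_closed [simp]: "x \<in> carrier A \<Longrightarrow> c \<odot> x \<in> carrier A"
  using smult_closed by simp

lemma scale_add_left: "x \<in> carrier A \<Longrightarrow> (c + d) \<odot> x = c \<odot> x \<oplus> d \<odot> x"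
  using smult_l_distr[of c d x] by simp

lemma scale_add_right:
  "\<lbrakk>x \<in> carrier A; y \<in> carrier A\<rbrakk> \<Longrightarrow> c \<odot> (x \<oplus> y) = c \<odot> x \<oplus> c \<odot> y"
  using smult_r_distr[of c x y] by simp

lemma scale_scale [simp]: "x \<in> carrier A \<Longrightarrow> c \<odot> (d \<odot> x) = (c * d) \<odot> x"
  using smult_assoc1[of c d x] by simp

lemma scale_one [simp]: "x \<in> carrier A \<Longrightarrow> 1 \<odot> x = x"
  using smult_one[of x] by simp

lemma scale_zero_left [simp]: "x \<in> carrier A \<Longrightarrow> 0 \<odot> x = \<zero>"
  using smult_l_null[of x] by simp

lemma scale_zero_right [simp]: "c \<odot> \<zero> = \<zero>"
  using smult_r_null[of c] by simp

lemma minus_eq_scale: "x \<in> carrier A \<Longrightarrow> \<ominus> x = (-1) \<odot> x"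
proof (rule minus_equality)
  assume x: "x \<in> carrier A"
  have "(-1) \<odot> x \<oplus> x = (-1 + 1) \<odot> x"
    using scale_add_left[OF x, of "-1" 1] x by simp
  then show "(-1) \<odot> x \<oplus> x = \<zero>" using x by simp
qed auto

lemma diff_eq_scale: "y \<in> carrier A \<Longrightarrow> x \<ominus> y = x \<oplus> (-1) \<odot> y"
  by (simp add: a_minus_def minus_eq_scale)

lemma mult_scale_left [simp]:
  "\<lbrakk>x \<in> carrier A; y \<in> carrier A\<rbrakk> \<Longrightarrow> (c \<odot> x) \<otimes> y = c \<odot> (x \<otimes> y)"
  by (rule smult_mult_l)

lemma mult_scale_right [simp]:
  "\<lbrakk>x \<in> carrier A; y \<in> carrier A\<rbrakk> \<Longrightarrow> x \<otimes> (c \<odot> y) = c \<odot> (x \<otimes> y)"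
  by (rule smult_mult_r)

lemma mult_zero_left [simp]: "x \<in> carrier A \<Longrightarrow> \<zero> \<otimes> x = \<zero>"
  using mult_scale_left[of \<zero> x 0] by simp

lemma mult_zero_right [simp]: "x \<in> carrier A \<Longrightarrow> x \<otimes> \<zero> = \<zero>"
  using mult_scale_right[of x \<zero> 0] by simp

lemma star_zero [simp]: "star A \<zero> = \<zero>"
  using star_smult[of \<zero> 0] by simp

lemma star_minus [simp]: "x \<in> carrier A \<Longrightarrow> star A (\<ominus> x) = \<ominus> star A x"
  by (simp add: minus_eq_scale)

lemma star_diff [simp]:
  "\<lbrakk>x \<in> carrier A; y \<in> carrier A\<rbrakk> \<Longrightarrow> star A (x \<ominus> y) = star A x \<ominus> star A y"
  by (simp add: diff_eq_scale)

lemma scale_diff_right: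
  "\<lbrakk>x \<in> carrier A; y \<in> carrier A\<rbrakk> \<Longrightarrow> c \<odot> (x \<ominus> y) = c \<odot> x \<ominus> c \<odot> y"
  by (simp add: diff_eq_scale scale_add_right)

lemma mult_diff_left:
  "\<lbrakk>x \<in> carrier A; y \<in> carrier A; z \<in> carrier A\<rbrakk> \<Longrightarrow> (x \<ominus> y) \<otimes> z = x \<otimes> z \<ominus> y \<otimes> z"
  by (simp add: diff_eq_scale mult_l_distr)

lemma mult_diff_right:
  "\<lbrakk>x \<in> carrier A; y \<in> carrier A; z \<in> carrier A\<rbrakk> \<Longrightarrow> z \<otimes> (x \<ominus> y) = z \<otimes> x \<ominus> z \<otimes> y"
  by (simp add: diff_eq_scale mult_r_distr)

lemma diff_self [simp]: "x \<in> carrier A \<Longrightarrow> x \<ominus> x = \<zero>"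
  by (simp add: a_minus_def r_neg)

lemma diff_zero [simp]: "x \<in> carrier A \<Longrightarrow> x \<ominus> \<zero> = x"
  by (simp add: diff_eq_scale)

lemma diff_eq_zero: "\<lbrakk>x \<in> carrier A; y \<in> carrier A; x \<ominus> y = \<zero>\<rbrakk> \<Longrightarrow> x = y"
  by (metis a_minus_def add.inv_closed minus_equality minus_minus)

lemma diff_eq_iff:
  "\<lbrakk>x \<in> carrier A; y \<in> carrier A; z \<in> carrier A\<rbrakk> \<Longrightarrow> x \<ominus> y = z \<longleftrightarrow> x = z \<oplus> y"
  unfolding a_minus_def by (metis add.inv_solve_right')

lemma diff_split:
  "\<lbrakk>x \<in> carrier A; y \<in> carrier A; z \<in> carrier A\<rbrakk> \<Longrightarrow> x \<ominus> z = (x \<ominus> y) \<oplus> (y \<ominus> z)"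
  by (simp add: a_minus_def a_assoc r_neg1 r_neg2)

lemma add_diff_add:
  "\<lbrakk>x \<in> carrier A; y \<in> carrier A; z \<in> carrier A; w \<in> carrier A\<rbrakk> \<Longrightarrow>
    (x \<oplus> y) \<ominus> (z \<oplus> w) = (x \<ominus> z) \<oplus> (y \<ominus> w)"
  by (simp add: diff_eq_scale scale_add_right a_ac)

lemma mult_diff_mult:
  "\<lbrakk>x \<in> carrier A; y \<in> carrier A; z \<in> carrier A; w \<in> carrier A\<rbrakk> \<Longrightarrow>
    x \<otimes> y \<ominus> z \<otimes> w = x \<otimes> (y \<ominus> w) \<oplus> (x \<ominus> z) \<otimes> w"
  by (simp add: mult_diff_right mult_diff_left flip: diff_split)

lemma scale_two: "x \<in> carrier A \<Longrightarrow> 2 \<odot> x = x \<oplus> x"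
  using scale_add_left[of x 1 1] by simp

lemma star_unit: "is_unit A u \<Longrightarrow> star A u = u"
  unfolding is_unit_def by (metis star_closed star_mult star_star)

lemma comm_diff_unit:
  assumes "is_unit A u" "x \<in> carrier A" "v \<in> carrier A" "v \<otimes> x = x \<otimes> v"
  shows "v \<otimes> (u \<ominus> x) = (u \<ominus> x) \<otimes> v"
  using assms by (simp add: is_unit_def mult_diff_left mult_diff_right)

lemma sum_add_diff:
  assumes "x \<in> carrier A" "y \<in> carrier A"
  shows "(x \<oplus> y) \<oplus> (x \<ominus> y) = 2 \<odot> x" and "(x \<oplus> y) \<ominus> (x \<ominus> y) = 2 \<odot> y"
    and "(x \<ominus> y) \<oplus> (x \<oplus> y) = 2 \<odot> x"
proof -
  have *: "a \<oplus> b \<oplus> (a \<oplus> c \<odot> b) = a \<oplus> a \<oplus> (b \<oplus> c \<odot> b)" if "a \<in> carrier A" "b \<in> carrier A" for a b c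
    using that by (simp add: a_ac)
  have c: "b \<oplus> (-1) \<odot> b = \<zero>" if "b \<in> carrier A" for b
    using that scale_add_left[of b 1 "-1"] by simp
  show 1: "(x \<oplus> y) \<oplus> (x \<ominus> y) = 2 \<odot> x"
    using assms by (simp add: diff_eq_scale * c scale_two)
  show "(x \<ominus> y) \<oplus> (x \<oplus> y) = 2 \<odot> x"
    using 1 assms by (simp add: a_comm)
  have "(x \<oplus> y) \<ominus> (x \<ominus> y) = (y \<oplus> x) \<oplus> (y \<oplus> (-1) \<odot> x)"
    using assms by (simp add: diff_eq_scale scale_add_right a_ac)
  then show "(x \<oplus> y) \<ominus> (x \<ominus> y) = 2 \<odot> y"
    using assms *[of y x "-1"] c[of x] by (simp add: scale_two)
qed

lemma add_neg [simp]: "x \<in> carrier A \<Longrightarrow> x \<oplus> (-1) \<odot> x = \<zero>"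
  using scale_add_left[of x 1 "-1"] by simp

lemma add_neg_cancel [simp]:
  "\<lbrakk>x \<in> carrier A; y \<in> carrier A\<rbrakk> \<Longrightarrow> x \<oplus> ((-1) \<odot> x \<oplus> y) = y"
  by (simp flip: a_assoc)

lemma diff_diff: "\<lbrakk>x \<in> carrier A; y \<in> carrier A\<rbrakk> \<Longrightarrow> x \<ominus> (x \<ominus> y) = y"
  by (simp add: diff_eq_scale scale_add_right)

lemma diff_add_cancel:
  "\<lbrakk>x \<in> carrier A; y \<in> carrier A\<rbrakk> \<Longrightarrow> x \<oplus> (-1) \<odot> (y \<oplus> x) = (-1) \<odot> y"
  by (simp add: scale_add_right a_lcomm[of x])

lemma scale_two_diff:
  "\<lbrakk>x \<in> carrier A; y \<in> carrier A\<rbrakk> \<Longrightarrow> 2 \<odot> (x \<ominus> y) = (x \<ominus> 2 \<odot> y) \<oplus> x"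
  using scale_two[of x] by (simp add: diff_eq_scale scale_add_right a_ac)

lemma add_neg_add:
  "\<lbrakk>x \<in> carrier A; y \<in> carrier A\<rbrakk> \<Longrightarrow> (x \<oplus> y) \<oplus> ((-1) \<odot> x \<oplus> y) = y \<oplus> y"
  by (simp add: a_assoc a_lcomm[of y "(-1) \<odot> x"])

end

locale seminormed_star_algebra = star_algebra A
  for A :: "('a, 'm) star_algebra_scheme" (structure) +
  fixes p :: "'a \<Rightarrow> real"
  assumes seminorm: "cstar_seminorm A p"
begin

lemma p_nonneg [simp]: "x \<in> carrier A \<Longrightarrow> 0 \<le> p x"
  and p_scale [simp]: "x \<in> carrier A \<Longrightarrow> p (c \<odot> x) = cmod c * p x"
  and p_triangle: "\<lbrakk>x \<in> carrier A; y \<in> carrier A\<rbrakk> \<Longrightarrow> p (x \<oplus> y) \<le> p x + p y"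
  and p_mult: "\<lbrakk>x \<in> carrier A; y \<in> carrier A\<rbrakk> \<Longrightarrow> p (x \<otimes> y) \<le> p x * p y"
  and p_cstar: "x \<in> carrier A \<Longrightarrow> p (star A x \<otimes> x) = (p x)\<^sup>2"
  using seminorm unfolding cstar_seminorm_def by auto

lemma p_zero [simp]: "p \<zero> = 0"
  using p_scale[of \<zero> 0] by simp

lemma p_minus [simp]: "x \<in> carrier A \<Longrightarrow> p (\<ominus> x) = p x"
  by (simp add: minus_eq_scale)

lemma p_diff_triangle: "\<lbrakk>x \<in> carrier A; y \<in> carrier A\<rbrakk> \<Longrightarrow> p (x \<ominus> y) \<le> p x + p y"
  by (metis a_minus_def add.inv_closed p_minus p_triangle)

lemma p_diff_trans:
  "\<lbrakk>x \<in> carrier A; y \<in> carrier A; z \<in> carrier A\<rbrakk> \<Longrightarrow> p (x \<ominus> z) \<le> p (x \<ominus> y) + p (y \<ominus> z)"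
  by (metis diff_split minus_closed p_triangle)

lemma p_diff_commute: "\<lbrakk>x \<in> carrier A; y \<in> carrier A\<rbrakk> \<Longrightarrow> p (x \<ominus> y) = p (y \<ominus> x)"
proof -
  assume a: "x \<in> carrier A" "y \<in> carrier A"
  have "x \<ominus> y = (-1) \<odot> (y \<ominus> x)"
    using a by (simp add: diff_eq_scale scale_add_right a_ac)
  then show ?thesis using a by simp
qed

text \<open>The C*-identity and submultiplicativity give
  \<open>(p x)\<^sup>2 \<le> p (star A x) * p x\<close>; cancelling \<open>p x\<close> is what makes
  the involution isometric without an axiom saying so.\<close>

lemma p_star_le: "x \<in> carrier A \<Longrightarrow> p x \<le> p (star A x)"
proof -
  assume x: "x \<in> carrier A"
  have "p x * p x \<le> p (star A x) * p x"
    using p_mult[of "star A x" x] p_cstar[of x] x by (simp add: power2_eq_square)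
  then show ?thesis
    using x by (cases "p x = 0") (auto simp: mult_le_cancel_right dest: p_nonneg)
qed

lemma p_star [simp]: "x \<in> carrier A \<Longrightarrow> p (star A x) = p x"
  using p_star_le[of x] p_star_le[of "star A x"] by simp

lemma p_square: "\<lbrakk>x \<in> carrier A; star A x = x\<rbrakk> \<Longrightarrow> p (x \<otimes> x) = (p x)\<^sup>2"
  using p_cstar[of x] by simp

lemma p_abs_diff: "\<lbrakk>x \<in> carrier A; y \<in> carrier A\<rbrakk> \<Longrightarrow> \<bar>p x - p y\<bar> \<le> p (x \<ominus> y)"
  using p_diff_trans[of x y \<zero>] p_diff_trans[of y x \<zero>] p_diff_commute[of x y] by simp

text \<open>\<open>u\<close> is a self-adjoint idempotent, so the C*-identity reads
  \<open>p u = (p u)\<^sup>2\<close>. The value 0 cannot be excluded, since \<open>p\<close> may be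
  the zero seminorm; hence only an inequality.\<close>

lemma p_unit:
  assumes "is_unit A u" shows "p u \<le> 1"
proof -
  have "p u = (p u)\<^sup>2"
    using p_cstar[of u] star_unit[OF assms] assms by (simp add: is_unit_def)
  then have "p u = 0 \<or> p u = 1"
    by (simp add: power2_eq_square)
  then show ?thesis by auto
qed

text \<open>The element \<open>w = x + i y\<close> is unitary, and \<open>x\<close> and \<open>2 x\<^sup>2 - 1\<close> are the real parts of \<open>w\<close> and
  \<open>w\<^sup>2\<close>.\<close>

lemma p_circle:
  assumes u: "is_unit A u" and xy: "x \<in> carrier A" "y \<in> carrier A"
    and sa: "star A x = x" "star A y = y" and comm: "y \<otimes> x = x \<otimes> y"
    and sum: "x \<otimes> x \<oplus> y \<otimes> y = u"
  shows "p x \<le> 1" and "p (u \<ominus> 2 \<odot> (x \<otimes> x)) \<le> 1"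
proof -
  let ?w = "x \<oplus> \<i> \<odot> y"
  have w: "?w \<in> carrier A" using xy by simp
  have sw: "star A ?w = x \<ominus> \<i> \<odot> y" using xy sa by (simp add: diff_eq_scale)
  have "star A ?w \<otimes> ?w = x \<otimes> x \<oplus> y \<otimes> y \<oplus> (\<i> \<odot> (x \<otimes> y) \<oplus> (-1) \<odot> (\<i> \<odot> (x \<otimes> y)))"
    using xy comm by (simp add: sw diff_eq_scale mult_l_distr mult_r_distr scale_add_right a_ac)
  also have "\<dots> = u"
    using xy u sum by (simp add: is_unit_def flip: diff_eq_scale)
      (metis diff_eq_scale diff_self scale_closed mult_closed scale_scale mult_minus1)
  finally have "(p ?w)\<^sup>2 \<le> 1"
    using p_cstar[OF w] p_unit[OF u] by simp
  then have pw: "p ?w \<le> 1"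
    using power2_le_imp_le[of "p ?w" 1] by simp
  have "p (2 \<odot> x) = p (?w \<oplus> star A ?w)"
    using xy by (simp only: sw) (simp add: sum_add_diff)
  also have "\<dots> \<le> 2"
    using p_triangle[of ?w "star A ?w"] w pw p_star[OF w] star_closed[OF w] by linarith
  finally show "p x \<le> 1" using xy by simp
  have pw2: "p (?w \<otimes> ?w) \<le> 1"
    using p_mult[OF w w] pw p_nonneg[OF w] mult_le_one[of "p ?w" "p ?w"] by linarith
  have yy: "y \<otimes> y = u \<ominus> x \<otimes> x"
    using sum xy u by (metis a_comm diff_eq_iff is_unit_def mult_closed)
  have "?w \<otimes> ?w = (x \<otimes> x \<ominus> y \<otimes> y) \<oplus> (2 * \<i>) \<odot> (x \<otimes> y)"
    using xy comm scale_two[of "\<i> \<odot> (x \<otimes> y)"]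
    by (simp add: diff_eq_scale mult_l_distr mult_r_distr scale_add_right a_ac)
  moreover have "star A (?w \<otimes> ?w) = (x \<otimes> x \<ominus> y \<otimes> y) \<ominus> (2 * \<i>) \<odot> (x \<otimes> y)"
    unfolding calculation using xy sa comm by (simp add: diff_eq_scale)
  ultimately have "?w \<otimes> ?w \<oplus> star A (?w \<otimes> ?w) = 2 \<odot> (x \<otimes> x \<ominus> y \<otimes> y)"
    using xy by (simp only: ) (simp add: sum_add_diff)
  moreover have "x \<otimes> x \<ominus> y \<otimes> y = (-1) \<odot> (u \<ominus> 2 \<odot> (x \<otimes> x))"
    using xy u unfolding yy
    by (simp add: is_unit_def diff_eq_scale scale_add_right scale_two a_ac)
  ultimately have "p (2 \<odot> ((-1) \<odot> (u \<ominus> 2 \<odot> (x \<otimes> x)))) = p (?w \<otimes> ?w \<oplus> star A (?w \<otimes> ?w))"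
    by simp
  also have "\<dots> \<le> 2"
    using p_triangle[of "?w \<otimes> ?w" "star A (?w \<otimes> ?w)"] w pw2 p_star[of "?w \<otimes> ?w"]
      star_closed[of "?w \<otimes> ?w"] mult_closed[OF w w] by linarith
  finally show "p (u \<ominus> 2 \<odot> (x \<otimes> x)) \<le> 1"
    using xy u by (simp add: is_unit_def)
qed

end

section \<open>Square roots\<close>

context star_algebra
begin

text \<open>A fixed point \<open>s = (y + s\<^sup>2) / 2\<close> satisfies \<open>(1 - s)\<^sup>2 = 1 - y\<close>. The iteration is dominated by its
  scalar instance \<open>y = 1\<close>, so it converges even when \<open>\<parallel>y\<parallel> = 1\<close>.\<close>

fun root_seq :: "'a \<Rightarrow> nat \<Rightarrow> 'a" where
  "root_seq y 0 = \<zero>"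
| "root_seq y (Suc n) = (1/2) \<odot> (y \<oplus> root_seq y n \<otimes> root_seq y n)"

lemma root_seq_closed [simp]: "y \<in> carrier A \<Longrightarrow> root_seq y n \<in> carrier A"
  by (induction n) auto

lemma root_seq_star: "\<lbrakk>y \<in> carrier A; star A y = y\<rbrakk> \<Longrightarrow> star A (root_seq y n) = root_seq y n"
  by (induction n) auto

text \<open>Every term is a polynomial in \<open>y\<close>. In the limit this gives the commutation
  clause of \<open>square_root_exists\<close>, which takes the place of the fact that the root lies
  in the C*-algebra generated by \<open>u\<close> and \<open>y\<close>.\<close>

lemma root_seq_commute:
  assumes "y \<in> carrier A" "v \<in> carrier A" "v \<otimes> y = y \<otimes> v"
  shows "v \<otimes> root_seq y n = root_seq y n \<otimes> v"
proof (induction n)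
  case (Suc n)
  have "v \<otimes> (root_seq y n \<otimes> root_seq y n) = (root_seq y n \<otimes> root_seq y n) \<otimes> v"
    using assms Suc by (metis mult_assoc root_seq_closed)
  then show ?case using assms by (simp add: mult_l_distr mult_r_distr)
qed (use assms in simp)

end

fun scalar_root_seq :: "nat \<Rightarrow> real" where
  "scalar_root_seq 0 = 0"
| "scalar_root_seq (Suc n) = (1 + (scalar_root_seq n)\<^sup>2) / 2"

lemma scalar_root_seq_bounds: "0 \<le> scalar_root_seq n \<and> scalar_root_seq n \<le> 1"
proof (induction n)
  case (Suc n)
  then have "(scalar_root_seq n)\<^sup>2 \<le> 1" by (simp add: power_le_one)
  then show ?case by simp
qed simp

lemma scalar_root_seq_mono: "scalar_root_seq n \<le> scalar_root_seq (Suc n)"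
proof -
  have "0 \<le> (scalar_root_seq n - 1)\<^sup>2" by simp
  then show ?thesis by (simp add: power2_eq_square field_simps)
qed

lemma scalar_root_seq_Cauchy: "Cauchy scalar_root_seq"
proof -
  have "incseq scalar_root_seq"
    using scalar_root_seq_mono by (rule incseq_SucI)
  then have "convergent scalar_root_seq"
    using scalar_root_seq_bounds
    by (metis convergent_def incseq_convergent)
  then show ?thesis by (rule convergent_Cauchy)
qed

context seminormed_star_algebra
begin

lemma root_seq_bound:
  assumes "y \<in> carrier A" "p y \<le> 1"
  shows "p (root_seq y n) \<le> scalar_root_seq n"
proof (induction n)
  case (Suc n)
  have "p (root_seq y n \<otimes> root_seq y n) \<le> (scalar_root_seq n)\<^sup>2"
    using p_mult[of "root_seq y n" "root_seq y n"] Suc assms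
      mult_mono[OF Suc Suc] scalar_root_seq_bounds[of n] by (simp add: power2_eq_square)
  then show ?case
    using p_triangle[of y "root_seq y n \<otimes> root_seq y n"] assms by simp
qed simp

text \<open>With d_n the increment from term n to term n+1, the recursion gives 2 d_(n+1) = s_(n+1)
  d_n + d_n s_n. For the scalar sequence the same formula is an equality between nonnegative
  numbers, so the domination of the terms carries over to the increments by induction.\<close>

lemma root_seq_step:
  assumes "y \<in> carrier A" "p y \<le> 1"
  shows "p (root_seq y (Suc n) \<ominus> root_seq y n) \<le> scalar_root_seq (Suc n) - scalar_root_seq n"
proof (induction n)
  case 0
  show ?case using assms by simp
next
  case (Suc n)
  let ?s = "root_seq y" and ?\<sigma> = scalar_root_seq
  let ?d = "?s (Suc n) \<ominus> ?s n"
  have c: "?s k \<in> carrier A" for k using assms by simp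
  define a b where "a = y \<oplus> ?s (Suc n) \<otimes> ?s (Suc n)" and "b = y \<oplus> ?s n \<otimes> ?s n"
  have ab: "?s (Suc (Suc n)) = (1/2) \<odot> a" "?s (Suc n) = (1/2) \<odot> b"
    by (simp_all only: root_seq.simps(2)[of y "Suc n"] root_seq.simps(2)[of y n] a_def b_def)
  have "a \<in> carrier A" "b \<in> carrier A" using assms c by (simp_all add: a_def b_def del: root_seq.simps)
  then have "?s (Suc (Suc n)) \<ominus> ?s (Suc n) = (1/2) \<odot> (a \<ominus> b)"
    unfolding ab by (simp add: scale_diff_right)
  also have "\<dots> = (1/2) \<odot> ((y \<oplus> ?s (Suc n) \<otimes> ?s (Suc n)) \<ominus> (y \<oplus> ?s n \<otimes> ?s n))"
    by (simp add: a_def b_def del: root_seq.simps)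
  also have "\<dots> = (1/2) \<odot> (?s (Suc n) \<otimes> ?d \<oplus> ?d \<otimes> ?s n)"
    using assms c
    by (simp add: add_diff_add mult_diff_mult del: root_seq.simps)
  finally have "p (?s (Suc (Suc n)) \<ominus> ?s (Suc n)) = 1/2 * p (?s (Suc n) \<otimes> ?d \<oplus> ?d \<otimes> ?s n)"
    using c by (simp del: root_seq.simps)
  also have "\<dots> \<le> 1/2 * (p (?s (Suc n)) * p ?d + p ?d * p (?s n))"
    using p_triangle[of "?s (Suc n) \<otimes> ?d" "?d \<otimes> ?s n"] p_mult[of "?s (Suc n)" ?d]
      p_mult[of ?d "?s n"] c by (simp del: root_seq.simps)
  also have "\<dots> = 1/2 * (p (?s (Suc n)) + p (?s n)) * p ?d"
    by (simp add: algebra_simps)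
  also have "\<dots> \<le> 1/2 * (?\<sigma> (Suc n) + ?\<sigma> n) * (?\<sigma> (Suc n) - ?\<sigma> n)"
    using Suc root_seq_bound[OF assms, of n] root_seq_bound[OF assms, of "Suc n"] c
      scalar_root_seq_bounds[of n] scalar_root_seq_bounds[of "Suc n"]
    by (intro mult_mono) (auto simp del: root_seq.simps scalar_root_seq.simps)
  also have "\<dots> = ?\<sigma> (Suc (Suc n)) - ?\<sigma> (Suc n)"
  proof -
    have "1/2 * (b + a) * (b - a) = c - b" if "c = (1 + b\<^sup>2) / 2" "b = (1 + a\<^sup>2) / 2" for a b c :: real
    proof -
      have "c - b = c - (1 + a\<^sup>2) / 2" by (simp only: that(2))
      also have "\<dots> = (1 + b\<^sup>2) / 2 - (1 + a\<^sup>2) / 2" by (simp only: that(1))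
      finally show ?thesis by (simp add: field_simps power2_eq_square)
    qed
    then show ?thesis by (metis scalar_root_seq.simps(2))
  qed
  finally show ?case .
qed

lemma root_seq_diff:
  assumes "y \<in> carrier A" "p y \<le> 1" "n \<le> m"
  shows "p (root_seq y m \<ominus> root_seq y n) \<le> scalar_root_seq m - scalar_root_seq n"
  using assms(3)
proof (induction m rule: dec_induct)
  case (step m)
  have "p (root_seq y (Suc m) \<ominus> root_seq y n)
      \<le> p (root_seq y (Suc m) \<ominus> root_seq y m) + p (root_seq y m \<ominus> root_seq y n)"
    by (intro p_diff_trans root_seq_closed assms(1))
  then show ?case
    using root_seq_step[OF assms(1,2), of m] step.IH by linarith
qed (use assms in simp)

lemma root_seq_Cauchy:
  assumes "y \<in> carrier A" "p y \<le> 1"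
  shows "root_seq y \<in> cauchy_seqs A p"
  unfolding cauchy_seqs_def
proof (intro CollectI conjI allI impI)
  fix \<epsilon> :: real assume "\<epsilon> > 0"
  then obtain N where N: "\<And>m n. \<lbrakk>m \<ge> N; n \<ge> N\<rbrakk> \<Longrightarrow> dist (scalar_root_seq m) (scalar_root_seq n) < \<epsilon>"
    using scalar_root_seq_Cauchy unfolding Cauchy_def by meson
  have "p (root_seq y m \<ominus> root_seq y n) < \<epsilon>" if mn: "m \<ge> N" "n \<ge> N" for m n
  proof -
    have "p (root_seq y m \<ominus> root_seq y n) \<le> \<bar>scalar_root_seq m - scalar_root_seq n\<bar>"
      using root_seq_diff[OF assms, of n m] root_seq_diff[OF assms, of m n]
        p_diff_commute[of "root_seq y m" "root_seq y n"] assms by (cases "n \<le> m") auto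
    then show ?thesis using N[OF mn] by (simp add: dist_real_def)
  qed
  then show "\<exists>N. \<forall>m\<ge>N. \<forall>n\<ge>N. p (root_seq y m \<ominus> root_seq y n) < \<epsilon>" by blast
qed (use assms in simp)

section \<open>Convergence in a C*-seminorm\<close>

definition tends :: "(nat \<Rightarrow> 'a) \<Rightarrow> 'a \<Rightarrow> bool" where
  "tends f l \<longleftrightarrow> (\<forall>n. f n \<in> carrier A) \<and> l \<in> carrier A \<and> (\<lambda>n. p (f n \<ominus> l)) \<longlonglongrightarrow> 0"

lemma tendsI:
  assumes "\<And>n. f n \<in> carrier A" "l \<in> carrier A" "\<And>n. p (f n \<ominus> l) \<le> b n" "b \<longlonglongrightarrow> 0"
  shows "tends f l"
  unfolding tends_def
proof (intro conjI allI assms)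
  show "(\<lambda>n. p (f n \<ominus> l)) \<longlonglongrightarrow> 0"
  proof (rule tendsto_sandwich[where f = "\<lambda>_. 0" and h = b])
    show "\<forall>\<^sub>F n in sequentially. p (f n \<ominus> l) \<le> b n" using assms(3) by simp
    show "\<forall>\<^sub>F n in sequentially. 0 \<le> p (f n \<ominus> l)" using assms(1,2) by simp
  qed (use assms in simp_all)
qed

lemma tends_const [simp]: "l \<in> carrier A \<Longrightarrow> tends (\<lambda>n. l) l"
  by (simp add: tends_def)

lemma tendsD:
  assumes "tends f l"
  shows "f n \<in> carrier A" "l \<in> carrier A" "(\<lambda>n. p (f n \<ominus> l)) \<longlonglongrightarrow> 0"
  using assms unfolding tends_def by auto

lemma tends_add:
  assumes "tends f l" "tends g k" shows "tends (\<lambda>n. f n \<oplus> g n) (l \<oplus> k)"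
proof (rule tendsI)
  note c = tendsD(1,2)[OF assms(1)] tendsD(1,2)[OF assms(2)]
  show "p (f n \<oplus> g n \<ominus> (l \<oplus> k)) \<le> p (f n \<ominus> l) + p (g n \<ominus> k)" for n
    using c by (simp add: add_diff_add p_triangle)
  show "(\<lambda>n. p (f n \<ominus> l) + p (g n \<ominus> k)) \<longlonglongrightarrow> 0"
    using tendsD(3)[OF assms(1)] tendsD(3)[OF assms(2)] by (rule tendsto_add_zero)
  show "f n \<oplus> g n \<in> carrier A" "l \<oplus> k \<in> carrier A" for n using c by simp_all
qed

lemma tends_scale:
  assumes "tends f l" shows "tends (\<lambda>n. c \<odot> f n) (c \<odot> l)"
proof (rule tendsI)
  note d = tendsD(1,2)[OF assms]
  show "p (c \<odot> f n \<ominus> c \<odot> l) \<le> cmod c * p (f n \<ominus> l)" for n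
    using d p_scale[of "f n \<ominus> l" c] by (simp add: scale_diff_right del: p_scale)
  show "(\<lambda>n. cmod c * p (f n \<ominus> l)) \<longlonglongrightarrow> 0"
    using tendsD(3)[OF assms] by (rule tendsto_mult_right_zero)
qed (use tendsD(1,2)[OF assms] in simp_all)

lemma tends_star:
  assumes "tends f l" shows "tends (\<lambda>n. star A (f n)) (star A l)"
proof (rule tendsI)
  note d = tendsD(1,2)[OF assms]
  show "p (star A (f n) \<ominus> star A l) \<le> p (f n \<ominus> l)" for n
    using d p_star[of "f n \<ominus> l"] by (simp del: p_star)
qed (use tendsD[OF assms] in simp_all)

lemma tends_norm:
  assumes "tends f l" shows "(\<lambda>n. p (f n)) \<longlonglongrightarrow> p l"
proof -
  have "(\<lambda>n. p (f n) - p l) \<longlonglongrightarrow> 0"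
  proof (rule tendsto_rabs_zero_cancel, rule tendsto_sandwich[where f = "\<lambda>_. 0"])
    show "\<forall>\<^sub>F n in sequentially. \<bar>p (f n) - p l\<bar> \<le> p (f n \<ominus> l)"
      using assms p_abs_diff unfolding tends_def by simp
    show "(\<lambda>n. p (f n \<ominus> l)) \<longlonglongrightarrow> 0" using assms unfolding tends_def by blast
  qed simp_all
  then show ?thesis by (simp add: LIM_zero_iff)
qed

lemma tends_mult:
  assumes "tends f l" "tends g k"
  shows "tends (\<lambda>n. f n \<otimes> g n) (l \<otimes> k)"
proof (rule tendsI[where b = "\<lambda>n. p (f n) * p (g n \<ominus> k) + p (f n \<ominus> l) * p k"])
  have c: "f n \<in> carrier A" "g n \<in> carrier A" "l \<in> carrier A" "k \<in> carrier A" for n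
    using assms by (auto simp: tends_def)
  show "p (f n \<otimes> g n \<ominus> l \<otimes> k) \<le> p (f n) * p (g n \<ominus> k) + p (f n \<ominus> l) * p k" for n
    using p_triangle[of "f n \<otimes> (g n \<ominus> k)" "(f n \<ominus> l) \<otimes> k"] p_mult[of "f n" "g n \<ominus> k"]
      p_mult[of "f n \<ominus> l" k] c by (simp add: mult_diff_mult)
  have "(\<lambda>n. p (f n) * p (g n \<ominus> k) + p (f n \<ominus> l) * p k) \<longlonglongrightarrow> p l * 0 + 0 * p k"
    using assms tends_norm[OF assms(1)] by (intro tendsto_intros) (auto simp: tends_def)
  then show "(\<lambda>n. p (f n) * p (g n \<ominus> k) + p (f n \<ominus> l) * p k) \<longlonglongrightarrow> 0" by simp
qed (use assms in \<open>auto simp: tends_def\<close>)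

lemma tends_unique_norm:
  assumes "tends f l" "tends f k"
  shows "p (l \<ominus> k) = 0"
proof -
  have "tends (\<lambda>n. (-1) \<odot> f n \<oplus> f n) ((-1) \<odot> l \<oplus> k)"
    using assms by (intro tends_add tends_scale)
  moreover have "(-1) \<odot> x \<oplus> x = \<zero>" if "x \<in> carrier A" for x
    using that scale_add_left[of x "-1" 1] by simp
  moreover have c: "l \<in> carrier A" "k \<in> carrier A" "\<And>n. f n \<in> carrier A"
    using assms by (auto simp: tends_def)
  ultimately have "(\<lambda>n. 0) \<longlonglongrightarrow> p ((-1) \<odot> l \<oplus> k)"
    using tends_norm[of "\<lambda>n. (-1) \<odot> f n \<oplus> f n"] by simp
  then have "p ((-1) \<odot> l \<oplus> k) = 0" by (simp add: LIMSEQ_const_iff)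
  moreover have "(-1) \<odot> l \<oplus> k = k \<ominus> l" using c by (simp add: diff_eq_scale a_comm)
  ultimately show ?thesis using c by (simp add: p_diff_commute[of l k])
qed

end

sublocale cstar_algebra \<subseteq> seminormed_star_algebra A "cnorm A"
  using cnorm_seminorm by unfold_locales

context cstar_algebra
begin

lemma tends_unique: "\<lbrakk>tends f l; tends f k\<rbrakk> \<Longrightarrow> l = k"
  using tends_unique_norm[of f l k] tendsD(2) by (metis cnorm_eq_0 diff_eq_zero minus_closed)

text \<open>The root is r = 1 - s, with s the limit of \<open>root_seq y\<close>. The bound on
  \<open>u \<ominus> r\<close>, which is s itself, lets the lemma be applied again to obtain a
  square root of r; the commutation clause keeps all these roots in one commuting family.\<close>

lemma square_root_exists:
  assumes u: "is_unit A u" and y: "y \<in> carrier A" "star A y = y" "cnorm A y \<le> 1"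
  obtains r where "r \<in> carrier A" "star A r = r" "r \<otimes> r = u \<ominus> y" "cnorm A (u \<ominus> r) \<le> 1"
    "\<And>v. \<lbrakk>v \<in> carrier A; v \<otimes> y = y \<otimes> v\<rbrakk> \<Longrightarrow> v \<otimes> r = r \<otimes> v"
proof -
  let ?s = "root_seq y"
  obtain s where s: "tends ?s s"
    using complete[OF root_seq_Cauchy[OF y(1,3)]] root_seq_closed[OF y(1)] unfolding tends_def by blast
  have sc: "s \<in> carrier A" and uc: "u \<in> carrier A"
    using s u by (auto simp: tends_def is_unit_def)
  have "tends (\<lambda>n. star A (?s n)) (star A s)" using s by (rule tends_star)
  then have ss: "star A s = s" using s y by (simp add: root_seq_star tends_unique)
  have "tends (\<lambda>n. (1/2) \<odot> (y \<oplus> ?s n \<otimes> ?s n)) ((1/2) \<odot> (y \<oplus> s \<otimes> s))"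
    using s y by (intro tends_scale tends_add tends_mult tends_const)
  moreover have "tends (\<lambda>n. ?s (Suc n)) s"
    using s LIMSEQ_Suc unfolding tends_def by blast
  ultimately have fix_s: "s = (1/2) \<odot> (y \<oplus> s \<otimes> s)"
    by (intro tends_unique) (simp_all only: root_seq.simps(2))
  have two: "y \<oplus> s \<otimes> s = s \<oplus> s"
  proof -
    have "2 \<odot> s = y \<oplus> s \<otimes> s"
      by (subst fix_s) (use sc y in simp)
    then show ?thesis using sc by (simp add: scale_two)
  qed
  have comm: "v \<otimes> s = s \<otimes> v" if v: "v \<in> carrier A" "v \<otimes> y = y \<otimes> v" for v
  proof -
    have "tends (\<lambda>n. v \<otimes> ?s n) (v \<otimes> s)" "tends (\<lambda>n. ?s n \<otimes> v) (s \<otimes> v)"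
      using s v by (auto intro!: tends_mult)
    then show ?thesis using v y by (simp add: root_seq_commute tends_unique)
  qed
  have "cnorm A s \<le> 1"
  proof (rule LIMSEQ_le_const2[OF tends_norm[OF s]])
    show "\<exists>N. \<forall>n\<ge>N. cnorm A (?s n) \<le> 1"
      using root_seq_bound[OF y(1,3)] scalar_root_seq_bounds order_trans by blast
  qed
  show thesis
  proof (rule that[of "u \<ominus> s"])
    have eq: "u \<ominus> (u \<ominus> s) = s"
      using uc sc by (rule diff_diff)
    show "cnorm A (u \<ominus> (u \<ominus> s)) \<le> 1" using \<open>cnorm A s \<le> 1\<close> eq by simp
    have "(u \<ominus> s) \<otimes> (u \<ominus> s) = u \<oplus> (s \<otimes> s \<oplus> (-1) \<odot> (s \<oplus> s))"
      using u uc sc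
      by (simp add: mult_l_distr mult_r_distr is_unit_def diff_eq_scale scale_add_right a_ac)
    also have "s \<otimes> s \<oplus> (-1) \<odot> (s \<oplus> s) = (-1) \<odot> y"
      unfolding two[symmetric] using sc y by (simp add: diff_add_cancel)
    finally show "(u \<ominus> s) \<otimes> (u \<ominus> s) = u \<ominus> y" using y by (simp add: diff_eq_scale)
    show "star A (u \<ominus> s) = u \<ominus> s" using uc sc ss u by (simp add: star_unit)
    show "v \<otimes> (u \<ominus> s) = (u \<ominus> s) \<otimes> v" if "v \<in> carrier A" "v \<otimes> y = y \<otimes> v" for v
      using comm_diff_unit[OF u sc] comm that by simp
  qed (use uc sc in simp)
qed

text \<open>This converts a norm bound into the algebraic identity that \<open>p_circle\<close>
  needs. The identity does not mention the norm, so it can be evaluated in any other C*-seminorm on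
  the same algebra.\<close>

lemma unit_circle_completion:
  assumes u: "is_unit A u" and h: "h \<in> carrier A" "star A h = h" "cnorm A h \<le> 1"
  shows "\<exists>r\<in>carrier A. star A r = r \<and> r \<otimes> r = u \<ominus> h \<otimes> h \<and> r \<otimes> h = h \<otimes> r \<and>
    h \<otimes> h \<oplus> r \<otimes> r = u"
proof -
  have hh: "h \<otimes> h \<in> carrier A" "star A (h \<otimes> h) = h \<otimes> h" "cnorm A (h \<otimes> h) \<le> 1"
    using h by (simp_all add: p_square power_le_one)
  obtain r where r: "r \<in> carrier A" "star A r = r" "r \<otimes> r = u \<ominus> h \<otimes> h"
    "\<And>v. \<lbrakk>v \<in> carrier A; v \<otimes> (h \<otimes> h) = (h \<otimes> h) \<otimes> v\<rbrakk> \<Longrightarrow> v \<otimes> r = r \<otimes> v"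
    by (rule square_root_exists[OF u hh]) blast
  have "h \<otimes> h \<oplus> r \<otimes> r = u"
    using r(3) h r(1) u by (metis a_comm diff_eq_iff is_unit_def mult_closed)
  moreover have "r \<otimes> h = h \<otimes> r" using r(4)[of h] h by (simp add: mult_assoc)
  ultimately show ?thesis using r(1-3) by blast
qed

text \<open>A self-adjoint contraction is completed to a point of the circle using completeness for
  \<open>cnorm A\<close>; then \<open>p_circle\<close> is applied with \<open>p\<close> in place of
  \<open>cnorm A\<close>. General elements follow from the C*-identity. For pulled-back norms this
  is the contractivity of star homomorphisms.\<close>

lemma seminorm_le_norm:
  assumes u: "is_unit A u" and p: "cstar_seminorm A p" and x: "x \<in> carrier A"
  shows "p x \<le> cnorm A x"
proof -
  interpret P: seminormed_star_algebra A p using p by unfold_locales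
  have sa: "p h \<le> t" if h: "h \<in> carrier A" "star A h = h" "cnorm A h \<le> t" "t > 0" for h t
  proof -
    define k where "k = complex_of_real (1/t) \<odot> h"
    have k: "k \<in> carrier A" "star A k = k" "cnorm A k \<le> 1"
      using h by (simp_all add: k_def norm_divide field_simps)
    obtain r where "r \<in> carrier A" "star A r = r" "r \<otimes> k = k \<otimes> r" "k \<otimes> k \<oplus> r \<otimes> r = u"
      using unit_circle_completion[OF u k] by blast
    then have "p k \<le> 1" using P.p_circle(1)[OF u k(1) _ k(2)] by blast
    then show ?thesis using h by (simp add: k_def field_simps norm_divide)
  qed
  \<comment> \<open>\<open>sa\<close> rescales by a positive \<open>t\<close>; the slack covers
    elements of norm 0.\<close>
  have "(p x)\<^sup>2 \<le> (cnorm A x)\<^sup>2"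
  proof (rule field_le_epsilon)
    fix \<epsilon> :: real assume "\<epsilon> > 0"
    then have "p (star A x \<otimes> x) \<le> (cnorm A x)\<^sup>2 + \<epsilon>"
      using x by (intro sa) (simp_all add: p_cstar add_nonneg_pos)
    then show "(p x)\<^sup>2 \<le> (cnorm A x)\<^sup>2 + \<epsilon>"
      using x by (simp add: P.p_cstar)
  qed
  then show ?thesis using x p_nonneg power2_le_imp_le by blast
qed

text \<open>In spectral terms: h^2 has spectrum in [0, t], so that of t - 2 h^2 lies in [-t, t] and
  that of t - h^2 in [0, t]. The first bound is the stronger one.\<close>

lemma norm_scaled_unit_diff:
  assumes u: "is_unit A u" and h: "h \<in> carrier A" "star A h = h" "(cnorm A h)\<^sup>2 \<le> t"
  shows "cnorm A (of_real t \<odot> u \<ominus> 2 \<odot> (h \<otimes> h)) \<le> t"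
    and "cnorm A (of_real t \<odot> u \<ominus> h \<otimes> h) \<le> t"
proof -
  have uc: "u \<in> carrier A" using u by (simp add: is_unit_def)
  have t0: "0 \<le> t" using h(3) by (meson order_trans zero_le_power2)
  show 1: "cnorm A (of_real t \<odot> u \<ominus> 2 \<odot> (h \<otimes> h)) \<le> t"
  proof (cases "t = 0")
    case True
    then have "h = \<zero>" using h cnorm_eq_0 by simp
    then show ?thesis using True uc by simp
  next
    case False
    then have t: "t > 0" using t0 by simp
    define k where "k = complex_of_real (1 / sqrt t) \<odot> h"
    have "cnorm A h \<le> sqrt t" using h by (simp add: real_le_rsqrt)
    then have k: "k \<in> carrier A" "star A k = k" "cnorm A k \<le> 1"
      using h t by (simp_all add: k_def norm_divide field_simps)
    obtain r where "r \<in> carrier A" "star A r = r" "r \<otimes> k = k \<otimes> r" "k \<otimes> k \<oplus> r \<otimes> r = u"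
      using unit_circle_completion[OF u k] by blast
    then have "cnorm A (u \<ominus> 2 \<odot> (k \<otimes> k)) \<le> 1" using p_circle(2)[OF u k(1) _ k(2)] by blast
    moreover have "of_real t \<odot> u \<ominus> 2 \<odot> (h \<otimes> h) = of_real t \<odot> (u \<ominus> 2 \<odot> (k \<otimes> k))"
    proof -
      have "complex_of_real t * (2 * (complex_of_real (1 / sqrt t) * complex_of_real (1 / sqrt t))) = 2"
        using t by (simp flip: of_real_mult of_real_divide)
      then show ?thesis using h uc by (simp add: k_def scale_diff_right)
    qed
    ultimately show ?thesis using t uc k by (simp add: mult_left_le)
  qed
  \<comment> \<open>t - h^2 is the mean of t - 2 h^2 and t.\<close>
  have "2 \<odot> (of_real t \<odot> u \<ominus> h \<otimes> h) = (of_real t \<odot> u \<ominus> 2 \<odot> (h \<otimes> h)) \<oplus> of_real t \<odot> u"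
    using uc h by (intro scale_two_diff) simp_all
  then have "cnorm A (2 \<odot> (of_real t \<odot> u \<ominus> h \<otimes> h)) \<le> t + cnorm A (of_real t \<odot> u)"
    using p_triangle[of "of_real t \<odot> u \<ominus> 2 \<odot> (h \<otimes> h)" "of_real t \<odot> u"] 1 uc h by simp
  also have "\<dots> \<le> 2 * t"
    using p_unit[OF u] uc t0 by (simp add: mult_left_le)
  finally show "cnorm A (of_real t \<odot> u \<ominus> h \<otimes> h) \<le> t" using uc h by simp
qed

text \<open>The norm criterion for positivity: h / t = 1 - y with y a self-adjoint contraction, and
  such elements have roots by \<open>square_root_exists\<close>.\<close>

lemma square_if_norm_diff:
  assumes u: "is_unit A u" and h: "h \<in> carrier A" "star A h = h"
    and t: "t > 0" "cnorm A (of_real t \<odot> u \<ominus> h) \<le> t"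
  shows "\<exists>r\<in>carrier A. star A r = r \<and> r \<otimes> r = h"
proof -
  have uc: "u \<in> carrier A" using u by (simp add: is_unit_def)
  let ?y = "u \<ominus> of_real (1/t) \<odot> h"
  have "of_real (1/t) \<odot> (of_real t \<odot> u \<ominus> h) = ?y"
    using t uc h by (simp add: scale_diff_right flip: of_real_mult)
  then have "cnorm A ?y = (1/t) * cnorm A (of_real t \<odot> u \<ominus> h)"
    using uc h t by (metis p_scale minus_closed scale_closed norm_of_real abs_of_pos zero_less_divide_1_iff)
  then have y: "?y \<in> carrier A" "star A ?y = ?y" "cnorm A ?y \<le> 1"
    using t uc h u by (simp_all add: star_unit)
  obtain r where r: "r \<in> carrier A" "star A r = r" "r \<otimes> r = u \<ominus> ?y"
    by (rule square_root_exists[OF u y])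
  have "u \<ominus> ?y = of_real (1/t) \<odot> h"
    using uc h by (intro diff_diff) simp_all
  then have "(of_real (sqrt t) \<odot> r) \<otimes> (of_real (sqrt t) \<odot> r) = h"
    using r h t by (simp flip: of_real_mult)
  then show ?thesis using r by (intro bexI[of _ "of_real (sqrt t) \<odot> r"]) simp_all
qed

text \<open>The norm criterion is additive: the deviations s - a^2 and t - b^2 have norms at most s
  and t, and they add up. No commutation of a and b enters, which is why positivity is measured by
  norms here.\<close>

lemma sum_of_squares:
  assumes u: "is_unit A u" and a: "a \<in> carrier A" "star A a = a" and b: "b \<in> carrier A" "star A b = b"
  shows "\<exists>r\<in>carrier A. star A r = r \<and> r \<otimes> r = a \<otimes> a \<oplus> b \<otimes> b"
proof (rule square_if_norm_diff[OF u])
  \<comment> \<open>The summand 1 keeps s + t positive when a and b both vanish.\<close>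
  let ?s = "(cnorm A a)\<^sup>2" and ?t = "(cnorm A b)\<^sup>2 + 1"
  have uc: "u \<in> carrier A" using u by (simp add: is_unit_def)
  show "?s + ?t > 0" by (simp add: add_nonneg_pos)
  have "of_real (?s + ?t) \<odot> u \<ominus> (a \<otimes> a \<oplus> b \<otimes> b)
      = (of_real ?s \<odot> u \<ominus> a \<otimes> a) \<oplus> (of_real ?t \<odot> u \<ominus> b \<otimes> b)"
    using uc a b scale_add_left[OF uc, of "of_real ?s" "of_real ?t"]
    by (simp only: of_real_add[of ?s ?t] add_diff_add scale_closed mult_closed)
  also have "cnorm A \<dots> \<le> ?s + ?t"
    using p_triangle[of "of_real ?s \<odot> u \<ominus> a \<otimes> a" "of_real ?t \<odot> u \<ominus> b \<otimes> b"]
      norm_scaled_unit_diff(2)[OF u a, of ?s] norm_scaled_unit_diff(2)[OF u b, of ?t] uc a b by simp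
  finally show "cnorm A (of_real (?s + ?t) \<odot> u \<ominus> (a \<otimes> a \<oplus> b \<otimes> b)) \<le> ?s + ?t" .
qed (use a b in simp_all)

end

section \<open>Positive elements\<close>

context cstar_algebra
begin

text \<open>With \<open>w = c c*\<close> and \<open>M = \<parallel>c\<parallel>\<^sup>2 = \<parallel>g\<parallel>\<^sup>2\<close>, write \<open>4 w\<^sup>2 = w (2 w + M) - w (M - 2 w)\<close>.
  Here \<open>w (2 w + M) = c (M - 2 g\<^sup>2) c*\<close>, while \<open>2 w\<close> is a sum of squares; both \<open>\<parallel>M - 2 g\<^sup>2\<parallel>\<close>
  and \<open>\<parallel>M - 2 w\<parallel>\<close> are at most \<open>M\<close>, so that \<open>4 M\<^sup>2 \<le> 2 M\<^sup>2\<close>.\<close>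

lemma star_mult_self_eq_neg_square:
  assumes u: "is_unit A u" and c: "c \<in> carrier A" and g: "g \<in> carrier A" "star A g = g"
    and eq: "star A c \<otimes> c \<oplus> g \<otimes> g = \<zero>"
  shows "c = \<zero>"
proof -
  have uc: "u \<in> carrier A" using u by (simp add: is_unit_def)
  define w M where "w = c \<otimes> star A c" and "M = (cnorm A c)\<^sup>2"
  have w: "w \<in> carrier A" "star A w = w" using c by (simp_all add: w_def)
  have cc: "star A c \<otimes> c = (-1) \<odot> (g \<otimes> g)"
    using eq c g by (metis add.inv_equality minus_eq_scale mult_closed star_closed)
  have gM: "(cnorm A g)\<^sup>2 = M"
    using p_cstar[OF c] p_square[OF g] g unfolding cc M_def by simp
  have wM: "cnorm A w = M"
    using p_cstar[of "star A c"] c by (simp add: w_def M_def)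
  have "\<exists>r\<in>carrier A. star A r = r \<and> r \<otimes> r = 2 \<odot> w"
  proof -
    \<comment> \<open>\<open>a\<close> is twice the real part of c and \<open>b\<close>, up to sign,
      twice the imaginary part, so a^2 + b^2 = 2 (c c* + c* c). Adding 2 g^2 = -2 c* c leaves 2
      w.\<close>
    define a b where "a = c \<oplus> star A c" and "b = \<i> \<odot> c \<ominus> \<i> \<odot> star A c"
    have a: "a \<in> carrier A" "star A a = a" using c by (simp_all add: a_def a_comm)
    have b: "b \<in> carrier A" "star A b = b"
      using c by (simp_all add: b_def diff_eq_scale scale_add_right a_comm)
    obtain r where r: "r \<in> carrier A" "star A r = r" "r \<otimes> r = a \<otimes> a \<oplus> b \<otimes> b"
      using sum_of_squares[OF u a b] by blast
    obtain s where s: "s \<in> carrier A" "star A s = s" "s \<otimes> s = g \<otimes> g \<oplus> g \<otimes> g"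
      using sum_of_squares[OF u g g] by blast
    obtain t where t: "t \<in> carrier A" "star A t = t" "t \<otimes> t = r \<otimes> r \<oplus> s \<otimes> s"
      using sum_of_squares[OF u r(1,2) s(1,2)] by blast
    let ?x = "c \<otimes> c" and ?y = "star A c \<otimes> star A c" and ?z = "star A c \<otimes> c"
    have "a \<otimes> a = (?x \<oplus> ?y) \<oplus> (w \<oplus> ?z)"
      using c by (simp add: a_def w_def mult_l_distr mult_r_distr a_ac)
    moreover have "b \<otimes> b = (-1) \<odot> (?x \<oplus> ?y) \<oplus> (w \<oplus> ?z)"
      using c by (simp add: b_def w_def diff_eq_scale mult_l_distr mult_r_distr scale_add_right a_ac)
    ultimately have "r \<otimes> r = (w \<oplus> ?z) \<oplus> (w \<oplus> ?z)"
      using w c r(3) by (simp only: add_neg_add a_closed mult_closed star_closed)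
    moreover have "s \<otimes> s = (-1) \<odot> ?z \<oplus> (-1) \<odot> ?z"
      unfolding s(3) cc using g by simp
    ultimately have "t \<otimes> t = (w \<oplus> w) \<oplus> ((?z \<oplus> ?z) \<oplus> (-1) \<odot> (?z \<oplus> ?z))"
      unfolding t(3) using w c by (simp add: scale_add_right a_ac)
    also have "\<dots> = 2 \<odot> w" using w c by (simp add: scale_two)
    finally show ?thesis using t by blast
  qed
  then obtain v where v: "v \<in> carrier A" "star A v = v" "v \<otimes> v = 2 \<odot> w" by blast
  have "(cnorm A v)\<^sup>2 = 2 * M"
    using p_square[OF v(1,2)] v(3) w wM by simp
  then have "cnorm A (of_real (2 * M) \<odot> u \<ominus> 2 \<odot> (2 \<odot> w)) \<le> 2 * M"
    using norm_scaled_unit_diff(1)[OF u v(1,2), of "2 * M"] v(3) by simp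
  moreover have "of_real (2 * M) \<odot> u \<ominus> 2 \<odot> (2 \<odot> w) = 2 \<odot> (of_real M \<odot> u \<ominus> 2 \<odot> w)"
    using uc w by (simp add: scale_diff_right)
  ultimately have n1: "cnorm A (of_real M \<odot> u \<ominus> 2 \<odot> w) \<le> M"
    using uc w by simp
  have n2: "cnorm A (of_real M \<odot> u \<ominus> 2 \<odot> (g \<otimes> g)) \<le> M"
    using norm_scaled_unit_diff(1)[OF u g, of M] gM by simp
  have M0: "0 \<le> M" by (simp add: M_def)
  let ?P = "c \<otimes> ((of_real M \<odot> u \<ominus> 2 \<odot> (g \<otimes> g)) \<otimes> star A c)"
  have "cnorm A ?P \<le> cnorm A c * (M * cnorm A c)"
    using p_mult[of c "(of_real M \<odot> u \<ominus> 2 \<odot> (g \<otimes> g)) \<otimes> star A c"]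
      p_mult[of "of_real M \<odot> u \<ominus> 2 \<odot> (g \<otimes> g)" "star A c"]
      mult_right_mono[OF n2, of "cnorm A c"] c g uc
    by (smt (verit) mult_left_mono mult_closed minus_closed scale_closed p_nonneg p_star star_closed)
  then have P: "cnorm A ?P \<le> M * M" by (simp add: M_def power2_eq_square mult_ac)
  let ?Q = "w \<otimes> (of_real M \<odot> u \<ominus> 2 \<odot> w)"
  have Q: "cnorm A ?Q \<le> M * M"
    using p_mult[of w "of_real M \<odot> u \<ominus> 2 \<odot> w"] n1 w uc wM M0
    by (smt (verit) mult_left_mono minus_closed scale_closed)
  have "c \<otimes> ((star A c \<otimes> c) \<otimes> star A c) = w \<otimes> w"
    using c by (simp add: w_def mult_assoc)
  then have "(-1) \<odot> (c \<otimes> ((g \<otimes> g) \<otimes> star A c)) = w \<otimes> w"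
    unfolding cc using c g by simp
  then have ww: "c \<otimes> ((g \<otimes> g) \<otimes> star A c) = (-1) \<odot> (w \<otimes> w)"
    using scale_scale[of "c \<otimes> ((g \<otimes> g) \<otimes> star A c)" "-1" "-1"] c g by simp
  have "?P = of_real M \<odot> w \<oplus> 2 \<odot> (w \<otimes> w)"
    using c g uc u ww w
    by (simp add: diff_eq_scale mult_l_distr mult_r_distr is_unit_def w_def[symmetric])
  moreover have "?Q = of_real M \<odot> w \<ominus> 2 \<odot> (w \<otimes> w)"
    using w uc u by (simp add: mult_diff_right is_unit_def)
  ultimately have "?P \<ominus> ?Q = 2 \<odot> (2 \<odot> (w \<otimes> w))"
    using sum_add_diff(2)[of "of_real M \<odot> w" "2 \<odot> (w \<otimes> w)"] w by simp
  then have "cnorm A (2 \<odot> (2 \<odot> (w \<otimes> w))) \<le> M * M + M * M"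
    using p_diff_triangle[of ?P ?Q] P Q c g uc w by simp
  then have "4 * M\<^sup>2 \<le> 2 * M\<^sup>2"
    using w wM p_square[OF w] by (simp add: power2_eq_square)
  then have "M = 0" using M0 by simp
  then show ?thesis using c cnorm_eq_0 by (simp add: M_def)
qed

text \<open>For \<open>h = b* b\<close> let \<open>k = \<bar>h\<bar>\<close>, \<open>q = k\<^sup>1\<^sup>/\<^sup>2\<close> and \<open>d = k - h\<close>, twice the negative part of \<open>h\<close>. Then
  \<open>(b d)* (b d) = - (q d)\<^sup>2\<close>, so the previous lemma gives \<open>d = 0\<close> and \<open>h = q\<^sup>2\<close>.\<close>

lemma star_mult_self_eq_square:
  assumes u: "is_unit A u" and b: "b \<in> carrier A"
  obtains r where "r \<in> carrier A" "star A r = r" "r \<otimes> r = star A b \<otimes> b"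
    "\<And>v. \<lbrakk>v \<in> carrier A; v \<otimes> (star A b \<otimes> b) = (star A b \<otimes> b) \<otimes> v\<rbrakk> \<Longrightarrow> v \<otimes> r = r \<otimes> v"
proof -
  have *: "\<exists>r\<in>carrier A. star A r = r \<and> r \<otimes> r = star A b \<otimes> b \<and>
      (\<forall>v\<in>carrier A. v \<otimes> (star A b \<otimes> b) = (star A b \<otimes> b) \<otimes> v \<longrightarrow> v \<otimes> r = r \<otimes> v)"
    if b: "b \<in> carrier A" "cnorm A b \<le> 1" for b
  proof -
    have uc: "u \<in> carrier A" using u by (simp add: is_unit_def)
    define h where "h = star A b \<otimes> b"
    have h: "h \<in> carrier A" "star A h = h" "cnorm A h \<le> 1"
      using b by (simp_all add: h_def p_cstar power_le_one)
    \<comment> \<open>\<open>square_root_exists\<close> takes roots of elements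
      \<open>u \<ominus> y\<close>; this \<open>y\<close> makes that element h^2, and its root k
      plays the part of the absolute value of h.\<close>
    let ?y = "u \<ominus> h \<otimes> h"
    have y: "?y \<in> carrier A" "star A ?y = ?y" "cnorm A ?y \<le> 1"
      using h uc u norm_scaled_unit_diff(2)[OF u h(1,2), of 1]
      by (simp_all add: star_unit power_le_one)
    obtain k where k: "k \<in> carrier A" "star A k = k" "k \<otimes> k = u \<ominus> ?y" "cnorm A (u \<ominus> k) \<le> 1"
      and kv: "\<And>v. \<lbrakk>v \<in> carrier A; v \<otimes> ?y = ?y \<otimes> v\<rbrakk> \<Longrightarrow> v \<otimes> k = k \<otimes> v"
      using square_root_exists[OF u y] by metis
    have kk: "k \<otimes> k = h \<otimes> h" using k(3) h uc by (simp add: diff_diff)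
    have kh: "v \<otimes> k = k \<otimes> v" if v: "v \<in> carrier A" "v \<otimes> h = h \<otimes> v" for v
    proof (rule kv[OF v(1)], rule comm_diff_unit[OF u _ v(1)])
      show "v \<otimes> (h \<otimes> h) = h \<otimes> h \<otimes> v" using v h by (metis mult_assoc)
    qed (use h in simp)
    have hk: "h \<otimes> k = k \<otimes> h" using kh[of h] h by simp
    have z: "u \<ominus> k \<in> carrier A" "star A (u \<ominus> k) = u \<ominus> k" using k uc u by (simp_all add: star_unit)
    obtain q where q: "q \<in> carrier A" "star A q = q" "q \<otimes> q = u \<ominus> (u \<ominus> k)"
      and qv: "\<And>v. \<lbrakk>v \<in> carrier A; v \<otimes> (u \<ominus> k) = (u \<ominus> k) \<otimes> v\<rbrakk> \<Longrightarrow> v \<otimes> q = q \<otimes> v"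
      using square_root_exists[OF u z k(4)] by metis
    have qq: "q \<otimes> q = k" using q(3) k uc by (simp add: diff_diff)
    have qk: "v \<otimes> q = q \<otimes> v" if "v \<in> carrier A" "v \<otimes> k = k \<otimes> v" for v
      using qv[OF that(1)] comm_diff_unit[OF u k(1) that] by blast
    define d where "d = k \<ominus> h"
    have d: "d \<in> carrier A" "star A d = d" "d \<otimes> k = k \<otimes> d" "h \<otimes> d = d \<otimes> h"
      using k h hk by (simp_all add: d_def mult_diff_left mult_diff_right)
    have dq: "d \<otimes> q = q \<otimes> d" using qk d by blast
    \<comment> \<open>h d = h k - h^2 = h k - k^2 = -k d: on its negative part, h acts as minus its
      absolute value.\<close>
    have hd: "h \<otimes> d = (-1) \<odot> (k \<otimes> d)"
      using h k hk kk by (simp add: d_def diff_eq_scale mult_r_distr scale_add_right a_comm)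
    define c g where "c = b \<otimes> d" and "g = q \<otimes> d"
    have c: "c \<in> carrier A" and g: "g \<in> carrier A" "star A g = g"
      using b d q dq by (simp_all add: c_def g_def)
    have "star A c \<otimes> c = d \<otimes> (h \<otimes> d)"
      using b d by (simp add: c_def h_def mult_assoc)
    also have "\<dots> = (-1) \<odot> (d \<otimes> (k \<otimes> d))" using hd d k by simp
    also have "d \<otimes> (k \<otimes> d) = g \<otimes> g"
    proof -
      have "g \<otimes> g = (d \<otimes> q) \<otimes> (q \<otimes> d)" by (simp add: g_def dq)
      also have "\<dots> = d \<otimes> ((q \<otimes> q) \<otimes> d)" using d(1) q(1) by (simp add: mult_assoc)
      finally show ?thesis by (simp add: qq)
    qed
    finally have "star A c \<otimes> c \<oplus> g \<otimes> g = \<zero>" using g by (simp add: a_comm)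
    moreover from this have c0: "c = \<zero>" by (rule star_mult_self_eq_neg_square[OF u c g])
    ultimately have "g \<otimes> g = \<zero>" using g by simp
    then have "g = \<zero>" using p_square[OF g] g cnorm_eq_0 by simp
    then have kd: "k \<otimes> d = \<zero>"
      using mult_assoc[of q q d] q d qq by (simp add: g_def)
    then have "d \<otimes> d = \<zero>"
      using hd k h d by (simp add: d_def mult_diff_left)
    then have "d = \<zero>" using p_square[OF d(1,2)] d cnorm_eq_0 by simp
    then have "h = k" using diff_eq_zero[of k h] k(1) h(1) by (simp add: d_def)
    then show ?thesis using q qq qk unfolding h_def[symmetric] by blast
  qed
  \<comment> \<open>The case already treated needs a contraction; the added 1 avoids division by
    zero at b = 0.\<close>
  define n where "n = cnorm A b + 1"
  have n: "n > 0" "cnorm A b \<le> n" using b by (simp_all add: n_def add_nonneg_pos)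
  define b' where "b' = of_real (1/n) \<odot> b"
  have b': "b' \<in> carrier A" "cnorm A b' \<le> 1"
    using b n by (simp_all add: b'_def norm_divide field_simps)
  have bb': "star A b' \<otimes> b' = of_real (1/n * (1/n)) \<odot> (star A b \<otimes> b)"
    using b by (simp add: b'_def)
  obtain r where r: "r \<in> carrier A" "star A r = r" "r \<otimes> r = star A b' \<otimes> b'"
    "\<And>v. \<lbrakk>v \<in> carrier A; v \<otimes> (star A b' \<otimes> b') = (star A b' \<otimes> b') \<otimes> v\<rbrakk> \<Longrightarrow> v \<otimes> r = r \<otimes> v"
    using *[OF b'] by blast
  show thesis
  proof (rule that[of "of_real n \<odot> r"])
    show "of_real n \<odot> r \<otimes> (of_real n \<odot> r) = star A b \<otimes> b"
      using r(1) b n by (simp add: r(3) bb')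
    show "v \<otimes> (of_real n \<odot> r) = of_real n \<odot> r \<otimes> v"
      if "v \<in> carrier A" "v \<otimes> (star A b \<otimes> b) = star A b \<otimes> b \<otimes> v" for v
      using r(1) r(4)[of v] that b by (simp add: bb')
  qed (use r in simp_all)
qed

text \<open>The way back from positivity to a norm bound. \<open>positive\<close> supplies just some
  b; \<open>star_mult_self_eq_square\<close> replaces it by a self-adjoint root of 1 - k^2 that
  commutes with k, and k and this root then form a point of the circle as in
  \<open>p_circle\<close>.\<close>

lemma norm_le_one_if_positive:
  assumes u: "is_unit A u" and k: "k \<in> carrier A" "star A k = k"
    and pos: "positive A (u \<ominus> k \<otimes> k)"
  shows "cnorm A k \<le> 1"
proof -
  have uc: "u \<in> carrier A" using u by (simp add: is_unit_def)
  obtain b where b: "b \<in> carrier A" "u \<ominus> k \<otimes> k = star A b \<otimes> b"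
    using pos by (auto simp: positive_def)
  have "k \<otimes> (u \<ominus> k \<otimes> k) = (u \<ominus> k \<otimes> k) \<otimes> k"
    using k by (intro comm_diff_unit[OF u]) (simp_all add: mult_assoc)
  then obtain r where r: "r \<in> carrier A" "star A r = r" "r \<otimes> r = u \<ominus> k \<otimes> k" "k \<otimes> r = r \<otimes> k"
    using star_mult_self_eq_square[OF u b(1)] k b(2) by metis
  then have "k \<otimes> k \<oplus> r \<otimes> r = u"
    using k uc by (metis a_comm diff_eq_iff mult_closed)
  then show ?thesis using p_circle(1)[OF u k(1) r(1) k(2) r(2)] r(4) by simp
qed

end

section \<open>Completions\<close>

context seminormed_star_algebra
begin

abbreviation seq_class :: "(nat \<Rightarrow> 'a) \<Rightarrow> (nat \<Rightarrow> 'a) set" where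
  "seq_class x \<equiv> null_rel A p `` {x}"

lemma cauchy_closed: "x \<in> cauchy_seqs A p \<Longrightarrow> x n \<in> carrier A"
  by (simp add: cauchy_seqs_def)

lemma cauchyD: "\<lbrakk>x \<in> cauchy_seqs A p; e > 0\<rbrakk> \<Longrightarrow> \<exists>N. \<forall>m\<ge>N. \<forall>n\<ge>N. p (x m \<ominus> x n) < e"
  unfolding cauchy_seqs_def by blast

lemma cauchy_const [simp]: "a \<in> carrier A \<Longrightarrow> (\<lambda>n. a) \<in> cauchy_seqs A p"
  by (simp add: cauchy_seqs_def)

lemma cauchy_add [simp]:
  assumes x: "x \<in> cauchy_seqs A p" and y: "y \<in> cauchy_seqs A p"
  shows "(\<lambda>n. x n \<oplus> y n) \<in> cauchy_seqs A p"
  unfolding cauchy_seqs_def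
proof (intro CollectI conjI allI impI)
  note [simp] = cauchy_closed[OF x] cauchy_closed[OF y]
  fix e :: real assume "e > 0"
  then have pos: "e/2 > 0" by simp
  obtain M where M: "\<And>m n. \<lbrakk>m \<ge> M; n \<ge> M\<rbrakk> \<Longrightarrow> p (x m \<ominus> x n) < e/2"
    using cauchyD[OF x pos] by blast
  obtain N where N: "\<And>m n. \<lbrakk>m \<ge> N; n \<ge> N\<rbrakk> \<Longrightarrow> p (y m \<ominus> y n) < e/2"
    using cauchyD[OF y pos] by blast
  have "p (x m \<oplus> y m \<ominus> (x n \<oplus> y n)) < e" if "m \<ge> max M N" "n \<ge> max M N" for m n
    using p_triangle[of "x m \<ominus> x n" "y m \<ominus> y n"] M[of m n] N[of m n] that x y
    by (simp add: add_diff_add)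
  then show "\<exists>N. \<forall>m\<ge>N. \<forall>n\<ge>N. p (x m \<oplus> y m \<ominus> (x n \<oplus> y n)) < e" by blast
qed (use cauchy_closed[OF x] cauchy_closed[OF y] in simp)

lemma cauchy_bounded:
  assumes x: "x \<in> cauchy_seqs A p"
  obtains B where "B > 0" "\<And>n. p (x n) \<le> B"
proof -
  note [simp] = cauchy_closed[OF x]
  obtain N where N: "\<And>m n. \<lbrakk>m \<ge> N; n \<ge> N\<rbrakk> \<Longrightarrow> p (x m \<ominus> x n) < 1"
    using cauchyD[OF x, of 1] by auto
  define B where "B = (\<Sum>k\<le>N. p (x k)) + 1"
  have le: "p (x n) \<le> B - 1" if "n \<le> N" for n
    using that member_le_sum[of n "{..N}" "\<lambda>k. p (x k)"] by (simp add: B_def)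
  have "p (x n) \<le> B" for n
  proof (cases "n \<le> N")
    case False
    then have "p (x n) \<le> p (x N) + 1"
      using p_abs_diff[of "x n" "x N"] N[of n N] x by simp
    then show ?thesis using le[of N] by simp
  qed (use le in force)
  moreover have "B > 0" using x by (simp add: B_def add_nonneg_pos sum_nonneg)
  ultimately show thesis using that by blast
qed

lemma cauchy_mult [simp]:
  assumes x: "x \<in> cauchy_seqs A p" and y: "y \<in> cauchy_seqs A p"
  shows "(\<lambda>n. x n \<otimes> y n) \<in> cauchy_seqs A p"
  unfolding cauchy_seqs_def
proof (intro CollectI conjI allI impI)
  note [simp] = cauchy_closed[OF x] cauchy_closed[OF y]
  obtain B where B: "B > 0" "\<And>n. p (x n) \<le> B" using cauchy_bounded[OF x] by blast
  obtain D where D: "D > 0" "\<And>n. p (y n) \<le> D" using cauchy_bounded[OF y] by blast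
  fix e :: real assume "e > 0"
  then have pos: "e / (2 * D) > 0" "e / (2 * B) > 0" using B D by simp_all
  obtain M where M: "\<And>m n. \<lbrakk>m \<ge> M; n \<ge> M\<rbrakk> \<Longrightarrow> p (x m \<ominus> x n) < e / (2 * D)"
    using cauchyD[OF x pos(1)] by blast
  obtain N where N: "\<And>m n. \<lbrakk>m \<ge> N; n \<ge> N\<rbrakk> \<Longrightarrow> p (y m \<ominus> y n) < e / (2 * B)"
    using cauchyD[OF y pos(2)] by blast
  have "p (x m \<otimes> y m \<ominus> x n \<otimes> y n) < e" if "m \<ge> max M N" "n \<ge> max M N" for m n
  proof -
    have "p (x m \<otimes> y m \<ominus> x n \<otimes> y n) \<le> p (x m) * p (y m \<ominus> y n) + p (x m \<ominus> x n) * p (y n)"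
      using p_triangle[of "x m \<otimes> (y m \<ominus> y n)" "(x m \<ominus> x n) \<otimes> y n"]
        p_mult[of "x m" "y m \<ominus> y n"] p_mult[of "x m \<ominus> x n" "y n"] x y
      by (simp add: mult_diff_mult)
    moreover have "p (x m) * p (y m \<ominus> y n) \<le> B * p (y m \<ominus> y n)"
      using B(2)[of m] x y by (simp add: mult_right_mono)
    moreover have "B * p (y m \<ominus> y n) < e / 2"
      using N[of m n] that B(1) by (simp add: field_simps)
    moreover have "p (x m \<ominus> x n) * p (y n) \<le> p (x m \<ominus> x n) * D"
      using D(2)[of n] x y by (simp add: mult_left_mono)
    moreover have "p (x m \<ominus> x n) * D < e / 2"
      using M[of m n] that D(1) by (simp add: field_simps)
    ultimately show ?thesis by linarith
  qed
  then show "\<exists>N. \<forall>m\<ge>N. \<forall>n\<ge>N. p (x m \<otimes> y m \<ominus> x n \<otimes> y n) < e" by blast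
qed (use cauchy_closed[OF x] cauchy_closed[OF y] in simp)

lemma cauchy_scale [simp]:
  assumes "x \<in> cauchy_seqs A p" shows "(\<lambda>n. c \<odot> x n) \<in> cauchy_seqs A p"
proof (cases "c = 0")
  case False
  note [simp] = cauchy_closed[OF assms]
  show ?thesis
    unfolding cauchy_seqs_def
  proof (intro CollectI conjI allI impI)
    fix e :: real assume "e > 0"
    then obtain N where "\<forall>m\<ge>N. \<forall>n\<ge>N. p (x m \<ominus> x n) < e / cmod c"
      using cauchyD[OF assms, of "e / cmod c"] False by auto
    then show "\<exists>N. \<forall>m\<ge>N. \<forall>n\<ge>N. p (c \<odot> x m \<ominus> c \<odot> x n) < e"
      using False by (intro exI[of _ N]) (simp add: field_simps flip: scale_diff_right)
  qed (use cauchy_closed[OF assms] in simp)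
qed (use cauchy_closed[OF assms] in simp)

lemma cauchy_star [simp]:
  assumes "x \<in> cauchy_seqs A p" shows "(\<lambda>n. star A (x n)) \<in> cauchy_seqs A p"
proof -
  note [simp] = cauchy_closed[OF assms]
  have "p (star A (x m) \<ominus> star A (x n)) = p (x m \<ominus> x n)" for m n
    using p_star[of "x m \<ominus> x n"] by (simp del: p_star)
  then show ?thesis using assms by (simp add: cauchy_seqs_def)
qed

lemma equiv_null_rel: "equiv (cauchy_seqs A p) (null_rel A p)"
proof (rule equivI)
  show "sym (null_rel A p)"
  proof (rule symI)
    fix x y assume "(x, y) \<in> null_rel A p"
    then show "(y, x) \<in> null_rel A p"
      using p_diff_commute[of "x n" "y n" for n] cauchy_closed[of x] cauchy_closed[of y]
      by (simp add: null_rel_def)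
  qed
  show "trans (null_rel A p)"
  proof (rule transI)
    fix x y z assume xy: "(x, y) \<in> null_rel A p" and yz: "(y, z) \<in> null_rel A p"
    have c: "x \<in> cauchy_seqs A p" "y \<in> cauchy_seqs A p" "z \<in> cauchy_seqs A p"
      using xy yz by (auto simp: null_rel_def)
    note [simp] = cauchy_closed[OF c(1)] cauchy_closed[OF c(2)] cauchy_closed[OF c(3)]
    have "(\<lambda>n. p (x n \<ominus> y n) + p (y n \<ominus> z n)) \<longlonglongrightarrow> 0"
      using xy yz by (intro tendsto_add_zero) (auto simp: null_rel_def)
    then have "(\<lambda>n. p (x n \<ominus> z n)) \<longlonglongrightarrow> 0"
    proof (rule tendsto_sandwich[of "\<lambda>_. 0", rotated -1])
      show "\<forall>\<^sub>F n in sequentially. p (x n \<ominus> z n) \<le> p (x n \<ominus> y n) + p (y n \<ominus> z n)"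
        using c by (simp add: p_diff_trans)
    qed (use c in simp_all)
    then show "(x, z) \<in> null_rel A p" using c by (simp add: null_rel_def)
  qed
qed (auto simp: refl_on_def null_rel_def cauchy_closed)

lemma seq_class_eq_iff:
  "\<lbrakk>x \<in> cauchy_seqs A p; y \<in> cauchy_seqs A p\<rbrakk> \<Longrightarrow>
    seq_class x = seq_class y \<longleftrightarrow> (\<lambda>n. p (x n \<ominus> y n)) \<longlonglongrightarrow> 0"
  using eq_equiv_class_iff[OF equiv_null_rel] by (simp add: null_rel_def)

lemma null_relI:
  assumes "x \<in> cauchy_seqs A p" "y \<in> cauchy_seqs A p" "\<And>n. p (x n \<ominus> y n) \<le> b n" "b \<longlonglongrightarrow> 0"
  shows "(x, y) \<in> null_rel A p"
proof -
  have "(\<lambda>n. p (x n \<ominus> y n)) \<longlonglongrightarrow> 0"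
    by (rule tendsto_sandwich[of "\<lambda>_. 0" _ _ b])
      (use assms cauchy_closed[of x] cauchy_closed[of y] in simp_all)
  then show ?thesis using assms by (simp add: null_rel_def)
qed

lemma null_relD:
  assumes "(x, y) \<in> null_rel A p"
  shows "x \<in> cauchy_seqs A p" "y \<in> cauchy_seqs A p" "(\<lambda>n. p (x n \<ominus> y n)) \<longlonglongrightarrow> 0"
    and "x n \<in> carrier A" "y n \<in> carrier A"
  using assms by (auto simp: null_rel_def cauchy_seqs_def)

lemma null_rel_add:
  assumes "(x, x') \<in> null_rel A p" "(y, y') \<in> null_rel A p"
  shows "(\<lambda>n. x n \<oplus> y n, \<lambda>n. x' n \<oplus> y' n) \<in> null_rel A p"
proof (rule null_relI)
  note c = null_relD(1,2,4,5)[OF assms(1)] null_relD(1,2,4,5)[OF assms(2)]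
  show "p (x n \<oplus> y n \<ominus> (x' n \<oplus> y' n)) \<le> p (x n \<ominus> x' n) + p (y n \<ominus> y' n)" for n
    using c by (simp add: add_diff_add p_triangle)
  show "(\<lambda>n. p (x n \<ominus> x' n) + p (y n \<ominus> y' n)) \<longlonglongrightarrow> 0"
    using null_relD(3)[OF assms(1)] null_relD(3)[OF assms(2)] by (rule tendsto_add_zero)
qed (use null_relD(1,2,4,5)[OF assms(1)] null_relD(1,2,4,5)[OF assms(2)] in simp_all)

lemma null_rel_mult:
  assumes "(x, x') \<in> null_rel A p" "(y, y') \<in> null_rel A p"
  shows "(\<lambda>n. x n \<otimes> y n, \<lambda>n. x' n \<otimes> y' n) \<in> null_rel A p"
proof -
  note c = null_relD(1,2,4,5)[OF assms(1)] null_relD(1,2,4,5)[OF assms(2)]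
  obtain B where B: "\<And>n. p (x n) \<le> B" using cauchy_bounded[OF c(1)] by blast
  obtain D where D: "\<And>n. p (y' n) \<le> D" using cauchy_bounded[OF c(6)] by blast
  show ?thesis
  proof (rule null_relI)
    show "p (x n \<otimes> y n \<ominus> x' n \<otimes> y' n) \<le> B * p (y n \<ominus> y' n) + p (x n \<ominus> x' n) * D" for n
    proof -
      have "p (x n \<otimes> y n \<ominus> x' n \<otimes> y' n) \<le> p (x n) * p (y n \<ominus> y' n) + p (x n \<ominus> x' n) * p (y' n)"
        using p_triangle[of "x n \<otimes> (y n \<ominus> y' n)" "(x n \<ominus> x' n) \<otimes> y' n"]
          p_mult[of "x n" "y n \<ominus> y' n"] p_mult[of "x n \<ominus> x' n" "y' n"] c
        by (simp add: mult_diff_mult)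
      also have "\<dots> \<le> B * p (y n \<ominus> y' n) + p (x n \<ominus> x' n) * D"
        using c B D by (intro add_mono mult_left_mono mult_right_mono) simp_all
      finally show ?thesis .
    qed
    show "(\<lambda>n. B * p (y n \<ominus> y' n) + p (x n \<ominus> x' n) * D) \<longlonglongrightarrow> 0"
      using null_relD(3)[OF assms(1)] null_relD(3)[OF assms(2)]
      by (intro tendsto_add_zero tendsto_mult_right_zero tendsto_mult_left_zero)
  qed (use c in simp_all)
qed

lemma null_rel_scale:
  assumes "(x, x') \<in> null_rel A p"
  shows "(\<lambda>n. c \<odot> x n, \<lambda>n. c \<odot> x' n) \<in> null_rel A p"
proof (rule null_relI)
  show "p (c \<odot> x n \<ominus> c \<odot> x' n) \<le> cmod c * p (x n \<ominus> x' n)" for n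
    using null_relD(1,2,4,5)[OF assms] p_scale[of "x n \<ominus> x' n" c]
    by (simp add: scale_diff_right del: p_scale)
  show "(\<lambda>n. cmod c * p (x n \<ominus> x' n)) \<longlonglongrightarrow> 0"
    using null_relD(3)[OF assms] by (rule tendsto_mult_right_zero)
qed (use null_relD(1,2,4,5)[OF assms] in simp_all)

lemma null_rel_star:
  assumes "(x, x') \<in> null_rel A p"
  shows "(\<lambda>n. star A (x n), \<lambda>n. star A (x' n)) \<in> null_rel A p"
proof (rule null_relI)
  show "p (star A (x n) \<ominus> star A (x' n)) \<le> p (x n \<ominus> x' n)" for n
    using null_relD(1,2,4,5)[OF assms] p_star[of "x n \<ominus> x' n"] by (simp del: p_star)
qed (use null_relD[OF assms] in simp_all)

lemma seq_class_cong: "(x, y) \<in> null_rel A p \<Longrightarrow> seq_class x = seq_class y"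
  by (rule equiv_class_eq[OF equiv_null_rel])

text \<open>The operation is a union over all representatives; congruence makes every member of that
  union the same class. The other operations follow this pattern.\<close>

lemma completion_add:
  assumes "x \<in> cauchy_seqs A p" "y \<in> cauchy_seqs A p"
  shows "seq_class x \<oplus>\<^bsub>completion A p\<^esub> seq_class y = seq_class (\<lambda>n. x n \<oplus> y n)"
proof -
  have "congruent2 (null_rel A p) (null_rel A p) (\<lambda>x y. seq_class (\<lambda>n. x n \<oplus> y n))"
    by (intro congruent2I' seq_class_cong null_rel_add)
  then show ?thesis
    using UN_equiv_class2[OF equiv_null_rel equiv_null_rel] assms by (simp add: completion_def)
qed

lemma completion_mult:
  assumes "x \<in> cauchy_seqs A p" "y \<in> cauchy_seqs A p"
  shows "seq_class x \<otimes>\<^bsub>completion A p\<^esub> seq_class y = seq_class (\<lambda>n. x n \<otimes> y n)"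
proof -
  have "congruent2 (null_rel A p) (null_rel A p) (\<lambda>x y. seq_class (\<lambda>n. x n \<otimes> y n))"
    by (intro congruent2I' seq_class_cong null_rel_mult)
  then show ?thesis
    using UN_equiv_class2[OF equiv_null_rel equiv_null_rel] assms by (simp add: completion_def)
qed

lemma completion_scale:
  assumes "x \<in> cauchy_seqs A p"
  shows "c \<odot>\<^bsub>completion A p\<^esub> seq_class x = seq_class (\<lambda>n. c \<odot> x n)"
proof -
  have "congruent (null_rel A p) (\<lambda>x. seq_class (\<lambda>n. c \<odot> x n))"
    by (intro congruentI seq_class_cong null_rel_scale)
  then show ?thesis
    using UN_equiv_class[OF equiv_null_rel] assms by (simp add: completion_def)
qed

lemma completion_star:
  assumes "x \<in> cauchy_seqs A p"
  shows "star (completion A p) (seq_class x) = seq_class (\<lambda>n. star A (x n))"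
proof -
  have "congruent (null_rel A p) (\<lambda>x. seq_class (\<lambda>n. star A (x n)))"
    by (intro congruentI seq_class_cong null_rel_star)
  then show ?thesis
    using UN_equiv_class[OF equiv_null_rel] assms by (simp add: completion_def)
qed

lemma completion_zero: "\<zero>\<^bsub>completion A p\<^esub> = seq_class (\<lambda>n. \<zero>)"
  by (simp add: completion_def)

lemma seq_class_closed [simp]: "x \<in> cauchy_seqs A p \<Longrightarrow> seq_class x \<in> carrier (completion A p)"
  by (simp add: completion_def quotientI)

lemma completion_cases:
  assumes "X \<in> carrier (completion A p)"
  obtains x where "x \<in> cauchy_seqs A p" "X = seq_class x"
  using assms by (auto simp: completion_def elim: quotientE)

lemma norm_convergent: "x \<in> cauchy_seqs A p \<Longrightarrow> convergent (\<lambda>n. p (x n))"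
proof (rule Cauchy_convergent, rule CauchyI)
  fix e :: real assume x: "x \<in> cauchy_seqs A p" and "e > 0"
  then obtain N where N: "\<forall>m\<ge>N. \<forall>n\<ge>N. p (x m \<ominus> x n) < e" using cauchyD by blast
  note [simp] = cauchy_closed[OF x]
  have "norm (p (x m) - p (x n)) < e" if "m \<ge> N" "n \<ge> N" for m n
    using N p_abs_diff[of "x m" "x n"] that by (simp add: le_less_trans)
  then show "\<exists>N. \<forall>m\<ge>N. \<forall>n\<ge>N. norm (p (x m) - p (x n)) < e" by blast
qed

text \<open>Sequences in one class have norms differing by a null sequence, so the definite
  description in \<open>completion\<close> has exactly one witness.\<close>

lemma completion_norm:
  assumes x: "x \<in> cauchy_seqs A p" and lim: "(\<lambda>n. p (x n)) \<longlonglongrightarrow> r"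
  shows "cnorm (completion A p) (seq_class x) = r"
proof -
  have "(\<lambda>n. p (y n)) \<longlonglongrightarrow> r" if "(x, y) \<in> null_rel A p" for y
  proof -
    note c = null_relD[OF that]
    have "(\<lambda>n. p (x n) - p (y n)) \<longlonglongrightarrow> 0"
    proof (rule tendsto_rabs_zero_cancel, rule tendsto_sandwich[where f = "\<lambda>_. 0"])
      show "\<forall>\<^sub>F n in sequentially. \<bar>p (x n) - p (y n)\<bar> \<le> p (x n \<ominus> y n)"
        using c p_abs_diff by simp
    qed (use c in simp_all)
    from tendsto_diff[OF lim this] show ?thesis by simp
  qed
  then have "(THE r. \<forall>y\<in>seq_class x. (\<lambda>n. p (y n)) \<longlonglongrightarrow> r) = r"
    using equiv_class_self[OF equiv_null_rel x]
    by (intro the_equality) (auto intro: LIMSEQ_unique[OF _ lim])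
  then show ?thesis by (simp add: completion_def)
qed

lemma completion_norm_lim:
  "x \<in> cauchy_seqs A p \<Longrightarrow> (\<lambda>n. p (x n)) \<longlonglongrightarrow> cnorm (completion A p) (seq_class x)"
  using norm_convergent completion_norm by (metis convergent_LIMSEQ_iff)

lemmas completion_ops =
  completion_add completion_mult completion_scale completion_star completion_zero

lemma star_algebra_completion: "star_algebra (completion A p)"
proof -
  let ?K = "completion A p"
  have "abelian_group ?K"
  proof (rule abelian_groupI)
    fix X assume "X \<in> carrier ?K"
    then obtain x where x: "x \<in> cauchy_seqs A p" "X = seq_class x" by (rule completion_cases)
    note [simp] = cauchy_closed[OF x(1)]
    have "seq_class (\<lambda>n. (-1) \<odot> x n) \<oplus>\<^bsub>?K\<^esub> X = \<zero>\<^bsub>?K\<^esub>"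
      using x by (simp add: completion_ops a_comm)
    then show "\<exists>Y\<in>carrier ?K. Y \<oplus>\<^bsub>?K\<^esub> X = \<zero>\<^bsub>?K\<^esub>"
      using x by (intro bexI[of _ "seq_class (\<lambda>n. (-1) \<odot> x n)"]) simp_all
  qed (auto elim!: completion_cases simp: completion_ops cauchy_closed a_ac)
  then have "module complex_ring ?K"
    by (rule moduleI[OF cring_complex_ring])
      (auto elim!: completion_cases simp: completion_ops cauchy_closed scale_add_left scale_add_right)
  then show ?thesis
    by (rule star_algebra.intro, unfold_locales)
      (auto elim!: completion_cases simp: completion_ops cauchy_closed mult_assoc mult_l_distr mult_r_distr)
qed

lemma cstar_seminorm_completion: "cstar_seminorm (completion A p) (cnorm (completion A p))"
proof -
  let ?K = "completion A p"
  show ?thesis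
    unfolding cstar_seminorm_def
  proof (intro conjI ballI allI)
    fix X assume "X \<in> carrier ?K"
    then obtain x where x: "x \<in> cauchy_seqs A p" "X = seq_class x" by (rule completion_cases)
    note [simp] = cauchy_closed[OF x(1)]
    note lx = completion_norm_lim[OF x(1)]
    show "0 \<le> cnorm ?K X"
      using LIMSEQ_le_const[OF lx, of 0] x by simp
    show "cnorm ?K (c \<odot>\<^bsub>?K\<^esub> X) = cmod c * cnorm ?K X" for c
    proof -
      have "(\<lambda>n. p (c \<odot> x n)) \<longlonglongrightarrow> cmod c * cnorm ?K X"
        using tendsto_mult_left[OF lx, of "cmod c"] x by simp
      then show ?thesis using x by (simp add: completion_ops completion_norm)
    qed
    show "cnorm ?K (star ?K X \<otimes>\<^bsub>?K\<^esub> X) = (cnorm ?K X)\<^sup>2"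
    proof -
      have "(\<lambda>n. p (star A (x n) \<otimes> x n)) \<longlonglongrightarrow> (cnorm ?K X)\<^sup>2"
        using tendsto_power[OF lx, of 2] x by (simp add: p_cstar)
      then show ?thesis using x by (simp add: completion_ops completion_norm)
    qed
    fix Y assume "Y \<in> carrier ?K"
    then obtain y where y: "y \<in> cauchy_seqs A p" "Y = seq_class y" by (rule completion_cases)
    note [simp] = cauchy_closed[OF y(1)]
    note ly = completion_norm_lim[OF y(1)]
    show "cnorm ?K (X \<oplus>\<^bsub>?K\<^esub> Y) \<le> cnorm ?K X + cnorm ?K Y"
      using LIMSEQ_le[OF completion_norm_lim[OF cauchy_add[OF x(1) y(1)]] tendsto_add[OF lx ly]]
        x y by (simp add: completion_ops p_triangle)
    show "cnorm ?K (X \<otimes>\<^bsub>?K\<^esub> Y) \<le> cnorm ?K X * cnorm ?K Y"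
      using LIMSEQ_le[OF completion_norm_lim[OF cauchy_mult[OF x(1) y(1)]] tendsto_mult[OF lx ly]]
        x y by (simp add: completion_ops p_mult)
  qed
qed

lemma completion_in_closed [simp]:
  "a \<in> carrier A \<Longrightarrow> completion_in A p a \<in> carrier (completion A p)"
  by (simp add: completion_in_def)

lemma star_hom_completion_in: "star_hom A (completion A p) (completion_in A p)"
  unfolding star_hom_def linear_on_def
  by (auto simp: completion_in_def completion_ops)

lemma completion_in_norm: "a \<in> carrier A \<Longrightarrow> cnorm (completion A p) (completion_in A p a) = p a"
  by (simp add: completion_in_def completion_norm)

lemma is_unit_completion_in:
  assumes "is_unit A u" shows "is_unit (completion A p) (completion_in A p u)"
  using assms unfolding is_unit_def
  by (auto simp: completion_in_def completion_ops cauchy_closed elim!: completion_cases)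

end

section \<open>Star homomorphisms and their contractivity\<close>

lemma star_hom_simps:
  assumes "star_hom A B f"
  shows "x \<in> carrier A \<Longrightarrow> f x \<in> carrier B"
    and "\<lbrakk>x \<in> carrier A; y \<in> carrier A\<rbrakk> \<Longrightarrow> f (x \<oplus>\<^bsub>A\<^esub> y) = f x \<oplus>\<^bsub>B\<^esub> f y"
    and "x \<in> carrier A \<Longrightarrow> f (c \<odot>\<^bsub>A\<^esub> x) = c \<odot>\<^bsub>B\<^esub> f x"
    and "\<lbrakk>x \<in> carrier A; y \<in> carrier A\<rbrakk> \<Longrightarrow> f (x \<otimes>\<^bsub>A\<^esub> y) = f x \<otimes>\<^bsub>B\<^esub> f y"
    and "x \<in> carrier A \<Longrightarrow> f (star A x) = star B (f x)"
  using assms unfolding star_hom_def linear_on_def by auto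

lemma star_hom_diff:
  assumes "star_algebra A" "star_algebra B" "star_hom A B f" "x \<in> carrier A" "y \<in> carrier A"
  shows "f (x \<ominus>\<^bsub>A\<^esub> y) = f x \<ominus>\<^bsub>B\<^esub> f y"
proof -
  interpret A: star_algebra A by fact
  interpret B: star_algebra B by fact
  show ?thesis
    using assms(4,5) by (simp add: A.diff_eq_scale B.diff_eq_scale star_hom_simps[OF assms(3)])
qed

lemma star_hom_zero:
  assumes "star_algebra A" "star_algebra B" "star_hom A B f"
  shows "f \<zero>\<^bsub>A\<^esub> = \<zero>\<^bsub>B\<^esub>"
proof -
  interpret A: star_algebra A by fact
  interpret B: star_algebra B by fact
  show ?thesis
    using star_hom_simps(3)[OF assms(3), of "\<zero>\<^bsub>A\<^esub>" 0] star_hom_simps(1)[OF assms(3)] by simp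
qed

lemma star_hom_comp:
  "\<lbrakk>star_hom A B f; star_hom B C g\<rbrakk> \<Longrightarrow> star_hom A C (g \<circ> f)"
  unfolding star_hom_def linear_on_def by auto

text \<open>The source of the norm estimates for star homomorphisms: a pulled-back C*-seminorm is
  compared with the norm of a unital C*-algebra or with the universal norm.\<close>

lemma cstar_seminorm_pullback:
  assumes "cstar_seminorm B p" "star_hom A B f" "star_algebra A"
  shows "cstar_seminorm A (\<lambda>x. p (f x))"
proof -
  interpret A: star_algebra A by fact
  show ?thesis
    using assms(1) unfolding cstar_seminorm_def by (auto simp: star_hom_simps[OF assms(2)])
qed

lemma star_hom_contractive:
  assumes "cstar_algebra A" "cstar_algebra B" "star_hom A B f" "is_unit A u" "x \<in> carrier A"
  shows "cnorm B (f x) \<le> cnorm A x"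
  using cstar_algebra.seminorm_le_norm[OF assms(1,4) cstar_seminorm_pullback[OF _ assms(3)]]
    cstar_algebra.cnorm_seminorm[OF assms(2)] cstar_algebra.axioms(1)[OF assms(1)] assms(5) by blast

text \<open>Meant for \<open>from_universal\<close>, whose surjectivity thereby yields a unit of the
  crossed product.\<close>

lemma is_unit_surj_image:
  assumes "surj_star_hom A B f" "is_unit A u"
  shows "is_unit B (f u)"
proof -
  have h: "star_hom A B f" and im: "carrier B = f ` carrier A"
    using assms(1) by (auto simp: surj_star_hom_def)
  show ?thesis
    using assms(2) unfolding is_unit_def im by (auto simp flip: star_hom_simps(4)[OF h])
qed

section \<open>Completeness of the completion\<close>

context seminormed_star_algebra
begin

lemma seminormed_star_algebra_completion:
  "seminormed_star_algebra (completion A p) (cnorm (completion A p))"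
  using star_algebra_completion cstar_seminorm_completion
  by (simp add: seminormed_star_algebra_def seminormed_star_algebra_axioms_def)

lemma completion_diff:
  assumes "x \<in> cauchy_seqs A p" "y \<in> cauchy_seqs A p"
  shows "seq_class x \<ominus>\<^bsub>completion A p\<^esub> seq_class y = seq_class (\<lambda>n. x n \<ominus> y n)"
proof -
  interpret K: star_algebra "completion A p" by (rule star_algebra_completion)
  show ?thesis
    using assms by (simp add: K.diff_eq_scale completion_ops diff_eq_scale cauchy_closed)
qed

lemma cauchy_diff: "\<lbrakk>x \<in> cauchy_seqs A p; y \<in> cauchy_seqs A p\<rbrakk> \<Longrightarrow> (\<lambda>n. x n \<ominus> y n) \<in> cauchy_seqs A p"
  using cauchy_add[of x "\<lambda>n. (-1) \<odot> y n"] by (simp add: diff_eq_scale cauchy_closed)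

lemma completion_in_dist:
  assumes x: "x \<in> cauchy_seqs A p" and N: "\<And>m. m \<ge> N \<Longrightarrow> p (x m \<ominus> x k) \<le> e"
  shows "cnorm (completion A p) (seq_class x \<ominus>\<^bsub>completion A p\<^esub> completion_in A p (x k)) \<le> e"
proof -
  have "(\<lambda>m. p (x m \<ominus> x k)) \<longlonglongrightarrow>
      cnorm (completion A p) (seq_class x \<ominus>\<^bsub>completion A p\<^esub> completion_in A p (x k))"
    using completion_norm_lim[OF cauchy_diff[OF x cauchy_const, of "x k"]] x
    by (simp add: completion_in_def completion_diff cauchy_closed)
  then show ?thesis by (rule LIMSEQ_le_const2) (use N in blast)
qed

lemma completion_in_tendsto:
  assumes x: "x \<in> cauchy_seqs A p"
  shows "(\<lambda>k. cnorm (completion A p) (seq_class x \<ominus>\<^bsub>completion A p\<^esub> completion_in A p (x k))) \<longlonglongrightarrow> 0"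
proof (rule LIMSEQ_I)
  interpret K: seminormed_star_algebra "completion A p" "cnorm (completion A p)"
    by (rule seminormed_star_algebra_completion)
  fix e :: real assume "e > 0"
  then have e2: "e / 2 > 0" by simp
  obtain N where N: "\<And>m k. \<lbrakk>m \<ge> N; k \<ge> N\<rbrakk> \<Longrightarrow> p (x m \<ominus> x k) < e/2"
    using cauchyD[OF x e2] by blast
  have "norm (cnorm (completion A p) (seq_class x \<ominus>\<^bsub>completion A p\<^esub> completion_in A p (x k)) - 0) < e"
    if "k \<ge> N" for k
  proof -
    have "cnorm (completion A p) (seq_class x \<ominus>\<^bsub>completion A p\<^esub> completion_in A p (x k)) \<le> e/2"
      using N that by (intro completion_in_dist[OF x, of N] less_imp_le) blast
    moreover have "0 \<le> cnorm (completion A p) (seq_class x \<ominus>\<^bsub>completion A p\<^esub> completion_in A p (x k))"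
      using x by (intro K.p_nonneg K.minus_closed) (simp_all add: cauchy_closed)
    ultimately show ?thesis using \<open>e > 0\<close> by simp
  qed
  then show "\<exists>N. \<forall>k\<ge>N. norm (cnorm (completion A p)
      (seq_class x \<ominus>\<^bsub>completion A p\<^esub> completion_in A p (x k)) - 0) < e" by blast
qed

text \<open>A Cauchy sequence \<open>U\<close> in the completion is approximated by a sequence \<open>y\<close> in the algebra, the
  \<open>k\<close>-th term up to \<open>1/(k+1)\<close>; then \<open>y\<close> is Cauchy and its class is the limit.\<close>

lemma completion_complete:
  assumes U: "U \<in> cauchy_seqs (completion A p) (cnorm (completion A p))"
  shows "\<exists>L\<in>carrier (completion A p).
    (\<lambda>n. cnorm (completion A p) (U n \<ominus>\<^bsub>completion A p\<^esub> L)) \<longlonglongrightarrow> 0"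
proof -
  let ?K = "completion A p"
  interpret K: seminormed_star_algebra ?K "cnorm ?K" by (rule seminormed_star_algebra_completion)
  note Uc = K.cauchy_closed[OF U]
  have "\<exists>a. a \<in> carrier A \<and> cnorm ?K (U k \<ominus>\<^bsub>?K\<^esub> completion_in A p a) \<le> 1 / real (Suc k)" for k
  proof -
    obtain x where x: "x \<in> cauchy_seqs A p" "U k = seq_class x"
      using completion_cases[OF Uc[of k]] by blast
    have pos: "1 / real (Suc k) > 0" by simp
    obtain N where N: "\<And>m n. \<lbrakk>m \<ge> N; n \<ge> N\<rbrakk> \<Longrightarrow> p (x m \<ominus> x n) < 1 / real (Suc k)"
      using cauchyD[OF x(1) pos] by blast
    have "cnorm ?K (U k \<ominus>\<^bsub>?K\<^esub> completion_in A p (x N)) \<le> 1 / real (Suc k)"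
      unfolding x(2) using N by (intro completion_in_dist[OF x(1), of N] less_imp_le) blast
    then show ?thesis using cauchy_closed[OF x(1)] by blast
  qed
  then obtain y where yc: "\<And>k. y k \<in> carrier A"
    and y: "\<And>k. cnorm ?K (U k \<ominus>\<^bsub>?K\<^esub> completion_in A p (y k)) \<le> 1 / real (Suc k)"
    by metis
  let ?c = "\<lambda>k. completion_in A p (y k)"
  have cc: "?c k \<in> carrier ?K" for k using yc by simp
  have dist: "p (y m \<ominus> y n) \<le> 1 / real (Suc m) + cnorm ?K (U m \<ominus>\<^bsub>?K\<^esub> U n) + 1 / real (Suc n)" for m n
  proof -
    have "p (y m \<ominus> y n) = cnorm ?K (?c m \<ominus>\<^bsub>?K\<^esub> ?c n)"
      using yc completion_in_norm[of "y m \<ominus> y n"]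
        star_hom_diff[OF star_algebra_axioms star_algebra_completion star_hom_completion_in, of "y m" "y n"]
      by simp
    also have "\<dots> \<le> cnorm ?K (?c m \<ominus>\<^bsub>?K\<^esub> U m) + cnorm ?K (U m \<ominus>\<^bsub>?K\<^esub> ?c n)"
      by (rule K.p_diff_trans[OF cc Uc cc])
    also have "\<dots> \<le> cnorm ?K (?c m \<ominus>\<^bsub>?K\<^esub> U m) +
        (cnorm ?K (U m \<ominus>\<^bsub>?K\<^esub> U n) + cnorm ?K (U n \<ominus>\<^bsub>?K\<^esub> ?c n))"
      using K.p_diff_trans[OF Uc Uc cc, of m n n] by simp
    finally show ?thesis
      using y[of m] y[of n] K.p_diff_commute[OF cc Uc, of m m] by linarith
  qed
  have inv: "\<exists>N. \<forall>n\<ge>N. 1 / real (Suc n) < e" if e: "e > 0" for e :: real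
  proof -
    obtain N where N: "inverse (real (Suc N)) < e" using reals_Archimedean[OF e] by blast
    have "1 / real (Suc n) < e" if "n \<ge> N" for n
    proof -
      have "1 / real (Suc n) \<le> 1 / real (Suc N)" using that by (intro divide_left_mono) simp_all
      then show ?thesis using N by (simp add: inverse_eq_divide)
    qed
    then show ?thesis by blast
  qed
  have yC: "y \<in> cauchy_seqs A p"
    unfolding cauchy_seqs_def
  proof (intro CollectI conjI allI impI yc)
    fix e :: real assume "e > 0"
    then have e3: "e / 3 > 0" by simp
    obtain M where M: "\<And>n. n \<ge> M \<Longrightarrow> 1 / real (Suc n) < e/3" using inv[OF e3] by blast
    obtain N where N: "\<And>m n. \<lbrakk>m \<ge> N; n \<ge> N\<rbrakk> \<Longrightarrow> cnorm ?K (U m \<ominus>\<^bsub>?K\<^esub> U n) < e/3"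
      using K.cauchyD[OF U e3] by blast
    have "p (y m \<ominus> y n) < e" if mn: "m \<ge> max M N" "n \<ge> max M N" for m n
    proof -
      have "m \<ge> M" "n \<ge> M" "m \<ge> N" "n \<ge> N" using mn by simp_all
      then show ?thesis using dist[of m n] M[of m] M[of n] N[of m n] by linarith
    qed
    then show "\<exists>N. \<forall>m\<ge>N. \<forall>n\<ge>N. p (y m \<ominus> y n) < e" by blast
  qed
  have lim: "(\<lambda>k. 1 / real (Suc k) + cnorm ?K (seq_class y \<ominus>\<^bsub>?K\<^esub> ?c k)) \<longlonglongrightarrow> 0"
  proof (rule tendsto_add_zero)
    show "(\<lambda>k. 1 / real (Suc k)) \<longlonglongrightarrow> 0"
      using LIMSEQ_inverse_real_of_nat by (simp add: inverse_eq_divide)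
  qed (rule completion_in_tendsto[OF yC])
  have "(\<lambda>n. cnorm ?K (U n \<ominus>\<^bsub>?K\<^esub> seq_class y)) \<longlonglongrightarrow> 0"
  proof (rule tendsto_sandwich[OF _ _ tendsto_const lim])
    have "cnorm ?K (U n \<ominus>\<^bsub>?K\<^esub> seq_class y) \<le> 1 / real (Suc n) + cnorm ?K (seq_class y \<ominus>\<^bsub>?K\<^esub> ?c n)" for n
      using K.p_diff_trans[OF Uc cc seq_class_closed[OF yC], of n n] y[of n]
        K.p_diff_commute[OF cc seq_class_closed[OF yC], of n] by linarith
    then show "\<forall>\<^sub>F n in sequentially. cnorm ?K (U n \<ominus>\<^bsub>?K\<^esub> seq_class y)
        \<le> 1 / real (Suc n) + cnorm ?K (seq_class y \<ominus>\<^bsub>?K\<^esub> ?c n)" by simp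
    show "\<forall>\<^sub>F n in sequentially. 0 \<le> cnorm ?K (U n \<ominus>\<^bsub>?K\<^esub> seq_class y)"
      using Uc seq_class_closed[OF yC] by simp
  qed
  then show ?thesis using seq_class_closed[OF yC] by (rule bexI)
qed

lemma cstar_algebra_completion: "cstar_algebra (completion A p)"
proof (rule cstar_algebra.intro[OF star_algebra_completion], rule cstar_algebra_axioms.intro)
  let ?K = "completion A p"
  show "cstar_seminorm ?K (cnorm ?K)" by (rule cstar_seminorm_completion)
  fix U assume "U \<in> cauchy_seqs ?K (cnorm ?K)"
  then show "\<exists>L\<in>carrier ?K. (\<lambda>n. cnorm ?K (U n \<ominus>\<^bsub>?K\<^esub> L)) \<longlonglongrightarrow> 0"
    by (rule completion_complete)
next
  let ?K = "completion A p"
  fix X assume X: "X \<in> carrier ?K" and X0: "cnorm ?K X = 0"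
  obtain x where x: "x \<in> cauchy_seqs A p" "X = seq_class x" using completion_cases[OF X] by blast
  have "(\<lambda>n. p (x n \<ominus> \<zero>)) \<longlonglongrightarrow> 0"
    using completion_norm_lim[OF x(1)] X0 x(2) cauchy_closed[OF x(1)] by simp
  then show "X = \<zero>\<^bsub>?K\<^esub>"
    using x by (simp add: completion_zero seq_class_eq_iff)
qed

end

text \<open>\<open>completion_map\<close> is a union over all representatives, and the class of a
  constant sequence also has non-constant ones. Contractivity keeps their images Cauchy and
  equivalent to the constant sequence \<open>h a\<close>.\<close>

lemma completion_map_completion_in:
  assumes A: "seminormed_star_algebra A p" and B: "seminormed_star_algebra B q"
    and h: "star_hom A B h" and le: "\<And>x. x \<in> carrier A \<Longrightarrow> q (h x) \<le> p x"
    and a: "a \<in> carrier A"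
  shows "completion_map B q h (completion_in A p a) = completion_in B q (h a)"
proof -
  interpret A: seminormed_star_algebra A p by fact
  interpret B: seminormed_star_algebra B q by fact
  have "null_rel B q `` {\<lambda>n. h (x n)} = completion_in B q (h a)"
    if x: "x \<in> completion_in A p a" for x
  proof -
    have "(\<lambda>n. a, x) \<in> null_rel A p" using x by (simp add: completion_in_def)
    note d = A.null_relD[OF this]
    have diff: "h (x m \<ominus>\<^bsub>A\<^esub> x n) = h (x m) \<ominus>\<^bsub>B\<^esub> h (x n)" for m n
      by (rule star_hom_diff[OF A.star_algebra_axioms B.star_algebra_axioms h d(5) d(5)])
    have hx: "(\<lambda>n. h (x n)) \<in> cauchy_seqs B q"
      unfolding cauchy_seqs_def
    proof (intro CollectI conjI allI impI)
      fix e :: real assume "e > 0"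
      then obtain N where "\<And>m n. \<lbrakk>m \<ge> N; n \<ge> N\<rbrakk> \<Longrightarrow> p (x m \<ominus>\<^bsub>A\<^esub> x n) < e"
        using A.cauchyD[OF d(2)] by blast
      then have "q (h (x m) \<ominus>\<^bsub>B\<^esub> h (x n)) < e" if "m \<ge> N" "n \<ge> N" for m n
        using le[OF A.minus_closed[OF d(5) d(5)], of m n] that diff by (metis le_less_trans)
      then show "\<exists>N. \<forall>m\<ge>N. \<forall>n\<ge>N. q (h (x m) \<ominus>\<^bsub>B\<^esub> h (x n)) < e" by blast
    qed (use star_hom_simps(1)[OF h] d(5) in blast)
    have "(\<lambda>n. h a, \<lambda>n. h (x n)) \<in> null_rel B q"
    proof (rule B.null_relI[OF _ hx])
      show "q (h a \<ominus>\<^bsub>B\<^esub> h (x n)) \<le> p (a \<ominus>\<^bsub>A\<^esub> x n)" for n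
        using le[OF A.minus_closed[OF a d(5)]]
          star_hom_diff[OF A.star_algebra_axioms B.star_algebra_axioms h a d(5)] by simp
    qed (use d star_hom_simps(1)[OF h a] in simp_all)
    then show ?thesis using B.seq_class_cong by (simp add: completion_in_def)
  qed
  \<comment> \<open>A union of equal sets is that set only over a nonempty index set.\<close>
  moreover have "(\<lambda>n. a) \<in> completion_in A p a"
    using a by (simp add: completion_in_def null_rel_def)
  ultimately show ?thesis unfolding completion_map_def by blast
qed

section \<open>The convolution algebra\<close>

context star_algebra
begin

lemma finsum_neutral_cong:
  assumes "finite S" "finite T" "\<And>i. F i \<in> carrier A"
    and "\<And>i. i \<in> S \<Longrightarrow> i \<notin> T \<Longrightarrow> F i = \<zero>" "\<And>i. i \<in> T \<Longrightarrow> i \<notin> S \<Longrightarrow> F i = \<zero>"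
  shows "finsum A F S = finsum A F T"
  using assms by (intro add.finprod_mono_neutral_cong) auto

text \<open>Stated for an abstract additive \<open>h\<close> to serve multiplication from either
  side, scaling, the involution and the group action alike.\<close>

lemma finsum_additive:
  assumes "finite S" "\<And>i. i \<in> S \<Longrightarrow> F i \<in> carrier A"
    and "\<And>x. x \<in> carrier A \<Longrightarrow> h x \<in> carrier A" "h \<zero> = \<zero>"
    and "\<And>x y. \<lbrakk>x \<in> carrier A; y \<in> carrier A\<rbrakk> \<Longrightarrow> h (x \<oplus> y) = h x \<oplus> h y"
  shows "h (finsum A F S) = finsum A (\<lambda>i. h (F i)) S"
  using assms(1,2)
proof (induction S)
  case (insert i S)
  then have "F \<in> S \<rightarrow> carrier A" "(\<lambda>i. h (F i)) \<in> S \<rightarrow> carrier A" using assms(3) by auto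
  then show ?case using insert assms(3-5) by simp
qed (use assms(4) in simp)

lemma finsum_mult_right:
  assumes "finite S" "\<And>i. i \<in> S \<Longrightarrow> F i \<in> carrier A" "x \<in> carrier A"
  shows "finsum A F S \<otimes> x = finsum A (\<lambda>i. F i \<otimes> x) S"
  by (rule finsum_additive[of S F "\<lambda>y. y \<otimes> x"]) (use assms in \<open>auto simp: mult_l_distr\<close>)

lemma finsum_mult_left:
  assumes "finite S" "\<And>i. i \<in> S \<Longrightarrow> F i \<in> carrier A" "x \<in> carrier A"
  shows "x \<otimes> finsum A F S = finsum A (\<lambda>i. x \<otimes> F i) S"
  by (rule finsum_additive[of S F "\<lambda>y. x \<otimes> y"]) (use assms in \<open>auto simp: mult_r_distr\<close>)

lemma finsum_swap:
  assumes "finite S" "finite T" "\<And>i j. F i j \<in> carrier A"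
  shows "finsum A (\<lambda>i. finsum A (F i) T) S = finsum A (\<lambda>j. finsum A (\<lambda>i. F i j) S) T"
  using assms(1)
proof (induction S)
  case (insert i S)
  have "finsum A (\<lambda>j. finsum A (\<lambda>i. F i j) (insert i S)) T
      = finsum A (\<lambda>j. F i j \<oplus> finsum A (\<lambda>i. F i j) S) T"
    using insert assms by simp
  also have "\<dots> = finsum A (F i) T \<oplus> finsum A (\<lambda>j. finsum A (\<lambda>i. F i j) S) T"
    using assms by (subst finsum_addf) auto
  finally show ?case using insert assms by simp
qed simp

end

section \<open>C*-algebras with a group action and their convolution algebras\<close>

locale g_cstar = G: group G + cstar_algebra A
  for G :: "('g, 'k) monoid_scheme" and A :: "('a, 'g) g_cstar_algebra" (structure) +
  assumes g_cstar_algebra: "g_cstar_algebra G A"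
begin

lemma act_star_hom: "s \<in> carrier G \<Longrightarrow> star_hom A A (act A s)"
  using g_cstar_algebra by (auto simp: g_cstar_algebra_def star_aut_def)

lemma act_simps [simp]:
  assumes "s \<in> carrier G"
  shows "x \<in> carrier A \<Longrightarrow> act A s x \<in> carrier A"
    and "\<lbrakk>x \<in> carrier A; y \<in> carrier A\<rbrakk> \<Longrightarrow> act A s (x \<oplus> y) = act A s x \<oplus> act A s y"
    and "x \<in> carrier A \<Longrightarrow> act A s (c \<odot> x) = c \<odot> act A s x"
    and "\<lbrakk>x \<in> carrier A; y \<in> carrier A\<rbrakk> \<Longrightarrow> act A s (x \<otimes> y) = act A s x \<otimes> act A s y"
    and "x \<in> carrier A \<Longrightarrow> act A s (star A x) = star A (act A s x)"
  using star_hom_simps[OF act_star_hom[OF assms]] by auto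

lemma act_zero [simp]: "s \<in> carrier G \<Longrightarrow> act A s \<zero> = \<zero>"
  using star_hom_zero[OF star_algebra_axioms star_algebra_axioms act_star_hom] by blast

lemma act_act:
  "\<lbrakk>s \<in> carrier G; t \<in> carrier G; x \<in> carrier A\<rbrakk> \<Longrightarrow> act A s (act A t x) = act A (s \<otimes>\<^bsub>G\<^esub> t) x"
  using g_cstar_algebra by (simp add: g_cstar_algebra_def)

lemma act_inj:
  "\<lbrakk>s \<in> carrier G; x \<in> carrier A; y \<in> carrier A; act A s x = act A s y\<rbrakk> \<Longrightarrow> x = y"
  using g_cstar_algebra by (auto simp: g_cstar_algebra_def star_aut_def bij_betw_def dest: inj_onD)

text \<open>Multiplicativity of the action makes the identity of G act by an idempotent map, and an
  injective idempotent map is the identity.\<close>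

lemma act_one [simp]: "x \<in> carrier A \<Longrightarrow> act A \<one>\<^bsub>G\<^esub> x = x"
  by (rule act_inj[of "\<one>\<^bsub>G\<^esub>"]) (simp_all add: act_act)

text \<open>\<open>act A s\<close> takes the value u at some x, namely the translate of u by the
  inverse of s. Applying it to u x = x gives \<open>act A s u \<otimes> u = u\<close>.\<close>

lemma act_unit: 
  assumes u: "is_unit A u" and s: "s \<in> carrier G" shows "act A s u = u"
proof -
  have uc: "u \<in> carrier A" using u by (simp add: is_unit_def)
  have "act A s (act A (inv\<^bsub>G\<^esub> s) u) = act A s (u \<otimes> act A (inv\<^bsub>G\<^esub> s) u)"
    using u s uc by (simp add: is_unit_def)
  also have "\<dots> = act A s u \<otimes> act A s (act A (inv\<^bsub>G\<^esub> s) u)" using s uc by simp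
  also have "act A s (act A (inv\<^bsub>G\<^esub> s) u) = u" using s uc by (simp add: act_act)
  finally show ?thesis using u s uc by (simp add: is_unit_def)
qed

abbreviation T :: "('g \<Rightarrow> 'a) star_algebra" where "T \<equiv> alg_crossed_product G A"

abbreviation supp :: "('g \<Rightarrow> 'a) \<Rightarrow> 'g set" where "supp f \<equiv> {s. f s \<noteq> \<zero>}"

lemma algI:
  assumes "\<And>s. s \<in> carrier G \<Longrightarrow> f s \<in> carrier A" "\<And>s. s \<notin> carrier G \<Longrightarrow> f s = \<zero>"
    and "finite S" "\<And>s. \<lbrakk>s \<in> carrier G; s \<notin> S\<rbrakk> \<Longrightarrow> f s = \<zero>"
  shows "f \<in> carrier T"
proof -
  have "supp f \<subseteq> S" using assms by blast
  then have "finite (supp f)" using assms(3) finite_subset by blast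
  then show ?thesis using assms(1,2) by (simp add: alg_crossed_product_def)
qed

lemma algD:
  assumes "f \<in> carrier T"
  shows "f s \<in> carrier A" "s \<notin> carrier G \<Longrightarrow> f s = \<zero>" "finite (supp f)" "supp f \<subseteq> carrier G"
  using assms by (auto simp: alg_crossed_product_def)

lemma alg_ops:
  "f \<oplus>\<^bsub>T\<^esub> g = (\<lambda>t. f t \<oplus> g t)" "\<zero>\<^bsub>T\<^esub> = (\<lambda>t. \<zero>)" "c \<odot>\<^bsub>T\<^esub> f = (\<lambda>t. c \<odot> f t)"
  by (auto simp: alg_crossed_product_def)

lemma alg_star:
  assumes f: "f \<in> carrier T"
  shows "star T f = (\<lambda>t. if t \<in> carrier G then star A (act A t (f (inv\<^bsub>G\<^esub> t))) else \<zero>)"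
  using algD(1)[OF f] by (auto simp: alg_crossed_product_def fun_eq_iff)

text \<open>The definition sums over \<open>supp f\<close>. Allowing any finite superset inside G
  makes convolutions with different supports comparable.\<close>

lemma conv_eq:
  assumes f: "f \<in> carrier T" and g: "g \<in> carrier T" and t: "t \<in> carrier G"
    and S: "finite S" "S \<subseteq> carrier G" "\<And>s. \<lbrakk>s \<in> carrier G; s \<notin> S\<rbrakk> \<Longrightarrow> f s = \<zero>"
  shows "(f \<otimes>\<^bsub>T\<^esub> g) t = (\<Oplus>s\<in>S. f s \<otimes> act A s (g (inv\<^bsub>G\<^esub> s \<otimes>\<^bsub>G\<^esub> t)))"
proof -
  have "supp f \<subseteq> S" using S(3) algD(4)[OF f] by blast
  moreover have "f s \<otimes> act A s (g (inv\<^bsub>G\<^esub> s \<otimes>\<^bsub>G\<^esub> t)) \<in> carrier A" if "s \<in> S" for s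
    using that S(2) algD(1)[OF f] algD(1)[OF g] by auto
  moreover have "f s \<otimes> act A s (g (inv\<^bsub>G\<^esub> s \<otimes>\<^bsub>G\<^esub> t)) = \<zero>" if "s \<in> S - supp f" for s
    using that S(2) algD(1)[OF g] by auto
  ultimately have "(\<Oplus>s\<in>supp f. f s \<otimes> act A s (g (inv\<^bsub>G\<^esub> s \<otimes>\<^bsub>G\<^esub> t)))
      = (\<Oplus>s\<in>S. f s \<otimes> act A s (g (inv\<^bsub>G\<^esub> s \<otimes>\<^bsub>G\<^esub> t)))"
    using S(1) by (intro add.finprod_mono_neutral_cong_left) auto
  then show ?thesis using t by (simp add: alg_crossed_product_def)
qed

lemma conv_supp:
  assumes f: "f \<in> carrier T" and g: "g \<in> carrier T" and t: "t \<in> carrier G"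
    and nt: "t \<notin> (\<lambda>(s, r). s \<otimes>\<^bsub>G\<^esub> r) ` (supp f \<times> supp g)"
  shows "(f \<otimes>\<^bsub>T\<^esub> g) t = \<zero>"
proof -
  have "f s \<otimes> act A s (g (inv\<^bsub>G\<^esub> s \<otimes>\<^bsub>G\<^esub> t)) = \<zero>" if "s \<in> supp f" for s
  proof -
    have s: "s \<in> carrier G" using that algD(4)[OF f] by blast
    have "t = s \<otimes>\<^bsub>G\<^esub> (inv\<^bsub>G\<^esub> s \<otimes>\<^bsub>G\<^esub> t)" using s t by (simp add: G.m_assoc[symmetric])
    then have "inv\<^bsub>G\<^esub> s \<otimes>\<^bsub>G\<^esub> t \<notin> supp g" using nt that by force
    then show ?thesis using s algD(1)[OF f] by simp
  qed
  then have "(\<Oplus>s\<in>supp f. f s \<otimes> act A s (g (inv\<^bsub>G\<^esub> s \<otimes>\<^bsub>G\<^esub> t))) = \<zero>"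
    by (rule add.finprod_one_eqI)
  then show ?thesis using t by (simp add: alg_crossed_product_def)
qed

lemma conv_closed: 
  assumes f: "f \<in> carrier T" and g: "g \<in> carrier T" shows "f \<otimes>\<^bsub>T\<^esub> g \<in> carrier T"
proof (rule algI)
  show "finite ((\<lambda>(s, r). s \<otimes>\<^bsub>G\<^esub> r) ` (supp f \<times> supp g))"
    using algD(3)[OF f] algD(3)[OF g] by simp
  show "(f \<otimes>\<^bsub>T\<^esub> g) s \<in> carrier A" if "s \<in> carrier G" for s
  proof -
    have "(f \<otimes>\<^bsub>T\<^esub> g) s = (\<Oplus>r\<in>supp f. f r \<otimes> act A r (g (inv\<^bsub>G\<^esub> r \<otimes>\<^bsub>G\<^esub> s)))"
      using that by (simp add: alg_crossed_product_def)
    also have "\<dots> \<in> carrier A"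
      using algD[OF f] algD[OF g] by (intro finsum_closed Pi_I mult_closed act_simps) auto
    finally show ?thesis .
  qed
  show "(f \<otimes>\<^bsub>T\<^esub> g) s = \<zero>" if "s \<notin> carrier G" for s
    using that by (simp add: alg_crossed_product_def)
qed (rule conv_supp[OF f g])

lemma star_alg_closed: "f \<in> carrier T \<Longrightarrow> star T f \<in> carrier T"
proof (rule algI[where S = "(\<lambda>s. inv\<^bsub>G\<^esub> s) ` supp f"])
  assume f: "f \<in> carrier T"
  show "finite ((\<lambda>s. inv\<^bsub>G\<^esub> s) ` supp f)" using algD(3)[OF f] by simp
  show "star T f s = \<zero>" if "s \<in> carrier G" "s \<notin> (\<lambda>s. inv\<^bsub>G\<^esub> s) ` supp f" for s
  proof -
    have "f (inv\<^bsub>G\<^esub> s) = \<zero>" using that by (metis (mono_tags, lifting) G.inv_inv image_eqI mem_Collect_eq)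
    then show ?thesis using f that by (simp add: alg_star)
  qed
qed (simp_all add: alg_star algD(1))

lemma add_alg_closed: 
  assumes f: "f \<in> carrier T" and g: "g \<in> carrier T" shows "f \<oplus>\<^bsub>T\<^esub> g \<in> carrier T"
proof (rule algI)
  show "finite (supp f \<union> supp g)" using algD(3)[OF f] algD(3)[OF g] by simp
qed (use algD[OF f] algD[OF g] f in \<open>simp_all add: alg_ops(1)\<close>)

lemma scale_alg_closed: 
  assumes f: "f \<in> carrier T" shows "c \<odot>\<^bsub>T\<^esub> f \<in> carrier T"
  by (rule algI[OF _ _ algD(3)[OF f]]) (use algD[OF f] f in \<open>simp_all add: alg_ops(3)\<close>)

lemma zero_alg_closed: "\<zero>\<^bsub>T\<^esub> \<in> carrier T"
  by (simp add: alg_crossed_product_def)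

lemma inj_on_translate:
  "\<lbrakk>s \<in> carrier G; Q \<subseteq> carrier G\<rbrakk> \<Longrightarrow> inj_on (\<lambda>q. s \<otimes>\<^bsub>G\<^esub> q) Q"
  by (rule inj_onI) (metis G.Units_eq G.Units_l_cancel subsetD)

text \<open>After exchanging the sums over s and r, the substitution r = s q turns the inner sum
  into the convolution of g and h, evaluated at t translated by the inverse of s.\<close>

lemma conv_assoc:
  assumes f: "f \<in> carrier T" and g: "g \<in> carrier T" and h: "h \<in> carrier T"
  shows "(f \<otimes>\<^bsub>T\<^esub> g) \<otimes>\<^bsub>T\<^esub> h = f \<otimes>\<^bsub>T\<^esub> (g \<otimes>\<^bsub>T\<^esub> h)"
proof
  fix t
  note [simp] = algD(1)[OF f] algD(1)[OF g] algD(1)[OF h]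
  let ?S = "supp f" and ?Q = "supp g"
  define R where "R = (\<lambda>(s, r). s \<otimes>\<^bsub>G\<^esub> r) ` (?S \<times> ?Q)"
  have S: "finite ?S" "?S \<subseteq> carrier G" and Q: "finite ?Q" "?Q \<subseteq> carrier G"
    using algD(3,4)[OF f] algD(3,4)[OF g] by auto
  have R: "finite R" "R \<subseteq> carrier G" using S Q by (auto simp: R_def)
  show "((f \<otimes>\<^bsub>T\<^esub> g) \<otimes>\<^bsub>T\<^esub> h) t = (f \<otimes>\<^bsub>T\<^esub> (g \<otimes>\<^bsub>T\<^esub> h)) t"
  proof (cases "t \<in> carrier G")
    case t: True
    \<comment> \<open>Set to zero outside G because \<open>finsum_swap\<close> wants every value in
      the carrier.\<close>
    define F where "F s r = (if s \<in> carrier G \<and> r \<in> carrier G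
      then (f s \<otimes> act A s (g (inv\<^bsub>G\<^esub> s \<otimes>\<^bsub>G\<^esub> r))) \<otimes> act A r (h (inv\<^bsub>G\<^esub> r \<otimes>\<^bsub>G\<^esub> t)) else \<zero>)" for s r
    have Fc: "F s r \<in> carrier A" for s r by (simp add: F_def)
    have "((f \<otimes>\<^bsub>T\<^esub> g) \<otimes>\<^bsub>T\<^esub> h) t = (\<Oplus>r\<in>R. (f \<otimes>\<^bsub>T\<^esub> g) r \<otimes> act A r (h (inv\<^bsub>G\<^esub> r \<otimes>\<^bsub>G\<^esub> t)))"
      by (rule conv_eq[OF conv_closed[OF f g] h t R]) (use conv_supp[OF f g] R_def in blast)
    also have "\<dots> = (\<Oplus>r\<in>R. \<Oplus>s\<in>?S. F s r)"
    proof (rule add.finprod_cong')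
      fix r assume "r \<in> R"
      then have r: "r \<in> carrier G" using R by blast
      have "(f \<otimes>\<^bsub>T\<^esub> g) r \<otimes> act A r (h (inv\<^bsub>G\<^esub> r \<otimes>\<^bsub>G\<^esub> t))
          = (\<Oplus>s\<in>?S. f s \<otimes> act A s (g (inv\<^bsub>G\<^esub> s \<otimes>\<^bsub>G\<^esub> r))) \<otimes> act A r (h (inv\<^bsub>G\<^esub> r \<otimes>\<^bsub>G\<^esub> t))"
        using conv_eq[OF f g r S] by simp
      also have "\<dots> = (\<Oplus>s\<in>?S. (f s \<otimes> act A s (g (inv\<^bsub>G\<^esub> s \<otimes>\<^bsub>G\<^esub> r))) \<otimes> act A r (h (inv\<^bsub>G\<^esub> r \<otimes>\<^bsub>G\<^esub> t)))"
        using S r by (intro finsum_mult_right) auto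
      also have "\<dots> = (\<Oplus>s\<in>?S. F s r)"
        using S(2) r by (intro add.finprod_cong') (auto simp: F_def)
      finally show "(f \<otimes>\<^bsub>T\<^esub> g) r \<otimes> act A r (h (inv\<^bsub>G\<^esub> r \<otimes>\<^bsub>G\<^esub> t)) = (\<Oplus>s\<in>?S. F s r)" .
    qed (use Fc in auto)
    also have "\<dots> = (\<Oplus>s\<in>?S. \<Oplus>r\<in>R. F s r)"
      using finsum_swap[OF R(1) S(1), of "\<lambda>r s. F s r"] Fc by blast
    also have "\<dots> = (\<Oplus>s\<in>?S. f s \<otimes> act A s ((g \<otimes>\<^bsub>T\<^esub> h) (inv\<^bsub>G\<^esub> s \<otimes>\<^bsub>G\<^esub> t)))"
    proof (rule add.finprod_cong')
      fix s assume s: "s \<in> ?S"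
      then have sG: "s \<in> carrier G" using S by blast
      have st: "inv\<^bsub>G\<^esub> s \<otimes>\<^bsub>G\<^esub> t \<in> carrier G" using sG t by simp
      let ?H = "\<lambda>q. g q \<otimes> act A q (h (inv\<^bsub>G\<^esub> q \<otimes>\<^bsub>G\<^esub> (inv\<^bsub>G\<^esub> s \<otimes>\<^bsub>G\<^esub> t)))"
      have Hc: "?H q \<in> carrier A" if "q \<in> ?Q" for q using that Q by auto
      \<comment> \<open>For fixed s only products r = s q with q in \<open>supp g\<close>
        contribute: g vanishes at the inverse of s times any other r.\<close>
      have "(\<Oplus>r\<in>R. F s r) = (\<Oplus>r\<in>(\<lambda>q. s \<otimes>\<^bsub>G\<^esub> q) ` ?Q. F s r)"
      proof (rule add.finprod_mono_neutral_cong_right)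
        show "(\<lambda>q. s \<otimes>\<^bsub>G\<^esub> q) ` ?Q \<subseteq> R" using s by (auto simp: R_def)
        show "F s r = \<zero>" if r: "r \<in> R - (\<lambda>q. s \<otimes>\<^bsub>G\<^esub> q) ` ?Q" for r
        proof -
          have rG: "r \<in> carrier G" using r R by blast
          have "r = s \<otimes>\<^bsub>G\<^esub> (inv\<^bsub>G\<^esub> s \<otimes>\<^bsub>G\<^esub> r)" using sG rG by (simp add: G.m_assoc[symmetric])
          then have "g (inv\<^bsub>G\<^esub> s \<otimes>\<^bsub>G\<^esub> r) = \<zero>" using r by blast
          then show ?thesis using sG rG by (simp add: F_def)
        qed
      qed (use R Fc in auto)
      also have "\<dots> = (\<Oplus>q\<in>?Q. F s (s \<otimes>\<^bsub>G\<^esub> q))"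
        by (rule finsum_reindex) (use Fc inj_on_translate[OF sG Q(2)] in auto)
      also have "\<dots> = (\<Oplus>q\<in>?Q. f s \<otimes> act A s (?H q))"
      proof (rule add.finprod_cong')
        fix q assume "q \<in> ?Q"
        then have q: "q \<in> carrier G" using Q by blast
        have 1: "inv\<^bsub>G\<^esub> s \<otimes>\<^bsub>G\<^esub> (s \<otimes>\<^bsub>G\<^esub> q) = q" using sG q by (simp add: G.m_assoc[symmetric])
        have 2: "inv\<^bsub>G\<^esub> (s \<otimes>\<^bsub>G\<^esub> q) \<otimes>\<^bsub>G\<^esub> t = inv\<^bsub>G\<^esub> q \<otimes>\<^bsub>G\<^esub> (inv\<^bsub>G\<^esub> s \<otimes>\<^bsub>G\<^esub> t)"
          using sG q t by (simp add: G.inv_mult_group G.m_assoc)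
        show "F s (s \<otimes>\<^bsub>G\<^esub> q) = f s \<otimes> act A s (?H q)"
          using sG q t by (simp add: F_def 1 2 act_act mult_assoc)
      qed (use Hc sG in auto)
      also have "\<dots> = f s \<otimes> (\<Oplus>q\<in>?Q. act A s (?H q))"
        using Hc sG Q by (intro finsum_mult_left[symmetric]) auto
      also have "(\<Oplus>q\<in>?Q. act A s (?H q)) = act A s (\<Oplus>q\<in>?Q. ?H q)"
        using Hc sG Q(1) by (intro finsum_additive[symmetric]) auto
      also have "(\<Oplus>q\<in>?Q. ?H q) = (g \<otimes>\<^bsub>T\<^esub> h) (inv\<^bsub>G\<^esub> s \<otimes>\<^bsub>G\<^esub> t)"
        using conv_eq[OF g h st Q] by simp
      finally show "(\<Oplus>r\<in>R. F s r) = f s \<otimes> act A s ((g \<otimes>\<^bsub>T\<^esub> h) (inv\<^bsub>G\<^esub> s \<otimes>\<^bsub>G\<^esub> t))" .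
    qed (use S algD(1)[OF conv_closed[OF g h]] in auto)
    also have "\<dots> = (f \<otimes>\<^bsub>T\<^esub> (g \<otimes>\<^bsub>T\<^esub> h)) t"
      using conv_eq[OF f conv_closed[OF g h] t S] by simp
    finally show ?thesis .
  qed (simp add: alg_crossed_product_def)
qed

text \<open>The substitution r = t s matches the summands. The translated support of f and the
  support of \<open>star T g\<close> are different index sets, but \<open>F\<close> vanishes
  wherever just one of them applies.\<close>

lemma conv_star:
  assumes f: "f \<in> carrier T" and g: "g \<in> carrier T"
  shows "star T (f \<otimes>\<^bsub>T\<^esub> g) = star T g \<otimes>\<^bsub>T\<^esub> star T f"
proof
  fix t
  note [simp] = algD(1)[OF f] algD(1)[OF g]
  let ?S = "supp f"
  have S: "finite ?S" "?S \<subseteq> carrier G" using algD(3,4)[OF f] by auto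
  show "star T (f \<otimes>\<^bsub>T\<^esub> g) t = (star T g \<otimes>\<^bsub>T\<^esub> star T f) t"
  proof (cases "t \<in> carrier G")
    case t: True
    let ?H = "\<lambda>s. f s \<otimes> act A s (g (inv\<^bsub>G\<^esub> s \<otimes>\<^bsub>G\<^esub> inv\<^bsub>G\<^esub> t))"
    define F where "F r = (if r \<in> carrier G
      then star A (act A r (g (inv\<^bsub>G\<^esub> r))) \<otimes> star A (act A t (f (inv\<^bsub>G\<^esub> t \<otimes>\<^bsub>G\<^esub> r))) else \<zero>)" for r
    have Fc: "F r \<in> carrier A" for r using t by (simp add: F_def)
    have Hc: "?H s \<in> carrier A" if "s \<in> ?S" for s using that S by auto
    have "star T (f \<otimes>\<^bsub>T\<^esub> g) t = star A (act A t (\<Oplus>s\<in>?S. ?H s))"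
      using t conv_eq[OF f g _ S, of "inv\<^bsub>G\<^esub> t"] conv_closed[OF f g] by (simp add: alg_star)
    also have "\<dots> = (\<Oplus>s\<in>?S. star A (act A t (?H s)))"
      using finsum_additive[of ?S ?H "\<lambda>x. star A (act A t x)"] Hc S(1) t by simp
    also have "\<dots> = (\<Oplus>s\<in>?S. F (t \<otimes>\<^bsub>G\<^esub> s))"
    proof (rule add.finprod_cong')
      fix s assume "s \<in> ?S"
      then have s: "s \<in> carrier G" using S by blast
      have "inv\<^bsub>G\<^esub> t \<otimes>\<^bsub>G\<^esub> (t \<otimes>\<^bsub>G\<^esub> s) = s" using s t by (simp add: G.m_assoc[symmetric])
      then show "star A (act A t (?H s)) = F (t \<otimes>\<^bsub>G\<^esub> s)"
        using s t by (simp add: F_def act_act G.inv_mult_group)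
    qed (use Fc in auto)
    also have "\<dots> = (\<Oplus>r\<in>(\<lambda>s. t \<otimes>\<^bsub>G\<^esub> s) ` ?S. F r)"
      by (rule finsum_reindex[symmetric]) (use Fc inj_on_translate[OF t S(2)] in auto)
    also have "\<dots> = (\<Oplus>r\<in>supp (star T g). F r)"
    proof (rule finsum_neutral_cong[OF _ _ Fc])
      show "F r = \<zero>" if "r \<in> supp (star T g)" "r \<notin> (\<lambda>s. t \<otimes>\<^bsub>G\<^esub> s) ` ?S" for r
      proof (cases "r \<in> carrier G")
        case r: True
        have "r = t \<otimes>\<^bsub>G\<^esub> (inv\<^bsub>G\<^esub> t \<otimes>\<^bsub>G\<^esub> r)" using r t by (simp add: G.m_assoc[symmetric])
        then have "f (inv\<^bsub>G\<^esub> t \<otimes>\<^bsub>G\<^esub> r) = \<zero>" using that(2) by blast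
        then show ?thesis using r t by (simp add: F_def)
      qed (simp add: F_def)
      show "F r = \<zero>" if "r \<in> (\<lambda>s. t \<otimes>\<^bsub>G\<^esub> s) ` ?S" "r \<notin> supp (star T g)" for r
        using that t g by (auto simp: F_def alg_star)
    qed (use S algD(3)[OF star_alg_closed[OF g]] in auto)
    also have "\<dots> = (\<Oplus>r\<in>supp (star T g). star T g r \<otimes> act A r (star T f (inv\<^bsub>G\<^esub> r \<otimes>\<^bsub>G\<^esub> t)))"
    proof (rule add.finprod_cong')
      fix r assume "r \<in> supp (star T g)"
      then have r: "r \<in> carrier G" using algD(4)[OF star_alg_closed[OF g]] by blast
      have "r \<otimes>\<^bsub>G\<^esub> (inv\<^bsub>G\<^esub> r \<otimes>\<^bsub>G\<^esub> t) = t" using r t by (simp add: G.m_assoc[symmetric])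
      then show "F r = star T g r \<otimes> act A r (star T f (inv\<^bsub>G\<^esub> r \<otimes>\<^bsub>G\<^esub> t))"
        using r t f g by (simp add: F_def alg_star act_act G.inv_mult_group)
    qed (use algD(1,4)[OF star_alg_closed[OF g]] algD(1)[OF star_alg_closed[OF f]] in auto)
    also have "\<dots> = (star T g \<otimes>\<^bsub>T\<^esub> star T f) t"
      using conv_eq[OF star_alg_closed[OF g] star_alg_closed[OF f] t
          algD(3)[OF star_alg_closed[OF g]] algD(4)[OF star_alg_closed[OF g]]] by simp
    finally show ?thesis .
  qed (use conv_closed[OF f g] in \<open>simp add: alg_crossed_product_def\<close>)
qed

lemma star_algebra_alg: "star_algebra T"
proof -
  have cl: "f \<oplus>\<^bsub>T\<^esub> g \<in> carrier T" "c \<odot>\<^bsub>T\<^esub> f \<in> carrier T" "star T f \<in> carrier T"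
    "f \<otimes>\<^bsub>T\<^esub> g \<in> carrier T" if "f \<in> carrier T" "g \<in> carrier T" for f g c
    using that add_alg_closed scale_alg_closed star_alg_closed conv_closed by auto
  have eqI: "f = g" if "\<And>t. t \<in> carrier G \<Longrightarrow> f t = g t" "f \<in> carrier T" "g \<in> carrier T" for f g
  proof
    fix t show "f t = g t" using that algD(2) by (cases "t \<in> carrier G") metis+
  qed
  have "abelian_group T"
  proof (rule abelian_groupI)
    fix f g h assume f: "f \<in> carrier T" and g: "g \<in> carrier T" and h: "h \<in> carrier T"
    note [simp] = algD(1)[OF f] algD(1)[OF g] algD(1)[OF h]
    show "f \<oplus>\<^bsub>T\<^esub> g \<in> carrier T" using cl f g by blast
    show "f \<oplus>\<^bsub>T\<^esub> g \<oplus>\<^bsub>T\<^esub> h = f \<oplus>\<^bsub>T\<^esub> (g \<oplus>\<^bsub>T\<^esub> h)" "f \<oplus>\<^bsub>T\<^esub> g = g \<oplus>\<^bsub>T\<^esub> f"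
      by (simp_all add: alg_ops a_ac)
  next
    fix f assume f: "f \<in> carrier T"
    note [simp] = algD(1)[OF f]
    show "\<zero>\<^bsub>T\<^esub> \<oplus>\<^bsub>T\<^esub> f = f" by (simp add: alg_ops)
    have "((-1) \<odot>\<^bsub>T\<^esub> f) \<oplus>\<^bsub>T\<^esub> f = \<zero>\<^bsub>T\<^esub>" by (simp add: alg_ops a_comm)
    then show "\<exists>g\<in>carrier T. g \<oplus>\<^bsub>T\<^esub> f = \<zero>\<^bsub>T\<^esub>" using cl(2)[OF f f] by (rule bexI)
  qed (rule zero_alg_closed)
  then have "module complex_ring T"
  proof (rule moduleI[OF cring_complex_ring])
    fix f g c d assume f: "f \<in> carrier T" and g: "g \<in> carrier T"
    note [simp] = algD(1)[OF f] algD(1)[OF g]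
    show "c \<odot>\<^bsub>T\<^esub> f \<in> carrier T" using cl f by blast
    show "(c \<oplus>\<^bsub>complex_ring\<^esub> d) \<odot>\<^bsub>T\<^esub> f = c \<odot>\<^bsub>T\<^esub> f \<oplus>\<^bsub>T\<^esub> d \<odot>\<^bsub>T\<^esub> f"
      "c \<odot>\<^bsub>T\<^esub> (f \<oplus>\<^bsub>T\<^esub> g) = c \<odot>\<^bsub>T\<^esub> f \<oplus>\<^bsub>T\<^esub> c \<odot>\<^bsub>T\<^esub> g"
      "(c \<otimes>\<^bsub>complex_ring\<^esub> d) \<odot>\<^bsub>T\<^esub> f = c \<odot>\<^bsub>T\<^esub> (d \<odot>\<^bsub>T\<^esub> f)"
      "\<one>\<^bsub>complex_ring\<^esub> \<odot>\<^bsub>T\<^esub> f = f"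
      by (simp_all add: alg_ops scale_add_left scale_add_right)
  qed
  moreover have "star_algebra_axioms T"
  proof
    fix f g h assume f: "f \<in> carrier T" and g: "g \<in> carrier T" and h: "h \<in> carrier T"
    note [simp] = algD(1)[OF f] algD(1)[OF g] algD(1)[OF h]
    show "f \<otimes>\<^bsub>T\<^esub> g \<otimes>\<^bsub>T\<^esub> h = f \<otimes>\<^bsub>T\<^esub> (g \<otimes>\<^bsub>T\<^esub> h)" by (rule conv_assoc[OF f g h])
    show "star T (f \<otimes>\<^bsub>T\<^esub> g) = star T g \<otimes>\<^bsub>T\<^esub> star T f" by (rule conv_star[OF f g])
    show "star T (f \<oplus>\<^bsub>T\<^esub> g) = star T f \<oplus>\<^bsub>T\<^esub> star T g"
      using cl f g by (auto simp: alg_star alg_ops(1) fun_eq_iff)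
    show "(f \<oplus>\<^bsub>T\<^esub> g) \<otimes>\<^bsub>T\<^esub> h = f \<otimes>\<^bsub>T\<^esub> h \<oplus>\<^bsub>T\<^esub> g \<otimes>\<^bsub>T\<^esub> h"
    proof (rule eqI)
      fix t assume t: "t \<in> carrier G"
      \<comment> \<open>One index set for f, g and their sum, whose support may shrink by
        cancellation.\<close>
      let ?S = "supp f \<union> supp g"
      have S: "finite ?S" "?S \<subseteq> carrier G" using algD(3,4)[OF f] algD(3,4)[OF g] by auto
      have "((f \<oplus>\<^bsub>T\<^esub> g) \<otimes>\<^bsub>T\<^esub> h) t = (\<Oplus>s\<in>?S. (f \<oplus>\<^bsub>T\<^esub> g) s \<otimes> act A s (h (inv\<^bsub>G\<^esub> s \<otimes>\<^bsub>G\<^esub> t)))"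
        using f by (intro conv_eq[OF cl(1)[OF f g] h t S]) (auto simp: alg_ops(1))
      also have "\<dots> = (\<Oplus>s\<in>?S. f s \<otimes> act A s (h (inv\<^bsub>G\<^esub> s \<otimes>\<^bsub>G\<^esub> t)) \<oplus> g s \<otimes> act A s (h (inv\<^bsub>G\<^esub> s \<otimes>\<^bsub>G\<^esub> t)))"
        using S(2) f by (intro add.finprod_cong') (auto simp: alg_ops(1) mult_l_distr)
      also have "\<dots> = (\<Oplus>s\<in>?S. f s \<otimes> act A s (h (inv\<^bsub>G\<^esub> s \<otimes>\<^bsub>G\<^esub> t)))
          \<oplus> (\<Oplus>s\<in>?S. g s \<otimes> act A s (h (inv\<^bsub>G\<^esub> s \<otimes>\<^bsub>G\<^esub> t)))"
        using S(2) by (intro finsum_addf) auto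
      also have "\<dots> = (f \<otimes>\<^bsub>T\<^esub> h) t \<oplus> (g \<otimes>\<^bsub>T\<^esub> h) t"
        using conv_eq[OF f h t S] conv_eq[OF g h t S] by simp
      finally show "((f \<oplus>\<^bsub>T\<^esub> g) \<otimes>\<^bsub>T\<^esub> h) t = (f \<otimes>\<^bsub>T\<^esub> h \<oplus>\<^bsub>T\<^esub> g \<otimes>\<^bsub>T\<^esub> h) t"
        using cl f h by (simp add: alg_ops(1))
    qed (use cl f g h in auto)
    show "h \<otimes>\<^bsub>T\<^esub> (f \<oplus>\<^bsub>T\<^esub> g) = h \<otimes>\<^bsub>T\<^esub> f \<oplus>\<^bsub>T\<^esub> h \<otimes>\<^bsub>T\<^esub> g"
    proof (rule eqI)
      fix t assume t: "t \<in> carrier G"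
      note S = algD(3,4)[OF h]
      have "(h \<otimes>\<^bsub>T\<^esub> (f \<oplus>\<^bsub>T\<^esub> g)) t = (\<Oplus>s\<in>supp h. h s \<otimes> act A s ((f \<oplus>\<^bsub>T\<^esub> g) (inv\<^bsub>G\<^esub> s \<otimes>\<^bsub>G\<^esub> t)))"
        by (intro conv_eq[OF h cl(1)[OF f g] t S]) simp
      also have "\<dots> = (\<Oplus>s\<in>supp h. h s \<otimes> act A s (f (inv\<^bsub>G\<^esub> s \<otimes>\<^bsub>G\<^esub> t)) \<oplus> h s \<otimes> act A s (g (inv\<^bsub>G\<^esub> s \<otimes>\<^bsub>G\<^esub> t)))"
        using S(2) f by (intro add.finprod_cong') (auto simp: alg_ops(1) mult_r_distr)
      also have "\<dots> = (\<Oplus>s\<in>supp h. h s \<otimes> act A s (f (inv\<^bsub>G\<^esub> s \<otimes>\<^bsub>G\<^esub> t)))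
          \<oplus> (\<Oplus>s\<in>supp h. h s \<otimes> act A s (g (inv\<^bsub>G\<^esub> s \<otimes>\<^bsub>G\<^esub> t)))"
        using S(2) by (intro finsum_addf) auto
      also have "\<dots> = (h \<otimes>\<^bsub>T\<^esub> f) t \<oplus> (h \<otimes>\<^bsub>T\<^esub> g) t"
        using conv_eq[OF h f t S] conv_eq[OF h g t S] by simp
      finally show "(h \<otimes>\<^bsub>T\<^esub> (f \<oplus>\<^bsub>T\<^esub> g)) t = (h \<otimes>\<^bsub>T\<^esub> f \<oplus>\<^bsub>T\<^esub> h \<otimes>\<^bsub>T\<^esub> g) t"
        using cl f h by (simp add: alg_ops(1))
    qed (use cl f g h in auto)
  next
    fix f g c assume f: "f \<in> carrier T" and g: "g \<in> carrier T"
    note [simp] = algD(1)[OF f] algD(1)[OF g]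
    note S = algD(3,4)[OF f]
    show "(c \<odot>\<^bsub>T\<^esub> f) \<otimes>\<^bsub>T\<^esub> g = c \<odot>\<^bsub>T\<^esub> (f \<otimes>\<^bsub>T\<^esub> g)"
    proof (rule eqI)
      fix t assume t: "t \<in> carrier G"
      have "((c \<odot>\<^bsub>T\<^esub> f) \<otimes>\<^bsub>T\<^esub> g) t = (\<Oplus>s\<in>supp f. (c \<odot>\<^bsub>T\<^esub> f) s \<otimes> act A s (g (inv\<^bsub>G\<^esub> s \<otimes>\<^bsub>G\<^esub> t)))"
        using f by (intro conv_eq[OF cl(2)[OF f f] g t S]) (auto simp: alg_ops(3))
      also have "\<dots> = (\<Oplus>s\<in>supp f. c \<odot> (f s \<otimes> act A s (g (inv\<^bsub>G\<^esub> s \<otimes>\<^bsub>G\<^esub> t))))"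
        using S(2) f t by (intro add.finprod_cong') (auto simp: alg_ops(3))
      also have "\<dots> = c \<odot> (\<Oplus>s\<in>supp f. f s \<otimes> act A s (g (inv\<^bsub>G\<^esub> s \<otimes>\<^bsub>G\<^esub> t)))"
        using S by (intro finsum_additive[symmetric]) (auto simp: scale_add_right)
      also have "\<dots> = c \<odot> ((f \<otimes>\<^bsub>T\<^esub> g) t)"
        using conv_eq[OF f g t S] by simp
      finally show "((c \<odot>\<^bsub>T\<^esub> f) \<otimes>\<^bsub>T\<^esub> g) t = (c \<odot>\<^bsub>T\<^esub> (f \<otimes>\<^bsub>T\<^esub> g)) t"
        using cl f g by (simp add: alg_ops(3))
    qed (use cl f g in auto)
    show "f \<otimes>\<^bsub>T\<^esub> (c \<odot>\<^bsub>T\<^esub> g) = c \<odot>\<^bsub>T\<^esub> (f \<otimes>\<^bsub>T\<^esub> g)"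
    proof (rule eqI)
      fix t assume t: "t \<in> carrier G"
      have "(f \<otimes>\<^bsub>T\<^esub> (c \<odot>\<^bsub>T\<^esub> g)) t = (\<Oplus>s\<in>supp f. f s \<otimes> act A s ((c \<odot>\<^bsub>T\<^esub> g) (inv\<^bsub>G\<^esub> s \<otimes>\<^bsub>G\<^esub> t)))"
        by (intro conv_eq[OF f cl(2)[OF g g] t S]) simp
      also have "\<dots> = (\<Oplus>s\<in>supp f. c \<odot> (f s \<otimes> act A s (g (inv\<^bsub>G\<^esub> s \<otimes>\<^bsub>G\<^esub> t))))"
        using S(2) g t by (intro add.finprod_cong') (auto simp: alg_ops(3))
      also have "\<dots> = c \<odot> (\<Oplus>s\<in>supp f. f s \<otimes> act A s (g (inv\<^bsub>G\<^esub> s \<otimes>\<^bsub>G\<^esub> t)))"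
        using S by (intro finsum_additive[symmetric]) (auto simp: scale_add_right)
      also have "\<dots> = c \<odot> ((f \<otimes>\<^bsub>T\<^esub> g) t)"
        using conv_eq[OF f g t S] by simp
      finally show "(f \<otimes>\<^bsub>T\<^esub> (c \<odot>\<^bsub>T\<^esub> g)) t = (c \<odot>\<^bsub>T\<^esub> (f \<otimes>\<^bsub>T\<^esub> g)) t"
        using cl f g by (simp add: alg_ops(3))
    qed (use cl f g in auto)
  next
    fix f assume f: "f \<in> carrier T"
    note [simp] = algD(1)[OF f]
    show "star T (star T f) = f"
    proof (rule eqI)
      show "star T (star T f) t = f t" if "t \<in> carrier G" for t
        using that f cl by (simp add: alg_star act_act flip: act_simps(5))
    qed (use cl f in auto)
    show "star T (c \<odot>\<^bsub>T\<^esub> f) = cnj c \<odot>\<^bsub>T\<^esub> star T f" for c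
      using cl f by (auto simp: alg_ops(3) alg_star fun_eq_iff)
  qed (use cl in auto)
  ultimately show ?thesis by (rule star_algebra.intro)
qed

end

section \<open>The universal norm as the largest C*-seminorm\<close>

context star_algebra
begin

text \<open>Suprema preserve inequalities, so the work lies in the two equations. The C*-identity
  survives because squaring is monotone on nonnegative reals; homogeneity follows from one
  inequality applied to both \<open>c\<close> and \<open>inverse c\<close>, hence the separate case
  c = 0.\<close>

lemma cstar_seminorm_Sup:
  assumes bdd: "\<And>x. x \<in> carrier A \<Longrightarrow> bdd_above {p x |p. cstar_seminorm A p}"
  shows "cstar_seminorm A (\<lambda>x. Sup {p x |p. cstar_seminorm A p})"
proof -
  define S where "S x = Sup {p x |p. cstar_seminorm A p}" for x
  have zero: "cstar_seminorm A (\<lambda>x. 0)" by (simp add: cstar_seminorm_def)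
  have le: "p x \<le> S x" if "cstar_seminorm A p" "x \<in> carrier A" for p x
    unfolding S_def by (rule cSup_upper[OF _ bdd[OF that(2)]]) (use that in blast)
  have least: "S x \<le> b" if "\<And>p. cstar_seminorm A p \<Longrightarrow> p x \<le> b" for x b
    unfolding S_def
  proof (rule cSup_least)
    show "{p x |p. cstar_seminorm A p} \<noteq> {}" using zero by blast
  qed (use that in blast)
  have nonneg: "0 \<le> S x" if "x \<in> carrier A" for x
    using le[OF zero that] by simp
  have scale_le: "S (c \<odot> x) \<le> cmod c * S x" if x: "x \<in> carrier A" for c x
  proof (rule least)
    fix p assume p: "cstar_seminorm A p"
    then have "p (c \<odot> x) = cmod c * p x" using x by (simp add: cstar_seminorm_def)
    then show "p (c \<odot> x) \<le> cmod c * S x" using le[OF p x] by (simp add: mult_left_mono)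
  qed
  have "cstar_seminorm A S"
    unfolding cstar_seminorm_def
  proof (intro conjI ballI allI)
    fix x assume x: "x \<in> carrier A"
    show "0 \<le> S x" by (rule nonneg[OF x])
    show "S (c \<odot> x) = cmod c * S x" for c
    proof (cases "c = 0")
      case True
      then show ?thesis
        using scale_le[OF x, of c] nonneg[of "c \<odot> x"] x by (intro order_antisym) auto
    next
      case False
      have "S (inverse c \<odot> (c \<odot> x)) \<le> cmod (inverse c) * S (c \<odot> x)"
        using x by (intro scale_le) simp
      then have "cmod c * S x \<le> S (c \<odot> x)"
        using False x by (simp add: norm_divide field_simps)
      then show ?thesis using scale_le[OF x, of c] by simp
    qed
    show "S (star A x \<otimes> x) = (S x)\<^sup>2"
    proof (rule order_antisym)
      show "S (star A x \<otimes> x) \<le> (S x)\<^sup>2"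
      proof (rule least)
        fix p assume p: "cstar_seminorm A p"
        then have "p (star A x \<otimes> x) = (p x)\<^sup>2" "0 \<le> p x" using x by (auto simp: cstar_seminorm_def)
        then show "p (star A x \<otimes> x) \<le> (S x)\<^sup>2" using le[OF p x] by (simp add: power_mono)
      qed
      have "S x \<le> sqrt (S (star A x \<otimes> x))"
      proof (rule least)
        fix p assume p: "cstar_seminorm A p"
        then have "p (star A x \<otimes> x) = (p x)\<^sup>2" using x by (simp add: cstar_seminorm_def)
        then show "p x \<le> sqrt (S (star A x \<otimes> x))"
          using le[OF p, of "star A x \<otimes> x"] x by (intro real_le_rsqrt) simp
      qed
      then show "(S x)\<^sup>2 \<le> S (star A x \<otimes> x)"
        using nonneg[OF x] nonneg[of "star A x \<otimes> x"] x
        by (metis mult_closed power_mono real_sqrt_pow2 star_closed)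
    qed
    fix y assume y: "y \<in> carrier A"
    show "S (x \<oplus> y) \<le> S x + S y"
    proof (rule least)
      fix p assume p: "cstar_seminorm A p"
      then have "p (x \<oplus> y) \<le> p x + p y" using x y by (simp add: cstar_seminorm_def)
      then show "p (x \<oplus> y) \<le> S x + S y" using le[OF p x] le[OF p y] by linarith
    qed
    show "S (x \<otimes> y) \<le> S x * S y"
    proof (rule least)
      fix p assume p: "cstar_seminorm A p"
      then have "p (x \<otimes> y) \<le> p x * p y" "0 \<le> p y" using x y by (auto simp: cstar_seminorm_def)
      moreover have "p x * p y \<le> S x * S y"
        using le[OF p x] le[OF p y] nonneg[OF x] \<open>0 \<le> p y\<close> by (intro mult_mono)
      ultimately show "p (x \<otimes> y) \<le> S x * S y" by linarith
    qed
  qed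
  then show ?thesis by (simp add: S_def[abs_def])
qed

end

context g_cstar
begin

sublocale alg: star_algebra T by (rule star_algebra_alg)

text \<open>The monomial usually written a u_s; every finitely supported function is a finite sum of
  these.\<close>

definition single :: "'g \<Rightarrow> 'a \<Rightarrow> 'g \<Rightarrow> 'a" where
  "single s a = (\<lambda>t. if t = s then a else \<zero>)"

lemma single_closed: "\<lbrakk>s \<in> carrier G; a \<in> carrier A\<rbrakk> \<Longrightarrow> single s a \<in> carrier T"
  by (rule algI[where S = "{s}"]) (auto simp: single_def)

lemma conv_single_left:
  assumes s: "s \<in> carrier G" and a: "a \<in> carrier A" and g: "g \<in> carrier T" and t: "t \<in> carrier G"
  shows "(single s a \<otimes>\<^bsub>T\<^esub> g) t = a \<otimes> act A s (g (inv\<^bsub>G\<^esub> s \<otimes>\<^bsub>G\<^esub> t))"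
proof -
  have "(single s a \<otimes>\<^bsub>T\<^esub> g) t = (\<Oplus>r\<in>{s}. single s a r \<otimes> act A r (g (inv\<^bsub>G\<^esub> r \<otimes>\<^bsub>G\<^esub> t)))"
    by (rule conv_eq[OF single_closed[OF s a] g t]) (use s in \<open>auto simp: single_def\<close>)
  then show ?thesis using s a algD(1)[OF g] by (simp add: single_def)
qed

lemma alg_eqI:
  "\<lbrakk>f \<in> carrier T; g \<in> carrier T; \<And>t. t \<in> carrier G \<Longrightarrow> f t = g t\<rbrakk> \<Longrightarrow> f = g"
  using algD(2) by (metis ext)

lemma star_single:
  assumes s: "s \<in> carrier G" and a: "a \<in> carrier A"
  shows "star T (single s a) = single (inv\<^bsub>G\<^esub> s) (star A (act A (inv\<^bsub>G\<^esub> s) a))"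
proof (rule alg_eqI)
  fix t assume t: "t \<in> carrier G"
  have "inv\<^bsub>G\<^esub> t = s \<longleftrightarrow> t = inv\<^bsub>G\<^esub> s" using s t by (metis G.inv_inv)
  then show "star T (single s a) t = single (inv\<^bsub>G\<^esub> s) (star A (act A (inv\<^bsub>G\<^esub> s) a)) t"
    using alg_star[OF single_closed[OF s a]] t by (auto simp: single_def)
qed (use s a in \<open>auto intro!: single_closed star_alg_closed\<close>)

lemma conv_single_single:
  assumes s: "s \<in> carrier G" "r \<in> carrier G" and a: "a \<in> carrier A" "b \<in> carrier A"
  shows "single s a \<otimes>\<^bsub>T\<^esub> single r b = single (s \<otimes>\<^bsub>G\<^esub> r) (a \<otimes> act A s b)"
proof (rule alg_eqI)
  fix t assume t: "t \<in> carrier G"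
  have "inv\<^bsub>G\<^esub> s \<otimes>\<^bsub>G\<^esub> t = r \<longleftrightarrow> t = s \<otimes>\<^bsub>G\<^esub> r"
    using s t by (metis G.inv_solve_left)
  then show "(single s a \<otimes>\<^bsub>T\<^esub> single r b) t = single (s \<otimes>\<^bsub>G\<^esub> r) (a \<otimes> act A s b) t"
    using conv_single_left[OF s(1) a(1) single_closed[OF s(2) a(2)] t] s a by (simp add: single_def)
qed (use s a in \<open>auto intro!: single_closed conv_closed\<close>)

lemma star_hom_single_one: "star_hom A T (single \<one>\<^bsub>G\<^esub>)"
  unfolding star_hom_def linear_on_def
proof (intro conjI ballI allI)
  fix x y assume "x \<in> carrier A" "y \<in> carrier A"
  then show "single \<one>\<^bsub>G\<^esub> (x \<otimes> y) = single \<one>\<^bsub>G\<^esub> x \<otimes>\<^bsub>T\<^esub> single \<one>\<^bsub>G\<^esub> y"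
    by (simp add: conv_single_single)
qed (simp_all add: single_closed star_single alg_ops, simp_all add: single_def fun_eq_iff)

lemma is_unit_single:
  assumes u: "is_unit A u" shows "is_unit T (single \<one>\<^bsub>G\<^esub> u)"
  unfolding is_unit_def
proof (intro conjI ballI)
  have uc: "u \<in> carrier A" using u by (simp add: is_unit_def)
  show c: "single \<one>\<^bsub>G\<^esub> u \<in> carrier T" using uc by (simp add: single_closed)
  fix f assume f: "f \<in> carrier T"
  show 1: "single \<one>\<^bsub>G\<^esub> u \<otimes>\<^bsub>T\<^esub> f = f" if "f \<in> carrier T" for f
  proof (rule alg_eqI)
    show "(single \<one>\<^bsub>G\<^esub> u \<otimes>\<^bsub>T\<^esub> f) t = f t" if "t \<in> carrier G" for t
      using conv_single_left[OF _ uc \<open>f \<in> carrier T\<close> that] that algD(1)[OF \<open>f \<in> carrier T\<close>] u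
      by (simp add: is_unit_def)
  qed (use c that conv_closed in auto)
  \<comment> \<open>This element is self-adjoint, so the left unit law for all elements yields the
    right one by taking adjoints.\<close>
  have s: "star T (single \<one>\<^bsub>G\<^esub> u) = single \<one>\<^bsub>G\<^esub> u"
    using uc star_unit[OF u] by (simp add: star_single)
  have "star T (f \<otimes>\<^bsub>T\<^esub> single \<one>\<^bsub>G\<^esub> u) = star T f"
    using f c by (simp add: s 1)
  then show "f \<otimes>\<^bsub>T\<^esub> single \<one>\<^bsub>G\<^esub> u = f"
    using f c by (metis alg.star_star conv_closed)
qed

text \<open>For a monomial x at s, the product x* x is a monomial at the identity of G. Those form a
  copy of A, on which every C*-seminorm is at most \<open>cnorm A\<close>. The resulting bound does
  not mention \<open>p\<close>.\<close>

lemma seminorm_single_le: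
  assumes u: "is_unit A u" and p: "cstar_seminorm T p" and s: "s \<in> carrier G" and a: "a \<in> carrier A"
  shows "p (single s a) \<le> sqrt (cnorm A (act A (inv\<^bsub>G\<^esub> s) (star A a \<otimes> a)))"
proof (rule real_le_rsqrt)
  interpret p: seminormed_star_algebra T p by unfold_locales (rule p)
  let ?b = "act A (inv\<^bsub>G\<^esub> s) (star A a \<otimes> a)"
  have "star T (single s a) \<otimes>\<^bsub>T\<^esub> single s a = single \<one>\<^bsub>G\<^esub> ?b"
    using s a by (simp add: star_single conv_single_single)
  then have "(p (single s a))\<^sup>2 = p (single \<one>\<^bsub>G\<^esub> ?b)"
    using p.p_cstar[OF single_closed[OF s a]] by simp
  also have "\<dots> \<le> cnorm A ?b"
    using s a by (intro seminorm_le_norm[OF u cstar_seminorm_pullback[OF p star_hom_single_one]])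
      (simp_all add: star_algebra_axioms)
  finally show "(p (single s a))\<^sup>2 \<le> cnorm A ?b" .
qed

lemma seminorm_le_l1:
  assumes p: "cstar_seminorm T p" and S: "finite S" "S \<subseteq> carrier G"
    and f: "f \<in> carrier T" "\<And>s. s \<notin> S \<Longrightarrow> f s = \<zero>"
  shows "p f \<le> (\<Sum>s\<in>S. p (single s (f s)))"
  using S f
proof (induction S arbitrary: f)
  case empty
  interpret p: seminormed_star_algebra T p by unfold_locales (rule p)
  have "f = \<zero>\<^bsub>T\<^esub>" using empty by (auto simp: alg_ops)
  then show ?case using p.p_zero by simp
next
  case (insert s S)
  interpret p: seminormed_star_algebra T p by unfold_locales (rule p)
  note [simp] = algD(1)[OF insert.prems(2)]
  let ?g = "f(s := \<zero>)"
  have s: "s \<in> carrier G" using insert by simp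
  have g: "?g \<in> carrier T"
    by (rule algI[OF _ _ algD(3)[OF insert.prems(2)]]) (use algD(2)[OF insert.prems(2)] in auto)
  have sc: "single s (f s) \<in> carrier T" using s by (simp add: single_closed)
  have "f = single s (f s) \<oplus>\<^bsub>T\<^esub> ?g" by (auto simp: alg_ops single_def)
  then have "p f \<le> p (single s (f s)) + p ?g" using p.p_triangle[OF sc g] by simp
  also have "p ?g \<le> (\<Sum>t\<in>S. p (single t (?g t)))"
    using insert by (intro insert.IH g) auto
  also have "\<dots> = (\<Sum>t\<in>S. p (single t (f t)))"
    using insert by (intro sum.cong) auto
  finally show ?case using insert by simp
qed

text \<open>A supremum of reals says nothing unless the set is bounded. Adding up the monomial
  bounds over the support gives an l1-type bound common to all C*-seminorms.\<close>

lemma bdd_above_seminorms: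
  assumes u: "is_unit A u" and f: "f \<in> carrier T"
  shows "bdd_above {p f |p. cstar_seminorm T p}"
proof (rule bdd_aboveI)
  fix r assume "r \<in> {p f |p. cstar_seminorm T p}"
  then obtain p where p: "cstar_seminorm T p" "r = p f" by blast
  have "p f \<le> (\<Sum>s\<in>supp f. p (single s (f s)))"
    using algD[OF f] by (intro seminorm_le_l1[OF p(1)] f) auto
  also have "\<dots> \<le> (\<Sum>s\<in>supp f. sqrt (cnorm A (act A (inv\<^bsub>G\<^esub> s) (star A (f s) \<otimes> f s))))"
    using algD(1,4)[OF f] by (intro sum_mono seminorm_single_le[OF u p(1)]) auto
  finally show "r \<le> (\<Sum>s\<in>supp f. sqrt (cnorm A (act A (inv\<^bsub>G\<^esub> s) (star A (f s) \<otimes> f s))))"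
    using p(2) by simp
qed

lemma cstar_seminorm_universal_norm:
  assumes u: "is_unit A u" shows "cstar_seminorm T (universal_norm G A)"
  using alg.cstar_seminorm_Sup[OF bdd_above_seminorms[OF u]]
  by (simp add: universal_norm_def[abs_def])

lemma seminorm_le_universal_norm:
  assumes u: "is_unit A u" and p: "cstar_seminorm T p" and f: "f \<in> carrier T"
  shows "p f \<le> universal_norm G A f"
  unfolding universal_norm_def
  by (rule cSup_upper[OF _ bdd_above_seminorms[OF u f]]) (use p in blast)

end

section \<open>Functoriality of the convolution algebra and of its universal norm\<close>

lemma finsum_star_hom:
  assumes "star_algebra A" "star_algebra B" "star_hom A B h"
    and "finite S" "\<And>i. i \<in> S \<Longrightarrow> F i \<in> carrier A"
  shows "h (finsum A F S) = finsum B (\<lambda>i. h (F i)) S"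
proof -
  interpret A: star_algebra A by fact
  interpret B: star_algebra B by fact
  note hs = star_hom_simps[OF assms(3)]
  show ?thesis
    using assms(4,5)
  proof (induction S)
    case empty
    show ?case using star_hom_zero[OF assms(1-3)] by simp
  next
    case (insert i S)
    then have "F \<in> S \<rightarrow> carrier A" "(\<lambda>i. h (F i)) \<in> S \<rightarrow> carrier B" using hs(1) by auto
    then show ?case using insert hs by simp
  qed
qed

lemma star_hom_alg_crossed_product:
  assumes A: "g_cstar G A" and B: "g_cstar G B" and h: "star_hom A B h" and eq: "equivariant G A B h"
  shows "star_hom (alg_crossed_product G A) (alg_crossed_product G B) (\<lambda>f. h \<circ> f)"
proof -
  interpret A: g_cstar G A by fact
  interpret B: g_cstar G B by fact
  note hs = star_hom_simps[OF h]
  have h0: "h \<zero>\<^bsub>A\<^esub> = \<zero>\<^bsub>B\<^esub>"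
    by (rule star_hom_zero[OF A.star_algebra_axioms B.star_algebra_axioms h])
  have cl: "h \<circ> f \<in> carrier B.T" if f: "f \<in> carrier A.T" for f
    by (rule B.algI[OF _ _ A.algD(3)[OF f]])
      (use hs(1) h0 A.algD(1,2)[OF f] in \<open>auto simp: o_def\<close>)
  show ?thesis
    unfolding star_hom_def linear_on_def
  proof (intro conjI ballI allI)
    fix f assume f: "f \<in> carrier A.T"
    note fc = A.algD(1)[OF f]
    show "h \<circ> f \<in> carrier B.T" by (rule cl[OF f])
    show "h \<circ> (c \<odot>\<^bsub>A.T\<^esub> f) = c \<odot>\<^bsub>B.T\<^esub> (h \<circ> f)" for c
      using hs(3)[OF fc] by (simp add: A.alg_ops B.alg_ops fun_eq_iff)
    show "h \<circ> star A.T f = star B.T (h \<circ> f)"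
    proof (rule ext)
      fix t
      show "(h \<circ> star A.T f) t = star B.T (h \<circ> f) t"
        using eq fc h0 hs(5)[OF A.act_simps(1)[OF _ fc]]
        by (simp add: A.alg_star[OF f] B.alg_star[OF cl[OF f]] equivariant_def)
    qed
    fix g assume g: "g \<in> carrier A.T"
    note gc = A.algD(1)[OF g]
    show "h \<circ> (f \<oplus>\<^bsub>A.T\<^esub> g) = (h \<circ> f) \<oplus>\<^bsub>B.T\<^esub> (h \<circ> g)"
      using hs(2)[OF fc gc] by (simp add: A.alg_ops B.alg_ops fun_eq_iff)
    show "h \<circ> (f \<otimes>\<^bsub>A.T\<^esub> g) = (h \<circ> f) \<otimes>\<^bsub>B.T\<^esub> (h \<circ> g)"
    proof (rule B.alg_eqI)
      fix t assume t: "t \<in> carrier G"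
      let ?S = "A.supp f"
      let ?F = "\<lambda>s. f s \<otimes>\<^bsub>A\<^esub> act A s (g (inv\<^bsub>G\<^esub> s \<otimes>\<^bsub>G\<^esub> t))"
      note S = A.algD(3,4)[OF f]
      have Fc: "?F s \<in> carrier A" if "s \<in> ?S" for s using that S fc gc by auto
      have "(h \<circ> (f \<otimes>\<^bsub>A.T\<^esub> g)) t = h (\<Oplus>\<^bsub>A\<^esub>s\<in>?S. ?F s)"
        using A.conv_eq[OF f g t S] by simp
      also have "\<dots> = (\<Oplus>\<^bsub>B\<^esub>s\<in>?S. h (?F s))"
        using Fc S(1) by (intro finsum_star_hom[OF A.star_algebra_axioms B.star_algebra_axioms h])
      also have "\<dots> = (\<Oplus>\<^bsub>B\<^esub>s\<in>?S. (h \<circ> f) s \<otimes>\<^bsub>B\<^esub> act B s ((h \<circ> g) (inv\<^bsub>G\<^esub> s \<otimes>\<^bsub>G\<^esub> t)))"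
      proof (rule B.add.finprod_cong')
        fix s assume "s \<in> ?S"
        then have "s \<in> carrier G" using S(2) by blast
        then show "h (?F s) = (h \<circ> f) s \<otimes>\<^bsub>B\<^esub> act B s ((h \<circ> g) (inv\<^bsub>G\<^esub> s \<otimes>\<^bsub>G\<^esub> t))"
          using eq fc gc by (simp add: hs(4) equivariant_def)
      qed (use S(2) hs(1) fc gc in auto)
      also have "\<dots> = ((h \<circ> f) \<otimes>\<^bsub>B.T\<^esub> (h \<circ> g)) t"
        by (rule B.conv_eq[OF cl[OF f] cl[OF g] t S, symmetric]) (use h0 in simp)
      finally show "(h \<circ> (f \<otimes>\<^bsub>A.T\<^esub> g)) t = ((h \<circ> f) \<otimes>\<^bsub>B.T\<^esub> (h \<circ> g)) t" .
    qed (use cl f g A.conv_closed B.conv_closed in auto)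
  qed
qed

text \<open>Composition with \<open>h\<close> turns a C*-seminorm on the target into one on the
  source, which the largest one dominates.\<close>

lemma universal_norm_comp_le:
  assumes A: "g_cstar G A" and B: "g_cstar G B" and h: "star_hom A B h" and eq: "equivariant G A B h"
    and u: "is_unit A u" and f: "f \<in> carrier (alg_crossed_product G A)"
  shows "universal_norm G B (h \<circ> f) \<le> universal_norm G A f"
proof -
  interpret A: g_cstar G A by fact
  interpret B: g_cstar G B by fact
  show ?thesis
    unfolding universal_norm_def[of G B]
  proof (rule cSup_least)
    \<comment> \<open>\<open>cSup_least\<close> needs a nonempty set; the zero seminorm is always a
      member.\<close>
    have "cstar_seminorm B.T (\<lambda>x. 0)" by (simp add: cstar_seminorm_def)
    then show "{p (h \<circ> f) |p. cstar_seminorm B.T p} \<noteq> {}" by blast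
    fix r assume "r \<in> {p (h \<circ> f) |p. cstar_seminorm B.T p}"
    then obtain p where p: "cstar_seminorm B.T p" "r = p (h \<circ> f)" by blast
    from A.seminorm_le_universal_norm[OF u
        cstar_seminorm_pullback[OF p(1) star_hom_alg_crossed_product[OF A B h eq] A.star_algebra_alg] f]
    show "r \<le> universal_norm G A f" using p(2) by simp
  qed
qed

section \<open>Scalars and states\<close>

text \<open>An affine function of s that is bounded below is constant: otherwise s = (d + 1) / m
  gives the value -d - 2, while s = 0 shows that d is nonnegative.\<close>

lemma nonneg_affine_slope:
  fixes d m :: real
  assumes "\<And>s. 0 \<le> d - 2 * s * m"
  shows "m = 0"
proof (rule ccontr)
  assume "m \<noteq> 0"
  then have "2 * ((d + 1) / m) * m = 2 * (d + 1)" by simp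
  then show False using assms(1)[of "(d + 1) / m"] assms(1)[of 0] by simp
qed

text \<open>Cholesky induction on the Schur complement of the last diagonal entry \<open>d\<close>; when \<open>d = 0\<close> the last row
  vanishes and the convention \<open>x / 0 = 0\<close> lets the same formulas go through.\<close>

lemma psd_matrix_factorization:
  fixes M :: "nat \<Rightarrow> nat \<Rightarrow> complex"
  assumes "\<And>i j. \<lbrakk>i < n; j < n\<rbrakk> \<Longrightarrow> M j i = cnj (M i j)"
    and "\<And>c. (\<Sum>i<n. \<Sum>j<n. cnj (c i) * c j * M i j) \<in> \<real>\<^sub>\<ge>\<^sub>0"
  shows "\<exists>Z. \<forall>i<n. \<forall>j<n. M i j = (\<Sum>k<n. cnj (Z k i) * Z k j)"
  using assms
proof (induction n arbitrary: M)
  case (Suc n)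
  note herm = Suc.prems(1) and psd = Suc.prems(2)
  have split: "(\<Sum>i<Suc n. \<Sum>j<Suc n. cnj (c i) * c j * M i j)
      = (\<Sum>i<n. \<Sum>j<n. cnj (c i) * c j * M i j) + c n * (\<Sum>i<n. cnj (c i) * M i n)
        + cnj (c n) * (\<Sum>j<n. c j * M n j) + cnj (c n) * c n * M n n" for c
    by (simp add: sum.distrib sum_distrib_left mult_ac)
  define d where "d = Re (M n n)"
  have Mnn: "M n n = of_real d"
    using herm[of n n] by (simp add: d_def complex_eq_iff)
  have d0: "0 \<le> d"
    using psd[of "\<lambda>i. if i = n then 1 else 0"] split[of "\<lambda>i. if i = n then 1 else 0"]
    by (simp add: Mnn)
  have zero: "M i n = 0" if "d = 0" "i < n" for i
  proof -
    have "0 \<le> Re (M i i) - 2 * s * (cmod (M i n))\<^sup>2" for s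
    proof -
      \<comment> \<open>The test vector e_i - s z e_n, with z the conjugate of \<open>M i n\<close>.
        As the last diagonal entry is 0, the form takes the value \<open>M i i\<close> - 2 s
        |\<open>M i n\<close>|^2 there, for every real s.\<close>
      define c where "c k = (if k = i then 1 else if k = n then - of_real s * cnj (M i n) else 0)" for k
      have ci: "c i = 1" "c n = - of_real s * cnj (M i n)" using that by (auto simp: c_def)
      have c0: "c k = (if k = i then 1 else 0)" if "k < n" for k using that by (auto simp: c_def)
      have "(\<Sum>j<n. cnj (c k) * c j * M k j) = (if k = i then M i i else 0)" if k: "k < n" for k
      proof -
        have "(\<Sum>j<n. cnj (c k) * c j * M k j) = (\<Sum>j<n. if j = i then (if k = i then M i i else 0) else 0)"
          by (intro sum.cong refl) (auto simp: c0 k)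
        then show ?thesis using \<open>i < n\<close> by simp
      qed
      then have 1: "(\<Sum>k<n. \<Sum>j<n. cnj (c k) * c j * M k j) = M i i" using \<open>i < n\<close> by simp
      have "(\<Sum>k<n. cnj (c k) * M k n) = (\<Sum>k<n. if k = i then M i n else 0)"
        by (intro sum.cong refl) (auto simp: c0)
      then have 2: "(\<Sum>k<n. cnj (c k) * M k n) = M i n" using that(2) by simp
      have "(\<Sum>k<n. c k * M n k) = (\<Sum>k<n. if k = i then M n i else 0)"
        by (intro sum.cong refl) (auto simp: c0)
      then have 3: "(\<Sum>k<n. c k * M n k) = cnj (M i n)"
        using that(2) herm[of i n] by simp
      have "M i i - 2 * of_real s * (M i n * cnj (M i n)) \<in> \<real>\<^sub>\<ge>\<^sub>0"
        using psd[of c] unfolding split 1 2 3 ci Mnn that(1) by (simp add: algebra_simps)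
      then show ?thesis by (simp add: complex_nonneg_Reals_iff complex_norm_square[symmetric] flip: of_real_mult of_real_power)
    qed
    then have "(cmod (M i n))\<^sup>2 = 0" by (rule nonneg_affine_slope)
    then show ?thesis by simp
  qed
  define M' where "M' i j = M i j - M i n * M n j / of_real d" for i j
  have "\<exists>Z. \<forall>i<n. \<forall>j<n. M' i j = (\<Sum>k<n. cnj (Z k i) * Z k j)"
  proof (rule Suc.IH)
    show "M' j i = cnj (M' i j)" if "i < n" "j < n" for i j
      using herm[of i j] herm[of i n] herm[of n j] that by (simp add: M'_def)
    fix c
    let ?b = "\<Sum>j<n. c j * M n j"
    \<comment> \<open>Completing the square: for d > 0 this last coordinate minimises the form of
      \<open>M\<close> once the others are fixed to be c, and the minimum is the form of the Schur
      complement \<open>M'\<close>.\<close>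
    define c' where "c' k = (if k = n then - ?b / of_real d else c k)" for k
    have b: "(\<Sum>i<n. cnj (c i) * M i n) = cnj ?b"
      using herm[of _ n] by (simp add: mult_ac)
    have "(\<Sum>i<n. \<Sum>j<n. cnj (c i) * c j * M' i j)
        = (\<Sum>i<n. \<Sum>j<n. cnj (c i) * c j * M i j) - (\<Sum>i<n. \<Sum>j<n. (cnj (c i) * M i n) * (c j * M n j)) / of_real d"
      by (simp add: M'_def algebra_simps sum_subtractf sum_divide_distrib)
    also have "(\<Sum>i<n. \<Sum>j<n. (cnj (c i) * M i n) * (c j * M n j)) = cnj ?b * ?b"
      by (simp only: sum_product[symmetric] b)
    finally have f: "(\<Sum>i<n. \<Sum>j<n. cnj (c i) * c j * M' i j)
        = (\<Sum>i<n. \<Sum>j<n. cnj (c i) * c j * M i j) - cnj ?b * ?b / of_real d" .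
    have "(\<Sum>i<Suc n. \<Sum>j<Suc n. cnj (c' i) * c' j * M i j)
      = (\<Sum>i<n. \<Sum>j<n. cnj (c i) * c j * M i j) + c' n * cnj ?b + cnj (c' n) * ?b + cnj (c' n) * c' n * M n n"
      unfolding split b[symmetric] by (simp add: c'_def)
    also have "\<dots> = (\<Sum>i<n. \<Sum>j<n. cnj (c i) * c j * M' i j)"
      unfolding f Mnn by (cases "d = 0") (simp_all add: c'_def field_simps)
    finally show "(\<Sum>i<n. \<Sum>j<n. cnj (c i) * c j * M' i j) \<in> \<real>\<^sub>\<ge>\<^sub>0"
      using psd[of c'] by simp
  qed
  then obtain Z where Z: "\<And>i j. \<lbrakk>i < n; j < n\<rbrakk> \<Longrightarrow> M' i j = (\<Sum>k<n. cnj (Z k i) * Z k j)" by blast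
  \<comment> \<open>Row n of \<open>W\<close> produces the rank-one term that \<open>M'\<close>
    subtracts from \<open>M\<close>; \<open>Z\<close>, padded by zeros in column n, produces
    \<open>M'\<close>.\<close>
  define W where "W k j = (if k = n then M n j / of_real (sqrt d) else if j = n then 0 else Z k j)" for k j
  have rd: "complex_of_real (sqrt d) * complex_of_real (sqrt d) = of_real d"
    using d0 by (simp flip: of_real_mult)
  have W: "(\<Sum>k<Suc n. cnj (W k i) * W k j) = (if i = n \<or> j = n then 0 else M' i j) + M i n * M n j / of_real d"
    if "i < Suc n" "j < Suc n" for i j
  proof -
    have "(\<Sum>k<n. cnj (W k i) * W k j) = (if i = n \<or> j = n then 0 else M' i j)"
      using that Z by (auto simp: W_def)
    moreover have "cnj (W n i) * W n j = M i n * M n j / of_real d"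
      using herm[of n i] that rd by (simp add: W_def)
    ultimately show ?thesis by simp
  qed
  have "M i j = (\<Sum>k<Suc n. cnj (W k i) * W k j)" if ij: "i < Suc n" "j < Suc n" for i j
  proof (cases "i = n \<or> j = n")
    case False
    then show ?thesis unfolding W[OF ij] by (simp add: M'_def)
  next
    case True
    show ?thesis
    proof (cases "d = 0")
      case d: True
      have "M n k = 0" if "k < Suc n" for k
        using zero[OF d, of k] herm[of k n] that Mnn d by (cases "k = n") auto
      moreover have "M k n = 0" if "k < Suc n" for k
        using zero[OF d, of k] that Mnn d by (cases "k = n") auto
      ultimately show ?thesis unfolding W[OF ij] using True ij by auto
    qed (unfold W[OF ij], use True Mnn in auto)
  qed
  then show ?case by blast
qed simp

section \<open>States on unital C*-algebras\<close>

lemma state_simps: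
  assumes "state A \<phi>"
  shows "\<lbrakk>x \<in> carrier A; y \<in> carrier A\<rbrakk> \<Longrightarrow> \<phi> (x \<oplus>\<^bsub>A\<^esub> y) = \<phi> x + \<phi> y"
    and "x \<in> carrier A \<Longrightarrow> \<phi> (c \<odot>\<^bsub>A\<^esub> x) = c * \<phi> x"
    and "x \<in> carrier A \<Longrightarrow> \<phi> (star A x \<otimes>\<^bsub>A\<^esub> x) \<in> \<real>\<^sub>\<ge>\<^sub>0"
  using assms unfolding state_def positive_def by auto

context cstar_algebra
begin

lemma state_zero: "state A \<phi> \<Longrightarrow> \<phi> \<zero> = 0"
  using state_simps(2)[of A \<phi> \<zero> 0] by simp

lemma state_finsum:
  assumes \<phi>: "state A \<phi>" and "finite S" "\<And>i. i \<in> S \<Longrightarrow> F i \<in> carrier A"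
  shows "\<phi> (finsum A F S) = (\<Sum>i\<in>S. \<phi> (F i))"
  using assms(2,3)
proof (induction S)
  case (insert i S)
  then have "F \<in> S \<rightarrow> carrier A" by auto
  then show ?case using insert state_simps(1)[OF \<phi>] by simp
qed (simp add: state_zero[OF \<phi>])

text \<open>Positivity at y* y for y = 1 + c x. Suitable choices of c give both the compatibility
  with the involution and a Cauchy-Schwarz type estimate for \<phi>(x).\<close>

lemma state_star_add:
  assumes \<phi>: "state A \<phi>" and u: "is_unit A u" and x: "x \<in> carrier A"
  shows "\<phi> u + c * \<phi> x + cnj c * \<phi> (star A x) + cnj c * c * \<phi> (star A x \<otimes> x) \<in> \<real>\<^sub>\<ge>\<^sub>0"
proof -
  have uc: "u \<in> carrier A" using u by (simp add: is_unit_def)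
  have "star A (u \<oplus> c \<odot> x) \<otimes> (u \<oplus> c \<odot> x)
      = (u \<oplus> c \<odot> x) \<oplus> (cnj c \<odot> star A x \<oplus> (cnj c * c) \<odot> (star A x \<otimes> x))"
    using u uc x
    by (simp add: star_unit[OF u] mult_l_distr mult_r_distr scale_add_right is_unit_def a_ac mult.commute)
  then have "\<phi> (star A (u \<oplus> c \<odot> x) \<otimes> (u \<oplus> c \<odot> x))
      = \<phi> u + c * \<phi> x + cnj c * \<phi> (star A x) + cnj c * c * \<phi> (star A x \<otimes> x)"
    using uc x by (simp add: state_simps[OF \<phi>])
  then show ?thesis using state_simps(3)[OF \<phi>, of "u \<oplus> c \<odot> x"] uc x by simp
qed

text \<open>The expression in \<open>state_star_add\<close> is real: c = 1 compares the imaginary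
  parts of the two values, and c = i their real parts.\<close>

lemma state_star:
  assumes \<phi>: "state A \<phi>" and u: "is_unit A u" and x: "x \<in> carrier A"
  shows "\<phi> (star A x) = cnj (\<phi> x)"
proof -
  have uc: "u \<in> carrier A" using u by (simp add: is_unit_def)
  have "\<phi> u \<in> \<real>\<^sub>\<ge>\<^sub>0"
    using state_simps(3)[OF \<phi> uc] star_unit[OF u] u uc by (simp add: is_unit_def)
  then show ?thesis
    using state_star_add[OF assms, of 1] state_star_add[OF assms, of \<i>] state_simps(3)[OF \<phi> x]
    by (auto simp: complex_nonneg_Reals_iff complex_eq_iff)
qed

text \<open>It has to be shown that \<phi>(1) is the supremum over the unit ball. For x in the ball,
  1 - x* x is a square, so \<phi>(x* x) \<le> \<phi>(1). A phase c with c \<phi>(x) = -|\<phi>(x)|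
  in \<open>state_star_add\<close> gives 2 |\<phi>(x)| \<le> \<phi>(1) + \<phi>(x* x), hence
  |\<phi>(x)| \<le> \<phi>(1).\<close>

lemma state_unit:
  assumes \<phi>: "state A \<phi>" and u: "is_unit A u"
  shows "\<phi> u = 1"
proof -
  have uc: "u \<in> carrier A" using u by (simp add: is_unit_def)
  let ?N = "{cmod (\<phi> x) |x. x \<in> carrier A \<and> cnorm A x \<le> 1}"
  have bdd: "bdd_above ?N" and Sup: "Sup ?N = 1" using \<phi> by (auto simp: state_def)
  have pos: "\<phi> u \<in> \<real>\<^sub>\<ge>\<^sub>0"
    using state_simps(3)[OF \<phi> uc] star_unit[OF u] u uc by (simp add: is_unit_def)
  have "cmod (\<phi> x) \<le> Re (\<phi> u)" if x: "x \<in> carrier A" "cnorm A x \<le> 1" for x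
  proof -
    have "star A (star A x \<otimes> x) = star A x \<otimes> x" "cnorm A (star A x \<otimes> x) \<le> 1"
      using x by (simp_all add: p_cstar power_le_one)
    then obtain r where r: "r \<in> carrier A" "star A r = r" "r \<otimes> r = u \<ominus> star A x \<otimes> x"
      using square_root_exists[OF u, of "star A x \<otimes> x"] x by (metis mult_closed star_closed)
    have "\<phi> (r \<otimes> r) = \<phi> u - \<phi> (star A x \<otimes> x)"
      using r x uc by (simp add: diff_eq_scale state_simps[OF \<phi>])
    then have le: "Re (\<phi> (star A x \<otimes> x)) \<le> Re (\<phi> u)"
      using state_simps(3)[OF \<phi> r(1)] r(2) by (simp add: complex_nonneg_Reals_iff)
    define c where "c = (if \<phi> x = 0 then 1 else - of_real (cmod (\<phi> x)) / \<phi> x)"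
    have c: "c * \<phi> x = - of_real (cmod (\<phi> x))" "cmod c = 1"
      by (auto simp: c_def norm_divide)
    have "cnj c * cnj (\<phi> x) = - of_real (cmod (\<phi> x))"
      using c(1) by (metis complex_cnj_complex_of_real complex_cnj_minus complex_cnj_mult)
    moreover have "cnj c * c = 1"
      using c(2) by (metis complex_norm_square mult.commute of_real_1 one_power2)
    ultimately have "\<phi> u - 2 * of_real (cmod (\<phi> x)) + \<phi> (star A x \<otimes> x) \<in> \<real>\<^sub>\<ge>\<^sub>0"
      using state_star_add[OF \<phi> u x(1), of c] c(1) state_star[OF \<phi> u x(1)] by simp
    then show ?thesis using le by (simp add: complex_nonneg_Reals_iff)
  qed
  then have "Sup ?N \<le> Re (\<phi> u)"
    using uc p_unit[OF u] by (intro cSup_least) auto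
  moreover have "cmod (\<phi> u) \<le> Sup ?N"
    using uc p_unit[OF u] by (intro cSup_upper bdd) auto
  ultimately have "Re (\<phi> u) = 1"
    using Sup complex_Re_le_cmod[of "\<phi> u"] by linarith
  then show ?thesis using pos by (simp add: complex_nonneg_Reals_iff complex_eq_iff)
qed

end

section \<open>The complex numbers as a G-C*-algebra, and complete positivity of states\<close>

context
  fixes e :: "complex \<Rightarrow> 'a" and A :: "('a, 'g) g_cstar_algebra"
  assumes inj: "inj e"
  defines "A \<equiv> scalars e"
begin

lemma scalars_simps:
  "carrier A = range e" "e z \<otimes>\<^bsub>A\<^esub> e w = e (z * w)" "\<zero>\<^bsub>A\<^esub> = e 0"
  "e z \<oplus>\<^bsub>A\<^esub> e w = e (z + w)" "c \<odot>\<^bsub>A\<^esub> e z = e (c * z)" "star A (e z) = e (cnj z)"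
  "cnorm A (e z) = cmod z" "act A s x = x"
  using inj by (simp_all add: A_def scalars_def)

lemma star_algebra_scalars: "star_algebra A"
proof -
  have "abelian_group A"
  proof (rule abelian_groupI)
    show "\<exists>y\<in>carrier A. y \<oplus>\<^bsub>A\<^esub> x = \<zero>\<^bsub>A\<^esub>" if x: "x \<in> carrier A" for x
    proof -
      obtain z where "x = e z" using x by (auto simp: scalars_simps)
      then show ?thesis by (intro bexI[of _ "e (- z)"]) (simp_all add: scalars_simps)
    qed
  qed (auto simp: scalars_simps algebra_simps)
  then have "module complex_ring A"
    by (rule moduleI[OF cring_complex_ring]) (auto simp: scalars_simps algebra_simps)
  then show ?thesis
    by (rule star_algebra.intro, unfold_locales) (auto simp: scalars_simps algebra_simps)
qed

lemma scalars_diff: "e z \<ominus>\<^bsub>A\<^esub> e w = e (z - w)"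
proof -
  interpret star_algebra A by (rule star_algebra_scalars)
  show ?thesis by (simp add: diff_eq_scale scalars_simps)
qed

lemma cstar_algebra_scalars: "cstar_algebra A"
proof (rule cstar_algebra.intro[OF star_algebra_scalars], rule cstar_algebra_axioms.intro)
  show "cstar_seminorm A (cnorm A)"
    unfolding cstar_seminorm_def
    by (auto simp: scalars_simps norm_mult norm_triangle_ineq power2_eq_square)
  show "x = \<zero>\<^bsub>A\<^esub>" if "x \<in> carrier A" "cnorm A x = 0" for x
    using that by (auto simp: scalars_simps)
  fix U assume U: "U \<in> cauchy_seqs A (cnorm A)"
  then have "\<forall>n. \<exists>z. U n = e z" by (auto simp: cauchy_seqs_def scalars_simps)
  then obtain z where z: "\<And>n. U n = e (z n)" by metis
  have "Cauchy z"
    using U unfolding Cauchy_def cauchy_seqs_def by (simp add: z scalars_diff scalars_simps dist_norm)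
  then obtain l where l: "z \<longlonglongrightarrow> l" using Cauchy_convergent convergent_def by blast
  then have "(\<lambda>n. cnorm A (U n \<ominus>\<^bsub>A\<^esub> e l)) \<longlonglongrightarrow> 0"
    by (simp add: z scalars_diff scalars_simps LIM_zero tendsto_norm_zero)
  then show "\<exists>l\<in>carrier A. (\<lambda>n. cnorm A (U n \<ominus>\<^bsub>A\<^esub> l)) \<longlonglongrightarrow> 0"
    by (intro bexI[of _ "e l"]) (simp_all add: scalars_simps)
qed

lemma g_cstar_algebra_scalars: "g_cstar_algebra G A"
  using cstar_algebra_scalars
  by (auto simp: g_cstar_algebra_def star_aut_def star_hom_def linear_on_def scalars_simps bij_betw_def
      inj_on_def)

lemma is_unit_scalars: "is_unit A (e 1)"
  by (auto simp: is_unit_def scalars_simps)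

lemma finsum_scalars: "finite S \<Longrightarrow> finsum A (\<lambda>i. e (F i)) S = e (\<Sum>i\<in>S. F i)"
proof (induction S rule: finite_induct)
  case empty
  interpret star_algebra A by (rule star_algebra_scalars)
  show ?case by (simp add: scalars_simps)
next
  case (insert i S)
  interpret star_algebra A by (rule star_algebra_scalars)
  have "(\<lambda>i. e (F i)) \<in> S \<rightarrow> carrier A" by (auto simp: scalars_simps)
  then show ?case using insert by (simp add: scalars_simps)
qed

text \<open>For X = Y* Y and a vector c, the quadratic form of the matrix of \<phi>-values is the
  sum over k of \<phi>(v_k* v_k), where v_k is row k of Y applied to c. So that complex matrix is
  positive semidefinite; \<open>positive\<close> asks for an explicit factor, which
  \<open>psd_matrix_factorization\<close> provides.\<close>

lemma completely_positive_state:
  assumes B: "cstar_algebra B" and u: "is_unit B u" and \<phi>: "state B \<phi>"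
  shows "completely_positive B A (\<lambda>x. e (\<phi> x))"
proof -
  interpret B: cstar_algebra B by fact
  note \<phi>s = state_simps[OF \<phi>]
  have lin: "linear_on B A (\<lambda>x. e (\<phi> x))"
    by (auto simp: linear_on_def scalars_simps \<phi>s)
  have "positive (matrix_algebra n A) (\<lambda>i j. e (\<phi> (X i j)))" if pos: "positive (matrix_algebra n B) X" for n X
  proof -
    obtain Y where Y: "Y \<in> carrier (matrix_algebra n B)"
      and X: "X = star (matrix_algebra n B) Y \<otimes>\<^bsub>matrix_algebra n B\<^esub> Y"
      using pos by (auto simp: positive_def)
    have Yc: "Y i j \<in> carrier B" for i j
      using Y by (cases "i < n \<and> j < n") (auto simp: matrix_algebra_def split: if_splits)
    have Xij: "X i j = (\<Oplus>\<^bsub>B\<^esub>k\<in>{..<n}. star B (Y k i) \<otimes>\<^bsub>B\<^esub> Y k j)" if "i < n" "j < n" for i j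
      using that Yc unfolding X
      by (simp add: matrix_algebra_def) (rule B.add.finprod_cong', auto)
    have X0: "X i j = \<zero>\<^bsub>B\<^esub>" if "\<not> (i < n \<and> j < n)" for i j
      using that unfolding X by (auto simp: matrix_algebra_def)
    define M where "M i j = (\<Sum>k<n. \<phi> (star B (Y k i) \<otimes>\<^bsub>B\<^esub> Y k j))" for i j
    have M: "\<phi> (X i j) = M i j" if "i < n" "j < n" for i j
      using Xij[OF that] Yc by (simp add: M_def B.state_finsum[OF \<phi>])
    have "\<exists>Z. \<forall>i<n. \<forall>j<n. M i j = (\<Sum>k<n. cnj (Z k i) * Z k j)"
    proof (rule psd_matrix_factorization)
      show "M j i = cnj (M i j)" for i j
        using B.state_star[OF \<phi> u, of "star B (Y _ i) \<otimes>\<^bsub>B\<^esub> Y _ j"] Yc by (simp add: M_def)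
      fix c
      define v where "v k = (\<Oplus>\<^bsub>B\<^esub>j\<in>{..<n}. c j \<odot>\<^bsub>B\<^esub> Y k j)" for k
      have vc: "v k \<in> carrier B" for k using Yc by (auto simp: v_def intro!: B.finsum_closed)
      have "\<phi> (star B (v k) \<otimes>\<^bsub>B\<^esub> v k)
          = (\<Sum>i<n. \<Sum>j<n. cnj (c i) * c j * \<phi> (star B (Y k i) \<otimes>\<^bsub>B\<^esub> Y k j))" for k
      proof -
        have "star B (v k) = (\<Oplus>\<^bsub>B\<^esub>i\<in>{..<n}. cnj (c i) \<odot>\<^bsub>B\<^esub> star B (Y k i))"
          unfolding v_def using Yc by (subst B.finsum_additive[where h = "star B"]) auto
        then have "star B (v k) \<otimes>\<^bsub>B\<^esub> v k
            = (\<Oplus>\<^bsub>B\<^esub>i\<in>{..<n}. (cnj (c i) \<odot>\<^bsub>B\<^esub> star B (Y k i)) \<otimes>\<^bsub>B\<^esub> v k)"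
          using Yc vc by (simp add: B.finsum_mult_right)
        then have "\<phi> (star B (v k) \<otimes>\<^bsub>B\<^esub> v k)
            = (\<Sum>i<n. \<phi> ((cnj (c i) \<odot>\<^bsub>B\<^esub> star B (Y k i)) \<otimes>\<^bsub>B\<^esub> v k))"
          using Yc vc by (simp add: B.state_finsum[OF \<phi>])
        also have "\<dots> = (\<Sum>i<n. \<Sum>j<n. cnj (c i) * c j * \<phi> (star B (Y k i) \<otimes>\<^bsub>B\<^esub> Y k j))"
        proof (rule sum.cong[OF refl])
          fix i
          have "(cnj (c i) \<odot>\<^bsub>B\<^esub> star B (Y k i)) \<otimes>\<^bsub>B\<^esub> v k
              = (\<Oplus>\<^bsub>B\<^esub>j\<in>{..<n}. (cnj (c i) \<odot>\<^bsub>B\<^esub> star B (Y k i)) \<otimes>\<^bsub>B\<^esub> (c j \<odot>\<^bsub>B\<^esub> Y k j))"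
            unfolding v_def using Yc by (intro B.finsum_mult_left) auto
          then show "\<phi> ((cnj (c i) \<odot>\<^bsub>B\<^esub> star B (Y k i)) \<otimes>\<^bsub>B\<^esub> v k)
              = (\<Sum>j<n. cnj (c i) * c j * \<phi> (star B (Y k i) \<otimes>\<^bsub>B\<^esub> Y k j))"
            using Yc by (simp add: B.state_finsum[OF \<phi>] \<phi>s mult_ac)
        qed
        finally show ?thesis .
      qed
      then have "(\<Sum>k<n. \<phi> (star B (v k) \<otimes>\<^bsub>B\<^esub> v k))
          = (\<Sum>k<n. \<Sum>i<n. \<Sum>j<n. cnj (c i) * c j * \<phi> (star B (Y k i) \<otimes>\<^bsub>B\<^esub> Y k j))"
        by simp
      also have "\<dots> = (\<Sum>i<n. \<Sum>k<n. \<Sum>j<n. cnj (c i) * c j * \<phi> (star B (Y k i) \<otimes>\<^bsub>B\<^esub> Y k j))"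
        by (rule sum.swap)
      also have "\<dots> = (\<Sum>i<n. \<Sum>j<n. \<Sum>k<n. cnj (c i) * c j * \<phi> (star B (Y k i) \<otimes>\<^bsub>B\<^esub> Y k j))"
        by (rule sum.cong[OF refl], rule sum.swap)
      also have "\<dots> = (\<Sum>i<n. \<Sum>j<n. cnj (c i) * c j * M i j)"
        by (simp add: M_def sum_distrib_left)
      finally have eq: "(\<Sum>i<n. \<Sum>j<n. cnj (c i) * c j * M i j) = (\<Sum>k<n. \<phi> (star B (v k) \<otimes>\<^bsub>B\<^esub> v k))" ..
      show "(\<Sum>i<n. \<Sum>j<n. cnj (c i) * c j * M i j) \<in> \<real>\<^sub>\<ge>\<^sub>0"
        unfolding eq using \<phi>s(3)[OF vc]
        by (simp add: complex_nonneg_Reals_iff sum_nonneg)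
    qed
    then obtain Z where Z: "\<And>i j. \<lbrakk>i < n; j < n\<rbrakk> \<Longrightarrow> M i j = (\<Sum>k<n. cnj (Z k i) * Z k j)" by blast
    \<comment> \<open>Padded by the zero of the scalars, as \<open>matrix_algebra\<close> requires
      outside the index range.\<close>
    define W where "W i j = (if i < n \<and> j < n then e (Z i j) else e 0)" for i j
    have "W \<in> carrier (matrix_algebra n A)"
      by (auto simp: matrix_algebra_def W_def scalars_simps)
    moreover have "(\<lambda>i j. e (\<phi> (X i j))) = star (matrix_algebra n A) W \<otimes>\<^bsub>matrix_algebra n A\<^esub> W"
    proof (intro ext)
      fix i j
      show "e (\<phi> (X i j)) = (star (matrix_algebra n A) W \<otimes>\<^bsub>matrix_algebra n A\<^esub> W) i j"
      proof (cases "i < n \<and> j < n")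
        case True
        interpret A: star_algebra A by (rule star_algebra_scalars)
        have "(star (matrix_algebra n A) W \<otimes>\<^bsub>matrix_algebra n A\<^esub> W) i j
            = (\<Oplus>\<^bsub>A\<^esub>k\<in>{..<n}. e (cnj (Z k i) * Z k j))"
          using True unfolding matrix_algebra_def
          by simp (rule A.add.finprod_cong', auto simp: W_def scalars_simps)
        then show ?thesis using True M Z by (simp add: finsum_scalars)
      next
        case False
        then show ?thesis
          using X0[OF False] by (auto simp: matrix_algebra_def scalars_simps B.state_zero[OF \<phi>])
      qed
    qed
    ultimately show ?thesis unfolding positive_def by blast
  qed
  then show ?thesis using lin by (simp add: completely_positive_def)
qed

lemma star_hom_unit_embedding:
  assumes B: "star_algebra B" and u: "is_unit B u"
  shows "star_hom A B (\<lambda>x. inv_into UNIV e x \<odot>\<^bsub>B\<^esub> u)"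
proof -
  interpret B: star_algebra B by fact
  have uc: "u \<in> carrier B" "u \<otimes>\<^bsub>B\<^esub> u = u" using u by (auto simp: is_unit_def)
  show ?thesis
    unfolding star_hom_def linear_on_def
    using uc inj by (auto simp: scalars_simps B.scale_add_left B.star_unit[OF u] mult.commute)
qed

end

text \<open>The case of 1 by 1 matrices, identified with elements through their single
  entry.\<close>

lemma positive_image_if_completely_positive:
  assumes A: "star_algebra A" and B: "star_algebra B" and f: "completely_positive A B f"
    and a: "positive A a"
  shows "positive B (f a)"
proof -
  interpret A: star_algebra A by fact
  interpret B: star_algebra B by fact
  have f0: "f \<zero>\<^bsub>A\<^esub> = \<zero>\<^bsub>B\<^esub>"
  proof -
    have "f (0 \<odot>\<^bsub>A\<^esub> \<zero>\<^bsub>A\<^esub>) = 0 \<odot>\<^bsub>B\<^esub> f \<zero>\<^bsub>A\<^esub>" "f \<zero>\<^bsub>A\<^esub> \<in> carrier B"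
      using f A.zero_closed unfolding completely_positive_def linear_on_def by blast+
    then show ?thesis by simp
  qed
  obtain b where b: "b \<in> carrier A" "a = star A b \<otimes>\<^bsub>A\<^esub> b" using a by (auto simp: positive_def)
  let ?m = "\<lambda>x i j. if i < Suc 0 \<and> j < Suc 0 then x else \<zero>\<^bsub>A\<^esub>"
  have "?m b \<in> carrier (matrix_algebra 1 A)" using b by (simp add: matrix_algebra_def)
  moreover have "?m a = star (matrix_algebra 1 A) (?m b) \<otimes>\<^bsub>matrix_algebra 1 A\<^esub> ?m b"
    using b by (auto simp: matrix_algebra_def fun_eq_iff lessThan_Suc)
  ultimately have "positive (matrix_algebra 1 A) (?m a)" unfolding positive_def by blast
  then have "positive (matrix_algebra 1 B) (\<lambda>i j. f (?m a i j))"
    using f unfolding completely_positive_def by blast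
  then obtain Y where Y: "Y \<in> carrier (matrix_algebra 1 B)"
    and eq: "(\<lambda>i j. f (?m a i j)) = star (matrix_algebra 1 B) Y \<otimes>\<^bsub>matrix_algebra 1 B\<^esub> Y"
    unfolding positive_def by blast
  have Y0: "Y 0 0 \<in> carrier B" using Y by (force simp: matrix_algebra_def)
  have "f a = star B (Y 0 0) \<otimes>\<^bsub>B\<^esub> Y 0 0"
    using fun_cong[OF fun_cong[OF eq, of 0], of 0] Y0 by (simp add: matrix_algebra_def lessThan_Suc)
  then show ?thesis using Y0 by (auto simp: positive_def)
qed

section \<open>Crossed product functors\<close>

context crossed_product_functor
begin

text \<open>\<open>alg_in\<close> is the embedding into the universal completion followed by the
  quotient map q. The unit survives both steps. Density holds in the completion by construction and
  passes on because q is surjective and contractive. The unit of A enters through the common bound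
  on the C*-seminorms.\<close>

lemma
  assumes A: "g_cstar G A" and u: "is_unit A u"
  shows star_hom_alg_in: "star_hom (alg_crossed_product G A) (obj \<mu> A) (alg_in G \<mu> A)"
    and is_unit_alg_in: "is_unit (obj \<mu> A) (alg_in G \<mu> A (g_cstar.single A \<one>\<^bsub>G\<^esub> u))"
    and alg_in_dense: "x \<in> carrier (obj \<mu> A) \<Longrightarrow>
      \<exists>f. (\<forall>n. f n \<in> carrier (alg_crossed_product G A)) \<and>
        (\<lambda>n. cnorm (obj \<mu> A) (x \<ominus>\<^bsub>obj \<mu> A\<^esub> alg_in G \<mu> A (f n))) \<longlonglongrightarrow> 0"
proof -
  interpret A: g_cstar G A by fact
  let ?p = "universal_norm G A"
  let ?U = "completion A.T ?p"
  interpret T: seminormed_star_algebra A.T ?p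
    by unfold_locales (rule A.cstar_seminorm_universal_norm[OF u])
  interpret U: cstar_algebra ?U by (rule T.cstar_algebra_completion)
  interpret D: cstar_algebra "obj \<mu> A" by (rule obj_cstar[OF A.g_cstar_algebra])
  have surj: "surj_star_hom ?U (obj \<mu> A) (from_universal \<mu> A)"
    using from_universal_surj[OF A.g_cstar_algebra] by (simp add: universal_crossed_product_def)
  then have hom: "star_hom ?U (obj \<mu> A) (from_universal \<mu> A)"
    and im: "from_universal \<mu> A ` carrier ?U = carrier (obj \<mu> A)"
    by (auto simp: surj_star_hom_def)
  have alg_in: "alg_in G \<mu> A = from_universal \<mu> A \<circ> completion_in A.T ?p"
    by (simp add: alg_in_def fun_eq_iff)
  have uU: "is_unit ?U (completion_in A.T ?p (A.single \<one>\<^bsub>G\<^esub> u))"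
    by (rule T.is_unit_completion_in[OF A.is_unit_single[OF u]])
  show "star_hom A.T (obj \<mu> A) (alg_in G \<mu> A)"
    unfolding alg_in by (rule star_hom_comp[OF T.star_hom_completion_in hom])
  show "is_unit (obj \<mu> A) (alg_in G \<mu> A (A.single \<one>\<^bsub>G\<^esub> u))"
    unfolding alg_in o_def by (rule is_unit_surj_image[OF surj uU])
  assume "x \<in> carrier (obj \<mu> A)"
  then obtain X where X: "X \<in> carrier ?U" "x = from_universal \<mu> A X" using im by blast
  obtain f where f: "f \<in> cauchy_seqs A.T ?p" "X = T.seq_class f"
    using T.completion_cases[OF X(1)] by blast
  note fc = T.cauchy_closed[OF f(1)]
  have "(\<lambda>n. cnorm (obj \<mu> A) (x \<ominus>\<^bsub>obj \<mu> A\<^esub> alg_in G \<mu> A (f n))) \<longlonglongrightarrow> 0"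
  proof (rule tendsto_sandwich[OF _ _ tendsto_const T.completion_in_tendsto[OF f(1)]])
    have "cnorm (obj \<mu> A) (x \<ominus>\<^bsub>obj \<mu> A\<^esub> alg_in G \<mu> A (f n))
        \<le> cnorm ?U (X \<ominus>\<^bsub>?U\<^esub> completion_in A.T ?p (f n))" for n
      using star_hom_contractive[OF U.cstar_algebra_axioms D.cstar_algebra_axioms hom uU,
          of "X \<ominus>\<^bsub>?U\<^esub> completion_in A.T ?p (f n)"]
        star_hom_diff[OF U.star_algebra_axioms D.star_algebra_axioms hom X(1) T.completion_in_closed[OF fc]]
        X T.completion_in_closed[OF fc] by (simp add: alg_in)
    then show "\<forall>\<^sub>F n in sequentially. cnorm (obj \<mu> A) (x \<ominus>\<^bsub>obj \<mu> A\<^esub> alg_in G \<mu> A (f n))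
        \<le> cnorm ?U (T.seq_class f \<ominus>\<^bsub>?U\<^esub> completion_in A.T ?p (f n))"
      using f(2) by simp
    have "x \<in> carrier (obj \<mu> A)" "alg_in G \<mu> A (f n) \<in> carrier (obj \<mu> A)" for n
      using X star_hom_simps(1)[OF hom] T.completion_in_closed[OF fc] by (auto simp: alg_in)
    then show "\<forall>\<^sub>F n in sequentially. 0 \<le> cnorm (obj \<mu> A) (x \<ominus>\<^bsub>obj \<mu> A\<^esub> alg_in G \<mu> A (f n))"
      by simp
  qed
  then show "\<exists>f. (\<forall>n. f n \<in> carrier A.T) \<and>
      (\<lambda>n. cnorm (obj \<mu> A) (x \<ominus>\<^bsub>obj \<mu> A\<^esub> alg_in G \<mu> A (f n))) \<longlonglongrightarrow> 0"
    using fc by blast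
qed

text \<open>The link between \<open>mor\<close> and composition with \<open>h\<close> is naturality
  of q: it reduces \<open>mor\<close> to \<open>universal_map\<close>, which sends the class of the
  constant sequence f to that of \<open>h \<circ> f\<close>.\<close>

lemma mor_alg_in:
  assumes A: "g_cstar G A" and B: "g_cstar G B" and u: "is_unit A u" and v: "is_unit B v"
    and h: "star_hom A B h" and eq: "equivariant G A B h"
    and f: "f \<in> carrier (alg_crossed_product G A)"
  shows "mor \<mu> A B h (alg_in G \<mu> A f) = alg_in G \<mu> B (h \<circ> f)"
proof -
  interpret A: g_cstar G A by fact
  interpret B: g_cstar G B by fact
  interpret TA: seminormed_star_algebra A.T "universal_norm G A"
    by unfold_locales (rule A.cstar_seminorm_universal_norm[OF u])
  interpret TB: seminormed_star_algebra B.T "universal_norm G B"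
    by unfold_locales (rule B.cstar_seminorm_universal_norm[OF v])
  have "g_morphism G A B h"
    using A.g_cstar_algebra B.g_cstar_algebra h eq by (simp add: g_morphism_def)
  then have "mor \<mu> A B h (alg_in G \<mu> A f)
      = from_universal \<mu> B (universal_map G B h (completion_in A.T (universal_norm G A) f))"
    unfolding alg_in_def
    using f by (intro from_universal_natural) (simp_all add: universal_crossed_product_def)
  also have "universal_map G B h (completion_in A.T (universal_norm G A) f)
      = completion_in B.T (universal_norm G B) (h \<circ> f)"
    unfolding universal_map_def
    by (intro completion_map_completion_in[OF TA.seminormed_star_algebra_axioms
          TB.seminormed_star_algebra_axioms star_hom_alg_crossed_product[OF A B h eq] _ f]
        universal_norm_comp_le[OF A B h eq u])
  finally show ?thesis by (simp add: alg_in_def)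
qed

end

theorem proposition2p13:
  fixes G :: "('g, 'k) monoid_scheme"
    and \<mu> :: "('a, 'g, 'v) crossed_product"
    and e :: "complex \<Rightarrow> 'a"
    and A :: "('a, 'g) g_cstar_algebra"
    and \<phi> :: "'a \<Rightarrow> complex"
  assumes "group G"
    and "correspondence_functor G \<mu>"
    and "inj e"
    and "g_cstar_algebra G A"
    and "unital A"
    and "invariant_state G A \<phi>"
  shows "\<forall>x\<in>carrier (group_cstar_algebra \<mu> e).
           cnorm (obj \<mu> A) (canonical_map \<mu> e A x) = cnorm (group_cstar_algebra \<mu> e) x"
proof -
  interpret G: group G by fact
  interpret \<mu>: correspondence_functor G \<mu> by fact
  let ?S = "scalars e :: ('a, 'g) g_cstar_algebra"
  have gS: "g_cstar G ?S" and gA: "g_cstar G A"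
    using g_cstar_algebra_scalars[OF assms(3)] assms(1,4)
    by (simp_all add: g_cstar_def g_cstar_axioms_def) (simp_all add: g_cstar_algebra_def)
  interpret S: g_cstar G ?S by (rule gS)
  interpret A: g_cstar G A by (rule gA)
  let ?B = "obj \<mu> ?S" and ?D = "obj \<mu> A"
  interpret B: cstar_algebra ?B by (rule \<mu>.obj_cstar[OF S.g_cstar_algebra])
  interpret D: cstar_algebra ?D by (rule \<mu>.obj_cstar[OF A.g_cstar_algebra])
  let ?u = "\<one>\<^bsub>A\<^esub>"
  have u: "is_unit A ?u" using assms(5) by (simp add: unital_def is_unit_def)
  note uS = is_unit_scalars[OF assms(3)]
  have \<phi>: "state A \<phi>" and inv: "\<And>s x. \<lbrakk>s \<in> carrier G; x \<in> carrier A\<rbrakk> \<Longrightarrow> \<phi> (act A s x) = \<phi> x"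
    using assms(6) by (auto simp: invariant_state_def)
  define \<theta> where "\<theta> z = inv_into UNIV e z \<odot>\<^bsub>A\<^esub> ?u" for z
  have \<theta>: "star_hom ?S A \<theta>"
    using star_hom_unit_embedding[OF assms(3) A.star_algebra_axioms u] unfolding \<theta>_def[abs_def] .
  have \<theta>_eq: "equivariant G ?S A \<theta>"
    using A.act_unit[OF u] u by (simp add: equivariant_def \<theta>_def scalars_def is_unit_def)
  define \<iota> where "\<iota> = mor \<mu> ?S A \<theta>"
  have \<iota>: "star_hom ?B ?D \<iota>"
    unfolding \<iota>_def
    using S.g_cstar_algebra A.g_cstar_algebra \<theta> \<theta>_eq by (intro \<mu>.mor_hom) (simp add: g_morphism_def)
  let ?jB = "alg_in G \<mu> ?S" and ?jA = "alg_in G \<mu> A"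
  note jB = \<mu>.star_hom_alg_in[OF gS uS] and jA = \<mu>.star_hom_alg_in[OF gA u]
  have \<iota>j: "\<iota> (?jB f) = ?jA (\<theta> \<circ> f)" if "f \<in> carrier S.T" for f
    unfolding \<iota>_def by (rule \<mu>.mor_alg_in[OF gS gA uS u \<theta> \<theta>_eq that])
  note \<theta>T = star_hom_alg_crossed_product[OF gS gA \<theta> \<theta>_eq]
  let ?\<delta> = "S.single \<one>\<^bsub>G\<^esub> (e 1)"
  have \<delta>: "?\<delta> \<in> carrier S.T" using S.is_unit_single[OF uS] by (simp add: is_unit_def)
  note uB = \<mu>.is_unit_alg_in[OF gS uS]
  \<comment> \<open>\<iota> is unital, so the image of 1 - k^2 is formed with the unit of the
    target, where \<open>unit_circle_completion\<close> applies.\<close>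
  have "\<theta> \<circ> ?\<delta> = A.single \<one>\<^bsub>G\<^esub> ?u"
    using u assms(3) star_hom_zero[OF S.star_algebra_axioms A.star_algebra_axioms \<theta>]
    by (auto simp: S.single_def A.single_def fun_eq_iff \<theta>_def is_unit_def)
  then have uD: "is_unit ?D (\<iota> (?jB ?\<delta>))"
    using \<mu>.is_unit_alg_in[OF gA u] \<iota>j[OF \<delta>] by simp
  have "completely_positive A ?S (\<lambda>x. e (\<phi> x))"
    by (rule completely_positive_state[OF assms(3) A.cstar_algebra_axioms u \<phi>])
  moreover have "equivariant G A ?S (\<lambda>x. e (\<phi> x))"
    using inv by (simp add: equivariant_def scalars_def)
  ultimately obtain \<Phi> where \<Phi>: "completely_positive ?D ?B \<Phi>"
    and \<Phi>j: "\<And>f. f \<in> carrier A.T \<Longrightarrow> \<Phi> (?jA f) = ?jB ((\<lambda>x. e (\<phi> x)) \<circ> f)"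
    using \<mu>.cp_functorial[OF A.g_cstar_algebra S.g_cstar_algebra] by blast
  have \<Phi>\<iota>: "\<Phi> (\<iota> (?jB f)) = ?jB f" if f: "f \<in> carrier S.T" for f
  proof -
    \<comment> \<open>\<phi>(w 1) = w for a scalar w because \<phi>(1) = 1: the state retracts the
      unital embedding.\<close>
    have "e (\<phi> (\<theta> z)) = z" if "z \<in> carrier ?S" for z
    proof -
      obtain w where "z = e w" using \<open>z \<in> carrier ?S\<close> by (auto simp: scalars_def)
      then show ?thesis
        using A.state_unit[OF \<phi> u] state_simps(2)[OF \<phi>] u assms(3) by (simp add: \<theta>_def is_unit_def)
    qed
    then have "(\<lambda>x. e (\<phi> x)) \<circ> (\<theta> \<circ> f) = f" using S.algD(1)[OF f] by (simp add: fun_eq_iff)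
    then show ?thesis using \<Phi>j[OF star_hom_simps(1)[OF \<theta>T f]] \<iota>j[OF f] by simp
  qed
  have unit_ball: "cnorm ?B (?jB k) \<le> 1"
    if k: "k \<in> carrier S.T" "star ?B (?jB k) = ?jB k" and le: "cnorm ?D (\<iota> (?jB k)) \<le> 1" for k
  proof -
    have kB: "?jB k \<in> carrier ?B" by (rule star_hom_simps(1)[OF jB k(1)])
    have kD: "\<iota> (?jB k) \<in> carrier ?D" "star ?D (\<iota> (?jB k)) = \<iota> (?jB k)"
      using star_hom_simps(1,5)[OF \<iota> kB] k(2) by simp_all
    \<comment> \<open>1 - k^2 is formed in the convolution algebra, since \<Phi> is known to undo
      \<iota> only on its image.\<close>
    let ?m = "?\<delta> \<ominus>\<^bsub>S.T\<^esub> k \<otimes>\<^bsub>S.T\<^esub> k"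
    have m: "?m \<in> carrier S.T" using \<delta> k by simp
    have jm: "?jB ?m = ?jB ?\<delta> \<ominus>\<^bsub>?B\<^esub> ?jB k \<otimes>\<^bsub>?B\<^esub> ?jB k"
      using star_hom_diff[OF S.star_algebra_alg B.star_algebra_axioms jB \<delta> S.conv_closed[OF k(1) k(1)]]
        star_hom_simps(4)[OF jB k(1) k(1)] by simp
    have "\<iota> (?jB ?m) = \<iota> (?jB ?\<delta>) \<ominus>\<^bsub>?D\<^esub> \<iota> (?jB k) \<otimes>\<^bsub>?D\<^esub> \<iota> (?jB k)"
      unfolding jm
      using star_hom_diff[OF B.star_algebra_axioms D.star_algebra_axioms \<iota>
          star_hom_simps(1)[OF jB \<delta>] B.mult_closed[OF kB kB]] star_hom_simps(4)[OF \<iota> kB kB] by simp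
    then have "positive ?D (\<iota> (?jB ?m))"
      using D.unit_circle_completion[OF uD kD le] unfolding positive_def by metis
    then have "positive ?B (?jB ?m)"
      using positive_image_if_completely_positive[OF D.star_algebra_axioms B.star_algebra_axioms \<Phi>]
        \<Phi>\<iota>[OF m] by metis
    then show ?thesis
      unfolding jm by (rule B.norm_le_one_if_positive[OF uB kB k(2)])
  qed
  have on_alg: "cnorm ?B (?jB f) \<le> cnorm ?D (\<iota> (?jB f))" if f: "f \<in> carrier S.T" for f
  proof -
    have fB: "?jB f \<in> carrier ?B" by (rule star_hom_simps(1)[OF jB f])
    have fD: "\<iota> (?jB f) \<in> carrier ?D" by (rule star_hom_simps(1)[OF \<iota> fB])
    let ?h = "star S.T f \<otimes>\<^bsub>S.T\<^esub> f"
    have h: "?h \<in> carrier S.T" using f by simp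
    have jh: "?jB ?h = star ?B (?jB f) \<otimes>\<^bsub>?B\<^esub> ?jB f"
      using star_hom_simps(4,5)[OF jB] f by simp
    have \<iota>h: "\<iota> (?jB ?h) = star ?D (\<iota> (?jB f)) \<otimes>\<^bsub>?D\<^esub> \<iota> (?jB f)"
      unfolding jh using star_hom_simps(4,5)[OF \<iota>] fB by simp
    have hB: "?jB ?h \<in> carrier ?B" "star ?B (?jB ?h) = ?jB ?h" unfolding jh using fB by simp_all
    have "(cnorm ?B (?jB f))\<^sup>2 \<le> (cnorm ?D (\<iota> (?jB f)))\<^sup>2"
    proof (rule field_le_epsilon)
      fix \<epsilon> :: real assume \<epsilon>: "\<epsilon> > 0"
      \<comment> \<open>\<open>unit_ball\<close> will be applied to f* f / t; the slack makes t
        positive even if \<iota> sends f to 0.\<close>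
      define t where "t = (cnorm ?D (\<iota> (?jB f)))\<^sup>2 + \<epsilon>"
      have t: "t > 0" using \<epsilon> by (simp add: t_def add_nonneg_pos)
      let ?k = "of_real (1 / t) \<odot>\<^bsub>S.T\<^esub> ?h"
      have jk: "?jB ?k = of_real (1 / t) \<odot>\<^bsub>?B\<^esub> ?jB ?h" by (rule star_hom_simps(3)[OF jB h])
      have \<iota>k: "\<iota> (?jB ?k) = of_real (1 / t) \<odot>\<^bsub>?D\<^esub> \<iota> (?jB ?h)"
        unfolding jk by (rule star_hom_simps(3)[OF \<iota> hB(1)])
      have "cnorm ?B (?jB ?k) \<le> 1"
      proof (rule unit_ball)
        show "?k \<in> carrier S.T" using h by (rule S.alg.scale_closed)
        show "star ?B (?jB ?k) = ?jB ?k" unfolding jk using hB by simp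
        have "cnorm ?D (\<iota> (?jB ?k)) = (cnorm ?D (\<iota> (?jB f)))\<^sup>2 / t"
          unfolding \<iota>k \<iota>h using fD t by (simp add: D.p_cstar norm_divide)
        then show "cnorm ?D (\<iota> (?jB ?k)) \<le> 1" using t \<epsilon> by (simp add: t_def)
      qed
      moreover have "cnorm ?B (?jB ?k) = (cnorm ?B (?jB f))\<^sup>2 / t"
        unfolding jk jh using fB t by (simp add: B.p_cstar norm_divide)
      ultimately show "(cnorm ?B (?jB f))\<^sup>2 \<le> (cnorm ?D (\<iota> (?jB f)))\<^sup>2 + \<epsilon>"
        using t by (simp flip: t_def)
    qed
    then show ?thesis by (rule power2_le_imp_le) (use fD in simp)
  qed
  note contr = star_hom_contractive[OF B.cstar_algebra_axioms D.cstar_algebra_axioms \<iota> uB]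
  \<comment> \<open>The limit argument uses only \<iota>, which is contractive as a star
    homomorphism; \<Phi>, whose continuity is not assumed, no longer occurs.\<close>
  have "cnorm ?D (\<iota> x) = cnorm ?B x" if x: "x \<in> carrier ?B" for x
  proof (rule order_antisym[OF contr[OF x]])
    obtain f where f: "\<And>n. f n \<in> carrier S.T"
      and lim: "(\<lambda>n. cnorm ?B (x \<ominus>\<^bsub>?B\<^esub> ?jB (f n))) \<longlonglongrightarrow> 0"
      using \<mu>.alg_in_dense[OF gS uS x] by blast
    note fB = star_hom_simps(1)[OF jB f]
    have "B.tends (\<lambda>n. ?jB (f n)) x"
      using lim x fB B.p_diff_commute[OF x fB] by (simp add: B.tends_def)
    then have limB: "(\<lambda>n. cnorm ?B (?jB (f n))) \<longlonglongrightarrow> cnorm ?B x" by (rule B.tends_norm)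
    have "D.tends (\<lambda>n. \<iota> (?jB (f n))) (\<iota> x)"
    proof (rule D.tendsI)
      show "cnorm ?D (\<iota> (?jB (f n)) \<ominus>\<^bsub>?D\<^esub> \<iota> x) \<le> cnorm ?B (x \<ominus>\<^bsub>?B\<^esub> ?jB (f n))" for n
        using contr[OF B.minus_closed[OF fB x], of n] B.p_diff_commute[OF x fB, of n]
          star_hom_diff[OF B.star_algebra_axioms D.star_algebra_axioms \<iota> fB x, of n] by simp
    qed (use lim star_hom_simps(1)[OF \<iota>] fB x in simp_all)
    then have limD: "(\<lambda>n. cnorm ?D (\<iota> (?jB (f n)))) \<longlonglongrightarrow> cnorm ?D (\<iota> x)" by (rule D.tends_norm)
    show "cnorm ?B x \<le> cnorm ?D (\<iota> x)"
      by (rule LIMSEQ_le[OF limB limD]) (use on_alg[OF f] in blast)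
  qed
  then show ?thesis
    by (simp add: group_cstar_algebra_def canonical_map_def \<iota>_def \<theta>_def[abs_def])
qed

end
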